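(* Let $\Bbbk$ be an algebraically closed field and $\mathscr{C}$ a locally-finite, pivotal, abelian, tensor $\Bbbk$-category with enough projectives. Let $P$ be an indecomposable projective object in $\mathscr{C}$. Then the corresponding trace tuple $(P,\alpha,\beta,\eta,\epsilon)$ and its associated right $(\alpha,\beta)$-trace $\mathsf{t}$ make the full subcategory $\mathcal{P}roj(\mathscr{C})$ of projective objects into an $(F_\alpha,F_\beta)$-twisted Calabi-Yau category, where $F_X$ denotes the endofunctor $X\otimes -$.
   Context: Composition of morphisms is written $fg=f\circ g$. A pivotal tensor $\Bbbk$-category is a strict monoidal category $\mathscr{C}$ that is additive, with hom-sets $\Bbbk$-modules and with $\Bbbk$-bilinear composition and tensor product, such that $\Bbbk\to\operatorname{End}_{\mathscr{C}}(\mathbf{1})$, $k\mapsto k\operatorname{Id}_{\mathbf 1}$, is an isomorphism ($\mathbf 1$ is the unit object), and such that each object $V$ has a dual $V^*$ with morphisms $\operatorname{coev}_V:\mathbf 1\to V\otimes V^*$, $\operatorname{ev}_V:V^*\otimes V\to\mathbf 1$ and $\widetilde{\operatorname{coev}}_V:\mathbf 1\to V^*\otimes V$, $\widetilde{\operatorname{ev}}_V:V\otimes V^*\to\mathbf 1$ satisfying the zig-zag identities (left and right duality), for which the left and right duals of each morphism coincide and the two canonical isomorphisms $W^*\otimes V^*\to (V\otimes W)^*$ coincide (these are taken to be identities). Locally-finite: every $\operatorname{Hom}_{\mathscr{C}}(X,Y)$ has finite length over $\Bbbk$ and every object has finite length. Enough projectives: every object has a projective cover. Twisted Calabi-Yau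 category: for endofunctors $F,G$ of a $\Bbbk$-linear category $\mathscr{D}$, $\mathscr{D}$ is $(F,G)$-twisted Calabi-Yau if it is equipped with $\Bbbk$-linear maps $\mathsf{t}_U:\operatorname{Hom}_{\mathscr{D}}(F(U),G(U))\to\Bbbk$, $U\in\mathscr{D}$, such that (1) for all $U,V\in\mathscr{D}$ the pairing $\operatorname{Hom}_{\mathscr{D}}(V,G(U))\times\operatorname{Hom}_{\mathscr{D}}(F(U),V)\to\Bbbk$, $(g,f)\mapsto\mathsf{t}_U(gf)$, is non-degenerate; (2) $\mathsf{t}_V(G(g)f)=\mathsf{t}_U(fF(g))$ for all $U,V\in\mathscr{D}$, $f:F(V)\to G(U)$, $g:U\to V$. Trace tuple: $(P,\alpha,\beta,\eta,\epsilon)$ with $\eta:\alpha\to P$, $\epsilon:P\to\beta$ nonzero such that $\operatorname{End}_{\mathscr{C}}(P)/\operatorname{J}(\operatorname{End}_{\mathscr{C}}(P))\cong\Bbbk$ with the Jacobson radical $\operatorname{J}(\operatorname{End}_{\mathscr{C}}(P))$ nilpotent, and $\operatorname{Hom}_{\mathscr{C}}(\alpha,P)=\Bbbk\eta$, $\operatorname{Hom}_{\mathscr{C}}(P,\beta)=\Bbbk\epsilon$ (free of rank one). For an indecomposable projective $P$ (which is the projective cover of a simple object), the corresponding trace tuple has $\beta$ the unique simple quotient of $P$, $\alpha$ the unique simple subobject (socle) of $P$, $\epsilon:P\to\beta$ a projection and $\eta:\alpha\to P$ an inclusion. Right partial trace: for $g\in\operatorname{Hom}_{\mathscr{C}}(V\otimes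 W,X\otimes W)$, $\operatorname{tr}_r^W(g)=(\operatorname{Id}_X\otimes\widetilde{\operatorname{ev}}_W)(g\otimes\operatorname{Id}_{W^*})(\operatorname{Id}_V\otimes\operatorname{coev}_W)$. Associated right $(\alpha,\beta)$-trace: every projective $V$ admits $\sigma_V:P\otimes V\to\alpha\otimes V$ with $\sigma_V(\eta\otimes\operatorname{Id}_V)=\operatorname{Id}_{\alpha\otimes V}$ and $\tau_V:\beta\otimes V\to P\otimes V$ with $(\epsilon\otimes\operatorname{Id}_V)\tau_V=\operatorname{Id}_{\beta\otimes V}$, and for $f\in\operatorname{Hom}_{\mathscr{C}}(\alpha\otimes V,\beta\otimes V)$ one sets $\mathsf{t}_V(f)=\langle\operatorname{tr}_r^V(\tau_Vf)\rangle_\eta=\langle\operatorname{tr}_r^V(f\sigma_V)\rangle_\epsilon$ (independent of choices), where $g=\langle g\rangle_\eta\eta$ for $g\in\operatorname{Hom}_{\mathscr{C}}(\alpha,P)$ and $h=\langle h\rangle_\epsilon\epsilon$ for $h\in\operatorname{Hom}_{\mathscr{C}}(P,\beta)$. *)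

theory Defs
  imports
    "HOL-Algebra.Module"
    "HOL-Algebra.QuotRing"
    "HOL-Algebra.Algebraic_Closure_Type"
begin

text \<open>
  The base ring is a type \<open>'k\<close>, seen as a HOL-Algebra ring through
  \<^const>\<open>ring_of_type_algebra\<close>.  Each hom-set is the carrier of a HOL-Algebra module
  (whose unused fields \<open>mult\<close> and \<open>one\<close> are arbitrary).

  Composition and tensor product of morphisms carry no object arguments.  This costs no
  generality, since morphisms can be tagged with their source and target; disjointness of the
  hom-sets is not needed and not imposed.  Values outside the hom-sets are irrelevant.
\<close>

section \<open>Modules and rings\<close>

definition linear_map :: "('k::comm_ring_1, 'a) module \<Rightarrow> ('k, 'b) module \<Rightarrow> ('a \<Rightarrow> 'b) \<Rightarrow> bool" where
  "linear_map M N \<phi> \<longleftrightarrow>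
     (\<forall>x\<in>carrier M. \<phi> x \<in> carrier N) \<and>
     (\<forall>x\<in>carrier M. \<forall>y\<in>carrier M. \<phi> (x \<oplus>\<^bsub>M\<^esub> y) = \<phi> x \<oplus>\<^bsub>N\<^esub> \<phi> y) \<and>
     (\<forall>c. \<forall>x\<in>carrier M. \<phi> (c \<odot>\<^bsub>M\<^esub> x) = c \<odot>\<^bsub>N\<^esub> \<phi> x)"

definition linear_functional :: "('k::comm_ring_1, 'a) module \<Rightarrow> ('a \<Rightarrow> 'k) \<Rightarrow> bool" where
  "linear_functional M \<phi> \<longleftrightarrow>
     (\<forall>x\<in>carrier M. \<forall>y\<in>carrier M. \<phi> (x \<oplus>\<^bsub>M\<^esub> y) = \<phi> x + \<phi> y) \<and>
     (\<forall>c. \<forall>x\<in>carrier M. \<phi> (c \<odot>\<^bsub>M\<^esub> x) = c * \<phi> x)"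

text \<open>Finite length: existence of a composition series.\<close>

definition finite_length_module :: "('k, 'r) ring_scheme \<Rightarrow> ('k, 'a) module \<Rightarrow> bool" where
  "finite_length_module R M \<longleftrightarrow>
     (\<exists>(n::nat) N. N 0 = {\<zero>\<^bsub>M\<^esub>} \<and> N n = carrier M \<and>
        (\<forall>i\<le>n. submodule (N i) R M) \<and>
        (\<forall>i<n. N i \<subset> N (Suc i) \<and>
           \<not> (\<exists>L. submodule L R M \<and> N i \<subset> L \<and> L \<subset> N (Suc i))))"

definition left_ideal :: "'a set \<Rightarrow> ('a, 'r) ring_scheme \<Rightarrow> bool" where
  "left_ideal I R \<longleftrightarrow>
     additive_subgroup I R \<and> (\<forall>a\<in>carrier R. \<forall>x\<in>I. a \<otimes>\<^bsub>R\<^esub> x \<in> I)"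

definition maximal_left_ideal :: "'a set \<Rightarrow> ('a, 'r) ring_scheme \<Rightarrow> bool" where
  "maximal_left_ideal I R \<longleftrightarrow>
     left_ideal I R \<and> I \<noteq> carrier R \<and>
     (\<forall>L. left_ideal L R \<longrightarrow> I \<subseteq> L \<longrightarrow> L = I \<or> L = carrier R)"

definition jacobson_radical :: "('a, 'r) ring_scheme \<Rightarrow> 'a set" where
  "jacobson_radical R = {x \<in> carrier R. \<forall>I. maximal_left_ideal I R \<longrightarrow> x \<in> I}"

text \<open>\<open>I\<^sup>n = 0\<close> for some \<open>n\<close>: all products of \<open>n\<close> elements of \<open>I\<close> vanish.\<close>

definition nilpotent_ideal :: "'a set \<Rightarrow> ('a, 'r) ring_scheme \<Rightarrow> bool" where
  "nilpotent_ideal I R \<longleftrightarrow>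
     (\<exists>n. \<forall>xs. length xs = n \<and> set xs \<subseteq> I \<longrightarrow> foldr (\<otimes>\<^bsub>R\<^esub>) xs \<one>\<^bsub>R\<^esub> = \<zero>\<^bsub>R\<^esub>)"

section \<open>Linear categories\<close>

text \<open>\<open>g \<cdot> f\<close> is \<open>g\<close> after \<open>f\<close>.\<close>

record ('o, 'm, 'k) lin_cat =
  Ob :: "'o set"
  Hom :: "'o \<Rightarrow> 'o \<Rightarrow> ('k, 'm) module"
  ident :: "'o \<Rightarrow> 'm"
  cmp :: "'m \<Rightarrow> 'm \<Rightarrow> 'm" (infixl "\<cdot>\<index>" 70)

abbreviation Mor :: "('o, 'm, 'k, 'z) lin_cat_scheme \<Rightarrow> 'o \<Rightarrow> 'o \<Rightarrow> 'm set" where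
  "Mor C A Y \<equiv> carrier (Hom C A Y)"

locale linear_category =
  fixes C :: "('o, 'm, 'k::comm_ring_1, 'z) lin_cat_scheme" (structure)
  assumes Hom_module: "\<lbrakk>A \<in> Ob C; Y \<in> Ob C\<rbrakk> \<Longrightarrow>
      Module.module (ring_of_type_algebra :: 'k ring) (Hom C A Y)"
    and id_closed: "A \<in> Ob C \<Longrightarrow> ident C A \<in> Mor C A A"
    and cmp_linear_left: "\<lbrakk>A \<in> Ob C; Y \<in> Ob C; Z \<in> Ob C; f \<in> Mor C A Y\<rbrakk> \<Longrightarrow>
      linear_map (Hom C Y Z) (Hom C A Z) (\<lambda>g. g \<cdot> f)"
    and cmp_linear_right: "\<lbrakk>A \<in> Ob C; Y \<in> Ob C; Z \<in> Ob C; g \<in> Mor C Y Z\<rbrakk> \<Longrightarrow>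
      linear_map (Hom C A Y) (Hom C A Z) (\<lambda>f. g \<cdot> f)"
    and cmp_assoc: "\<lbrakk>W \<in> Ob C; A \<in> Ob C; Y \<in> Ob C; Z \<in> Ob C;
      f \<in> Mor C W A; g \<in> Mor C A Y; h \<in> Mor C Y Z\<rbrakk> \<Longrightarrow> (h \<cdot> g) \<cdot> f = h \<cdot> (g \<cdot> f)"
    and id_left: "\<lbrakk>A \<in> Ob C; Y \<in> Ob C; f \<in> Mor C A Y\<rbrakk> \<Longrightarrow> ident C Y \<cdot> f = f"
    and id_right: "\<lbrakk>A \<in> Ob C; Y \<in> Ob C; f \<in> Mor C A Y\<rbrakk> \<Longrightarrow> f \<cdot> ident C A = f"

definition full_subcategory ::
    "('o, 'm, 'k, 'z) lin_cat_scheme \<Rightarrow> ('o \<Rightarrow> bool) \<Rightarrow> ('o, 'm, 'k, 'z) lin_cat_scheme" where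
  "full_subcategory C Q = C\<lparr>Ob := {A \<in> Ob C. Q A}\<rparr>"

definition monomorphism :: "('o, 'm, 'k, 'z) lin_cat_scheme \<Rightarrow> 'o \<Rightarrow> 'o \<Rightarrow> 'm \<Rightarrow> bool" where
  "monomorphism C A Y m \<longleftrightarrow> A \<in> Ob C \<and> Y \<in> Ob C \<and> m \<in> Mor C A Y \<and>
     (\<forall>W\<in>Ob C. \<forall>f\<in>Mor C W A. \<forall>g\<in>Mor C W A. m \<cdot>\<^bsub>C\<^esub> f = m \<cdot>\<^bsub>C\<^esub> g \<longrightarrow> f = g)"

definition epimorphism :: "('o, 'm, 'k, 'z) lin_cat_scheme \<Rightarrow> 'o \<Rightarrow> 'o \<Rightarrow> 'm \<Rightarrow> bool" where
  "epimorphism C A Y e \<longleftrightarrow> A \<in> Ob C \<and> Y \<in> Ob C \<and> e \<in> Mor C A Y \<and>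
     (\<forall>Z\<in>Ob C. \<forall>f\<in>Mor C Y Z. \<forall>g\<in>Mor C Y Z. f \<cdot>\<^bsub>C\<^esub> e = g \<cdot>\<^bsub>C\<^esub> e \<longrightarrow> f = g)"

definition isomorphism :: "('o, 'm, 'k, 'z) lin_cat_scheme \<Rightarrow> 'o \<Rightarrow> 'o \<Rightarrow> 'm \<Rightarrow> bool" where
  "isomorphism C A Y f \<longleftrightarrow> A \<in> Ob C \<and> Y \<in> Ob C \<and> f \<in> Mor C A Y \<and>
     (\<exists>g\<in>Mor C Y A. g \<cdot>\<^bsub>C\<^esub> f = ident C A \<and> f \<cdot>\<^bsub>C\<^esub> g = ident C Y)"

definition zero_object :: "('o, 'm, 'k, 'z) lin_cat_scheme \<Rightarrow> 'o \<Rightarrow> bool" where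
  "zero_object C Z \<longleftrightarrow> Z \<in> Ob C \<and>
     (\<forall>A\<in>Ob C. (\<exists>!f. f \<in> Mor C A Z) \<and> (\<exists>!f. f \<in> Mor C Z A))"

definition is_biproduct ::
    "('o, 'm, 'k, 'z) lin_cat_scheme \<Rightarrow> 'o \<Rightarrow> 'o \<Rightarrow> 'o \<Rightarrow> 'm \<Rightarrow> 'm \<Rightarrow> 'm \<Rightarrow> 'm \<Rightarrow> bool" where
  "is_biproduct C B A Y i j p q \<longleftrightarrow>
     B \<in> Ob C \<and> A \<in> Ob C \<and> Y \<in> Ob C \<and>
     i \<in> Mor C A B \<and> j \<in> Mor C Y B \<and> p \<in> Mor C B A \<and> q \<in> Mor C B Y \<and>
     p \<cdot>\<^bsub>C\<^esub> i = ident C A \<and> q \<cdot>\<^bsub>C\<^esub> j = ident C Y \<and>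
     q \<cdot>\<^bsub>C\<^esub> i = \<zero>\<^bsub>Hom C A Y\<^esub> \<and> p \<cdot>\<^bsub>C\<^esub> j = \<zero>\<^bsub>Hom C Y A\<^esub> \<and>
     (i \<cdot>\<^bsub>C\<^esub> p) \<oplus>\<^bsub>Hom C B B\<^esub> (j \<cdot>\<^bsub>C\<^esub> q) = ident C B"

definition is_kernel ::
    "('o, 'm, 'k, 'z) lin_cat_scheme \<Rightarrow> 'o \<Rightarrow> 'o \<Rightarrow> 'm \<Rightarrow> 'o \<Rightarrow> 'm \<Rightarrow> bool" where
  "is_kernel C A Y f K i \<longleftrightarrow> K \<in> Ob C \<and> i \<in> Mor C K A \<and> f \<cdot>\<^bsub>C\<^esub> i = \<zero>\<^bsub>Hom C K Y\<^esub> \<and>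
     (\<forall>W\<in>Ob C. \<forall>g\<in>Mor C W A. f \<cdot>\<^bsub>C\<^esub> g = \<zero>\<^bsub>Hom C W Y\<^esub> \<longrightarrow>
        (\<exists>!h. h \<in> Mor C W K \<and> i \<cdot>\<^bsub>C\<^esub> h = g))"

definition is_cokernel ::
    "('o, 'm, 'k, 'z) lin_cat_scheme \<Rightarrow> 'o \<Rightarrow> 'o \<Rightarrow> 'm \<Rightarrow> 'o \<Rightarrow> 'm \<Rightarrow> bool" where
  "is_cokernel C A Y f Q q \<longleftrightarrow> Q \<in> Ob C \<and> q \<in> Mor C Y Q \<and> q \<cdot>\<^bsub>C\<^esub> f = \<zero>\<^bsub>Hom C A Q\<^esub> \<and>
     (\<forall>Z\<in>Ob C. \<forall>g\<in>Mor C Y Z. g \<cdot>\<^bsub>C\<^esub> f = \<zero>\<^bsub>Hom C A Z\<^esub> \<longrightarrow>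
        (\<exists>!h. h \<in> Mor C Q Z \<and> h \<cdot>\<^bsub>C\<^esub> q = g))"

locale additive_category = linear_category +
  assumes zero_object_exists: "\<exists>Z. zero_object C Z"
    and biproduct_exists: "\<lbrakk>A \<in> Ob C; Y \<in> Ob C\<rbrakk> \<Longrightarrow> \<exists>B i j p q. is_biproduct C B A Y i j p q"

locale abelian_category = additive_category +
  assumes kernel_exists: "\<lbrakk>A \<in> Ob C; Y \<in> Ob C; f \<in> Mor C A Y\<rbrakk> \<Longrightarrow> \<exists>K i. is_kernel C A Y f K i"
    and cokernel_exists: "\<lbrakk>A \<in> Ob C; Y \<in> Ob C; f \<in> Mor C A Y\<rbrakk> \<Longrightarrow> \<exists>Q q. is_cokernel C A Y f Q q"
    and mono_is_kernel: "monomorphism C A Y m \<Longrightarrow>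
      \<exists>Z\<in>Ob C. \<exists>f\<in>Mor C Y Z. is_kernel C Y Z f A m"
    and epi_is_cokernel: "epimorphism C A Y e \<Longrightarrow>
      \<exists>W\<in>Ob C. \<exists>f\<in>Mor C W A. is_cokernel C W A f Y e"

definition simple_object :: "('o, 'm, 'k, 'z) lin_cat_scheme \<Rightarrow> 'o \<Rightarrow> bool" where
  "simple_object C S \<longleftrightarrow> S \<in> Ob C \<and> \<not> zero_object C S \<and>
     (\<forall>A m. monomorphism C A S m \<longrightarrow> zero_object C A \<or> isomorphism C A S m)"

definition finite_length_object :: "('o, 'm, 'k, 'z) lin_cat_scheme \<Rightarrow> 'o \<Rightarrow> bool" where
  "finite_length_object C A \<longleftrightarrow>
     (\<exists>(n::nat) Y m. zero_object C (Y 0) \<and> Y n = A \<and>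
        (\<forall>i<n. monomorphism C (Y i) (Y (Suc i)) (m i) \<and>
           (\<exists>S q. is_cokernel C (Y i) (Y (Suc i)) (m i) S q \<and> simple_object C S)))"

definition locally_finite :: "('o, 'm, 'k::comm_ring_1, 'z) lin_cat_scheme \<Rightarrow> bool" where
  "locally_finite C \<longleftrightarrow>
     (\<forall>A\<in>Ob C. \<forall>Y\<in>Ob C. finite_length_module (ring_of_type_algebra :: 'k ring) (Hom C A Y)) \<and>
     (\<forall>A\<in>Ob C. finite_length_object C A)"

definition projective :: "('o, 'm, 'k, 'z) lin_cat_scheme \<Rightarrow> 'o \<Rightarrow> bool" where
  "projective C P \<longleftrightarrow> P \<in> Ob C \<and>
     (\<forall>A Y e. epimorphism C A Y e \<longrightarrow> (\<forall>f\<in>Mor C P Y. \<exists>g\<in>Mor C P A. e \<cdot>\<^bsub>C\<^esub> g = f))"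

text \<open>A projective cover is an essential epimorphism from a projective object.\<close>

definition projective_cover :: "('o, 'm, 'k, 'z) lin_cat_scheme \<Rightarrow> 'o \<Rightarrow> 'o \<Rightarrow> 'm \<Rightarrow> bool" where
  "projective_cover C P A p \<longleftrightarrow> projective C P \<and> epimorphism C P A p \<and>
     (\<forall>Q\<in>Ob C. \<forall>h\<in>Mor C Q P. epimorphism C Q A (p \<cdot>\<^bsub>C\<^esub> h) \<longrightarrow> epimorphism C Q P h)"

definition enough_projectives :: "('o, 'm, 'k, 'z) lin_cat_scheme \<Rightarrow> bool" where
  "enough_projectives C \<longleftrightarrow> (\<forall>A\<in>Ob C. \<exists>P p. projective_cover C P A p)"

definition indecomposable :: "('o, 'm, 'k, 'z) lin_cat_scheme \<Rightarrow> 'o \<Rightarrow> bool" where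
  "indecomposable C A \<longleftrightarrow> A \<in> Ob C \<and> \<not> zero_object C A \<and>
     (\<forall>Y Z i j p q. is_biproduct C A Y Z i j p q \<longrightarrow> zero_object C Y \<or> zero_object C Z)"

section \<open>Pivotal tensor categories\<close>

record ('o, 'm, 'k) piv_cat = "('o, 'm, 'k) lin_cat" +
  unit_ob :: 'o ("\<one>\<^sub>o\<index>")
  tensor_ob :: "'o \<Rightarrow> 'o \<Rightarrow> 'o" (infixr "\<otimes>\<^sub>o\<index>" 75)
  tensor_mor :: "'m \<Rightarrow> 'm \<Rightarrow> 'm" (infixr "\<otimes>\<^sub>m\<index>" 75)
  dual :: "'o \<Rightarrow> 'o"
  ev :: "'o \<Rightarrow> 'm"
  coev :: "'o \<Rightarrow> 'm"
  ev_tilde :: "'o \<Rightarrow> 'm"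
  coev_tilde :: "'o \<Rightarrow> 'm"

locale tensor_category = additive_category C
  for C :: "('o, 'm, 'k::comm_ring_1, 'z) piv_cat_scheme" (structure) +
  assumes unit_closed: "\<one>\<^sub>o \<in> Ob C"
    and tensor_ob_closed: "\<lbrakk>A \<in> Ob C; Y \<in> Ob C\<rbrakk> \<Longrightarrow> A \<otimes>\<^sub>o Y \<in> Ob C"
    and tensor_linear_left: "\<lbrakk>A \<in> Ob C; Y \<in> Ob C; V \<in> Ob C; W \<in> Ob C; g \<in> Mor C V W\<rbrakk> \<Longrightarrow>
      linear_map (Hom C A Y) (Hom C (A \<otimes>\<^sub>o V) (Y \<otimes>\<^sub>o W)) (\<lambda>f. f \<otimes>\<^sub>m g)"
    and tensor_linear_right: "\<lbrakk>A \<in> Ob C; Y \<in> Ob C; V \<in> Ob C; W \<in> Ob C; f \<in> Mor C A Y\<rbrakk> \<Longrightarrow>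
      linear_map (Hom C V W) (Hom C (A \<otimes>\<^sub>o V) (Y \<otimes>\<^sub>o W)) (\<lambda>g. f \<otimes>\<^sub>m g)"
    and tensor_id: "\<lbrakk>A \<in> Ob C; Y \<in> Ob C\<rbrakk> \<Longrightarrow> ident C A \<otimes>\<^sub>m ident C Y = ident C (A \<otimes>\<^sub>o Y)"
    and tensor_cmp: "\<lbrakk>A \<in> Ob C; Y \<in> Ob C; Z \<in> Ob C; U \<in> Ob C; V \<in> Ob C; W \<in> Ob C;
      f \<in> Mor C A Y; g \<in> Mor C Y Z; h \<in> Mor C U V; k \<in> Mor C V W\<rbrakk> \<Longrightarrow>
      (g \<cdot> f) \<otimes>\<^sub>m (k \<cdot> h) = (g \<otimes>\<^sub>m k) \<cdot> (f \<otimes>\<^sub>m h)"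
    and tensor_ob_assoc: "\<lbrakk>A \<in> Ob C; Y \<in> Ob C; Z \<in> Ob C\<rbrakk> \<Longrightarrow>
      (A \<otimes>\<^sub>o Y) \<otimes>\<^sub>o Z = A \<otimes>\<^sub>o (Y \<otimes>\<^sub>o Z)"
    and tensor_ob_unit_left: "A \<in> Ob C \<Longrightarrow> \<one>\<^sub>o \<otimes>\<^sub>o A = A"
    and tensor_ob_unit_right: "A \<in> Ob C \<Longrightarrow> A \<otimes>\<^sub>o \<one>\<^sub>o = A"
    and tensor_mor_assoc: "\<lbrakk>A \<in> Ob C; A' \<in> Ob C; Y \<in> Ob C; Y' \<in> Ob C; Z \<in> Ob C; Z' \<in> Ob C;
      f \<in> Mor C A A'; g \<in> Mor C Y Y'; h \<in> Mor C Z Z'\<rbrakk> \<Longrightarrow>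
      (f \<otimes>\<^sub>m g) \<otimes>\<^sub>m h = f \<otimes>\<^sub>m (g \<otimes>\<^sub>m h)"
    and tensor_mor_unit_left: "\<lbrakk>A \<in> Ob C; Y \<in> Ob C; f \<in> Mor C A Y\<rbrakk> \<Longrightarrow> ident C \<one>\<^sub>o \<otimes>\<^sub>m f = f"
    and tensor_mor_unit_right: "\<lbrakk>A \<in> Ob C; Y \<in> Ob C; f \<in> Mor C A Y\<rbrakk> \<Longrightarrow> f \<otimes>\<^sub>m ident C \<one>\<^sub>o = f"
    and scalars_End_unit:
      "bij_betw (\<lambda>c. c \<odot>\<^bsub>Hom C \<one>\<^sub>o \<one>\<^sub>o\<^esub> ident C \<one>\<^sub>o) UNIV (Mor C \<one>\<^sub>o \<one>\<^sub>o)"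

text \<open>
  For \<open>f : V \<rightarrow> W\<close>, the two dual morphisms \<open>W\<^sup>* \<rightarrow> V\<^sup>*\<close>, and the two canonical morphisms
  \<open>W\<^sup>* \<otimes> V\<^sup>* \<rightarrow> (V \<otimes> W)\<^sup>*\<close>, built from \<open>ev, coev\<close> and from their tilde versions respectively.
\<close>

definition left_dual_mor :: "('o, 'm, 'k, 'z) piv_cat_scheme \<Rightarrow> 'o \<Rightarrow> 'o \<Rightarrow> 'm \<Rightarrow> 'm" where
  "left_dual_mor C V W f =
     (ev C W \<otimes>\<^sub>m\<^bsub>C\<^esub> ident C (dual C V)) \<cdot>\<^bsub>C\<^esub>
     (ident C (dual C W) \<otimes>\<^sub>m\<^bsub>C\<^esub> f \<otimes>\<^sub>m\<^bsub>C\<^esub> ident C (dual C V)) \<cdot>\<^bsub>C\<^esub>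
     (ident C (dual C W) \<otimes>\<^sub>m\<^bsub>C\<^esub> coev C V)"

definition right_dual_mor :: "('o, 'm, 'k, 'z) piv_cat_scheme \<Rightarrow> 'o \<Rightarrow> 'o \<Rightarrow> 'm \<Rightarrow> 'm" where
  "right_dual_mor C V W f =
     (ident C (dual C V) \<otimes>\<^sub>m\<^bsub>C\<^esub> ev_tilde C W) \<cdot>\<^bsub>C\<^esub>
     (ident C (dual C V) \<otimes>\<^sub>m\<^bsub>C\<^esub> f \<otimes>\<^sub>m\<^bsub>C\<^esub> ident C (dual C W)) \<cdot>\<^bsub>C\<^esub>
     (coev_tilde C V \<otimes>\<^sub>m\<^bsub>C\<^esub> ident C (dual C W))"

definition left_dual_tensor :: "('o, 'm, 'k, 'z) piv_cat_scheme \<Rightarrow> 'o \<Rightarrow> 'o \<Rightarrow> 'm" where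
  "left_dual_tensor C V W =
     (ev C W \<otimes>\<^sub>m\<^bsub>C\<^esub> ident C (dual C (V \<otimes>\<^sub>o\<^bsub>C\<^esub> W))) \<cdot>\<^bsub>C\<^esub>
     (ident C (dual C W) \<otimes>\<^sub>m\<^bsub>C\<^esub> ev C V \<otimes>\<^sub>m\<^bsub>C\<^esub> ident C (W \<otimes>\<^sub>o\<^bsub>C\<^esub> dual C (V \<otimes>\<^sub>o\<^bsub>C\<^esub> W))) \<cdot>\<^bsub>C\<^esub>
     (ident C (dual C W \<otimes>\<^sub>o\<^bsub>C\<^esub> dual C V) \<otimes>\<^sub>m\<^bsub>C\<^esub> coev C (V \<otimes>\<^sub>o\<^bsub>C\<^esub> W))"

definition right_dual_tensor :: "('o, 'm, 'k, 'z) piv_cat_scheme \<Rightarrow> 'o \<Rightarrow> 'o \<Rightarrow> 'm" where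
  "right_dual_tensor C V W =
     (ident C (dual C (V \<otimes>\<^sub>o\<^bsub>C\<^esub> W)) \<otimes>\<^sub>m\<^bsub>C\<^esub> ev_tilde C V) \<cdot>\<^bsub>C\<^esub>
     (ident C (dual C (V \<otimes>\<^sub>o\<^bsub>C\<^esub> W) \<otimes>\<^sub>o\<^bsub>C\<^esub> V) \<otimes>\<^sub>m\<^bsub>C\<^esub> ev_tilde C W \<otimes>\<^sub>m\<^bsub>C\<^esub> ident C (dual C V)) \<cdot>\<^bsub>C\<^esub>
     (coev_tilde C (V \<otimes>\<^sub>o\<^bsub>C\<^esub> W) \<otimes>\<^sub>m\<^bsub>C\<^esub> ident C (dual C W \<otimes>\<^sub>o\<^bsub>C\<^esub> dual C V))"

text \<open>
  The common canonical isomorphism \<open>W\<^sup>* \<otimes> V\<^sup>* \<rightarrow> (V \<otimes> W)\<^sup>*\<close> is not required to be an identity.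
  Categories in which it is one are a special case.
\<close>

locale pivotal_tensor_category = tensor_category +
  assumes dual_closed: "V \<in> Ob C \<Longrightarrow> dual C V \<in> Ob C"
    and coev_closed: "V \<in> Ob C \<Longrightarrow> coev C V \<in> Mor C \<one>\<^sub>o (V \<otimes>\<^sub>o dual C V)"
    and ev_closed: "V \<in> Ob C \<Longrightarrow> ev C V \<in> Mor C (dual C V \<otimes>\<^sub>o V) \<one>\<^sub>o"
    and coev_tilde_closed: "V \<in> Ob C \<Longrightarrow> coev_tilde C V \<in> Mor C \<one>\<^sub>o (dual C V \<otimes>\<^sub>o V)"
    and ev_tilde_closed: "V \<in> Ob C \<Longrightarrow> ev_tilde C V \<in> Mor C (V \<otimes>\<^sub>o dual C V) \<one>\<^sub>o"
    and zigzag_1: "V \<in> Ob C \<Longrightarrow>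
      (ident C V \<otimes>\<^sub>m ev C V) \<cdot> (coev C V \<otimes>\<^sub>m ident C V) = ident C V"
    and zigzag_2: "V \<in> Ob C \<Longrightarrow>
      (ev C V \<otimes>\<^sub>m ident C (dual C V)) \<cdot> (ident C (dual C V) \<otimes>\<^sub>m coev C V) = ident C (dual C V)"
    and zigzag_tilde_1: "V \<in> Ob C \<Longrightarrow>
      (ev_tilde C V \<otimes>\<^sub>m ident C V) \<cdot> (ident C V \<otimes>\<^sub>m coev_tilde C V) = ident C V"
    and zigzag_tilde_2: "V \<in> Ob C \<Longrightarrow>
      (ident C (dual C V) \<otimes>\<^sub>m ev_tilde C V) \<cdot> (coev_tilde C V \<otimes>\<^sub>m ident C (dual C V)) = ident C (dual C V)"
    and dual_mor_coincide: "\<lbrakk>V \<in> Ob C; W \<in> Ob C; f \<in> Mor C V W\<rbrakk> \<Longrightarrow>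
      left_dual_mor C V W f = right_dual_mor C V W f"
    and dual_tensor_coincide: "\<lbrakk>V \<in> Ob C; W \<in> Ob C\<rbrakk> \<Longrightarrow>
      left_dual_tensor C V W = right_dual_tensor C V W"

section \<open>Twisted Calabi-Yau categories\<close>

text \<open>A functor is given by its object map and its morphism map.\<close>

definition linear_endofunctor ::
    "('o, 'm, 'k::comm_ring_1, 'z) lin_cat_scheme \<Rightarrow> ('o \<Rightarrow> 'o) \<times> ('m \<Rightarrow> 'm) \<Rightarrow> bool" where
  "linear_endofunctor D F \<longleftrightarrow>
     (\<forall>A\<in>Ob D. fst F A \<in> Ob D) \<and>
     (\<forall>A\<in>Ob D. \<forall>Y\<in>Ob D. linear_map (Hom D A Y) (Hom D (fst F A) (fst F Y)) (snd F)) \<and>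
     (\<forall>A\<in>Ob D. snd F (ident D A) = ident D (fst F A)) \<and>
     (\<forall>A\<in>Ob D. \<forall>Y\<in>Ob D. \<forall>Z\<in>Ob D. \<forall>f\<in>Mor D A Y. \<forall>g\<in>Mor D Y Z.
        snd F (g \<cdot>\<^bsub>D\<^esub> f) = snd F g \<cdot>\<^bsub>D\<^esub> snd F f)"

definition twisted_calabi_yau ::
    "('o, 'm, 'k::comm_ring_1, 'z) lin_cat_scheme \<Rightarrow> ('o \<Rightarrow> 'o) \<times> ('m \<Rightarrow> 'm) \<Rightarrow>
     ('o \<Rightarrow> 'o) \<times> ('m \<Rightarrow> 'm) \<Rightarrow> ('o \<Rightarrow> 'm \<Rightarrow> 'k) \<Rightarrow> bool" where
  "twisted_calabi_yau D F G t \<longleftrightarrow>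
     linear_category D \<and> linear_endofunctor D F \<and> linear_endofunctor D G \<and>
     (\<forall>U\<in>Ob D. linear_functional (Hom D (fst F U) (fst G U)) (t U)) \<and>
     (\<forall>U\<in>Ob D. \<forall>V\<in>Ob D.
        (\<forall>g\<in>Mor D V (fst G U).
           (\<forall>f\<in>Mor D (fst F U) V. t U (g \<cdot>\<^bsub>D\<^esub> f) = 0) \<longrightarrow> g = \<zero>\<^bsub>Hom D V (fst G U)\<^esub>) \<and>
        (\<forall>f\<in>Mor D (fst F U) V.
           (\<forall>g\<in>Mor D V (fst G U). t U (g \<cdot>\<^bsub>D\<^esub> f) = 0) \<longrightarrow> f = \<zero>\<^bsub>Hom D (fst F U) V\<^esub>)) \<and>
     (\<forall>U\<in>Ob D. \<forall>V\<in>Ob D. \<forall>f\<in>Mor D (fst F V) (fst G U). \<forall>g\<in>Mor D U V.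
        t V (snd G g \<cdot>\<^bsub>D\<^esub> f) = t U (f \<cdot>\<^bsub>D\<^esub> snd F g))"

definition left_tensor_functor ::
    "('o, 'm, 'k, 'z) piv_cat_scheme \<Rightarrow> 'o \<Rightarrow> ('o \<Rightarrow> 'o) \<times> ('m \<Rightarrow> 'm)" where
  "left_tensor_functor C A = (\<lambda>V. A \<otimes>\<^sub>o\<^bsub>C\<^esub> V, \<lambda>f. ident C A \<otimes>\<^sub>m\<^bsub>C\<^esub> f)"

section \<open>Trace tuples and their traces\<close>

definition End_ring :: "('o, 'm, 'k, 'z) lin_cat_scheme \<Rightarrow> 'o \<Rightarrow> 'm ring" where
  "End_ring C A =
     \<lparr>carrier = Mor C A A, monoid.mult = (\<cdot>\<^bsub>C\<^esub>), one = ident C A,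
      ring.zero = \<zero>\<^bsub>Hom C A A\<^esub>, add = (\<oplus>\<^bsub>Hom C A A\<^esub>)\<rparr>"

text \<open>
  The isomorphism of \<open>End(P)\<close> modulo its radical with the base ring is one of algebras: it sends
  the class of \<open>c \<cdot> id\<close> to \<open>c\<close>.
\<close>

definition trace_tuple ::
    "('o, 'm, 'k::comm_ring_1, 'z) lin_cat_scheme \<Rightarrow> 'o \<Rightarrow> 'o \<Rightarrow> 'o \<Rightarrow> 'm \<Rightarrow> 'm \<Rightarrow> bool" where
  "trace_tuple C P \<alpha> \<beta> \<eta> \<epsilon> \<longleftrightarrow>
     P \<in> Ob C \<and> \<alpha> \<in> Ob C \<and> \<beta> \<in> Ob C \<and>
     \<eta> \<in> Mor C \<alpha> P \<and> \<eta> \<noteq> \<zero>\<^bsub>Hom C \<alpha> P\<^esub> \<and>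
     \<epsilon> \<in> Mor C P \<beta> \<and> \<epsilon> \<noteq> \<zero>\<^bsub>Hom C P \<beta>\<^esub> \<and>
     (\<exists>h \<in> ring_iso (End_ring C P Quot jacobson_radical (End_ring C P))
                    (ring_of_type_algebra :: 'k ring).
        \<forall>c. h (jacobson_radical (End_ring C P) +>\<^bsub>End_ring C P\<^esub> (c \<odot>\<^bsub>Hom C P P\<^esub> ident C P)) = c) \<and>
     nilpotent_ideal (jacobson_radical (End_ring C P)) (End_ring C P) \<and>
     (\<forall>g\<in>Mor C \<alpha> P. \<exists>!c. g = c \<odot>\<^bsub>Hom C \<alpha> P\<^esub> \<eta>) \<and>
     (\<forall>g\<in>Mor C P \<beta>. \<exists>!c. g = c \<odot>\<^bsub>Hom C P \<beta>\<^esub> \<epsilon>)"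

definition unique_simple_quotient ::
    "('o, 'm, 'k, 'z) lin_cat_scheme \<Rightarrow> 'o \<Rightarrow> 'o \<Rightarrow> 'm \<Rightarrow> bool" where
  "unique_simple_quotient C P \<beta> \<epsilon> \<longleftrightarrow> simple_object C \<beta> \<and> epimorphism C P \<beta> \<epsilon> \<and>
     (\<forall>S e. simple_object C S \<and> epimorphism C P S e \<longrightarrow>
        (\<exists>\<phi>. isomorphism C \<beta> S \<phi> \<and> e = \<phi> \<cdot>\<^bsub>C\<^esub> \<epsilon>))"

definition unique_simple_subobject ::
    "('o, 'm, 'k, 'z) lin_cat_scheme \<Rightarrow> 'o \<Rightarrow> 'o \<Rightarrow> 'm \<Rightarrow> bool" where
  "unique_simple_subobject C P \<alpha> \<eta> \<longleftrightarrow> simple_object C \<alpha> \<and> monomorphism C \<alpha> P \<eta> \<and>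
     (\<forall>S m. simple_object C S \<and> monomorphism C S P m \<longrightarrow>
        (\<exists>\<phi>. isomorphism C S \<alpha> \<phi> \<and> m = \<eta> \<cdot>\<^bsub>C\<^esub> \<phi>))"

definition corresponding_tuple ::
    "('o, 'm, 'k, 'z) lin_cat_scheme \<Rightarrow> 'o \<Rightarrow> 'o \<Rightarrow> 'o \<Rightarrow> 'm \<Rightarrow> 'm \<Rightarrow> bool" where
  "corresponding_tuple C P \<alpha> \<beta> \<eta> \<epsilon> \<longleftrightarrow>
     unique_simple_quotient C P \<beta> \<epsilon> \<and> unique_simple_subobject C P \<alpha> \<eta>"

text \<open>The right partial trace over \<open>W\<close> of a morphism \<open>g : V \<otimes> W \<rightarrow> A \<otimes> W\<close>.\<close>

definition right_partial_trace ::
    "('o, 'm, 'k, 'z) piv_cat_scheme \<Rightarrow> 'o \<Rightarrow> 'o \<Rightarrow> 'o \<Rightarrow> 'm \<Rightarrow> 'm" where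
  "right_partial_trace C V A W g =
     (ident C A \<otimes>\<^sub>m\<^bsub>C\<^esub> ev_tilde C W) \<cdot>\<^bsub>C\<^esub> (g \<otimes>\<^sub>m\<^bsub>C\<^esub> ident C (dual C W)) \<cdot>\<^bsub>C\<^esub>
     (ident C V \<otimes>\<^sub>m\<^bsub>C\<^esub> coev C W)"

text \<open>The coefficient of \<open>g\<close> with respect to a generator \<open>b\<close> of a free module of rank one.\<close>

definition coefficient :: "('k, 'a) module \<Rightarrow> 'a \<Rightarrow> 'a \<Rightarrow> 'k" where
  "coefficient M b g = (THE c. g = c \<odot>\<^bsub>M\<^esub> b)"

text \<open>
  \<open>t\<close> is the associated right trace: on projective \<open>V\<close> the auxiliary morphisms \<open>\<sigma>\<close>, \<open>\<tau>\<close> exist,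
  and \<open>t V f\<close> is computed by either formula with any choice of them.  This determines \<open>t V\<close> on
  morphisms \<open>\<alpha> \<otimes> V \<rightarrow> \<beta> \<otimes> V\<close> for projective \<open>V\<close>.
\<close>

definition associated_right_trace ::
    "('o, 'm, 'k, 'z) piv_cat_scheme \<Rightarrow> 'o \<Rightarrow> 'o \<Rightarrow> 'o \<Rightarrow> 'm \<Rightarrow> 'm \<Rightarrow> ('o \<Rightarrow> 'm \<Rightarrow> 'k) \<Rightarrow> bool" where
  "associated_right_trace C P \<alpha> \<beta> \<eta> \<epsilon> t \<longleftrightarrow>
     (\<forall>V. projective C V \<longrightarrow>
        (let Sig = {\<sigma> \<in> Mor C (P \<otimes>\<^sub>o\<^bsub>C\<^esub> V) (\<alpha> \<otimes>\<^sub>o\<^bsub>C\<^esub> V).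
                      \<sigma> \<cdot>\<^bsub>C\<^esub> (\<eta> \<otimes>\<^sub>m\<^bsub>C\<^esub> ident C V) = ident C (\<alpha> \<otimes>\<^sub>o\<^bsub>C\<^esub> V)};
             Tau = {\<tau> \<in> Mor C (\<beta> \<otimes>\<^sub>o\<^bsub>C\<^esub> V) (P \<otimes>\<^sub>o\<^bsub>C\<^esub> V).
                      (\<epsilon> \<otimes>\<^sub>m\<^bsub>C\<^esub> ident C V) \<cdot>\<^bsub>C\<^esub> \<tau> = ident C (\<beta> \<otimes>\<^sub>o\<^bsub>C\<^esub> V)}
         in Sig \<noteq> {} \<and> Tau \<noteq> {} \<and>
            (\<forall>f\<in>Mor C (\<alpha> \<otimes>\<^sub>o\<^bsub>C\<^esub> V) (\<beta> \<otimes>\<^sub>o\<^bsub>C\<^esub> V).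
               (\<forall>\<tau>\<in>Tau. t V f =
                  coefficient (Hom C \<alpha> P) \<eta> (right_partial_trace C \<alpha> P V (\<tau> \<cdot>\<^bsub>C\<^esub> f))) \<and>
               (\<forall>\<sigma>\<in>Sig. t V f =
                  coefficient (Hom C P \<beta>) \<epsilon> (right_partial_trace C P \<beta> V (f \<cdot>\<^bsub>C\<^esub> \<sigma>))))))"

end

theory Submission
  imports Defs
begin

text \<open>
  Everything rests on two facts about the indecomposable projective object \<open>P\<close>.

  First, \<open>End(P)\<close> is local with residue field \<open>k\<close>.  It is a finite-dimensional algebra without
  nontrivial idempotents (\<open>indecomposable_idempotent\<close>), so each endomorphism is invertible or nilpotent
  (\<open>fitting\<close>), and it has an eigenvalue because \<open>k\<close> is algebraically closed (\<open>eigenvalue\<close>).  Hence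
  every endomorphism is a scalar, its residue, plus a radical element.

  Second, \<open>P\<close> is also injective (\<open>projective_imp_injective\<close>).  If \<open>Q\<close> is projective, so is \<open>Q\<^sup>*\<close>:
  maps \<open>Q\<^sup>* \<rightarrow> B\<close> are maps \<open>1 \<rightarrow> Q \<otimes> B\<close>, and \<open>Q \<otimes> -\<close> turns epimorphisms into split ones, since tensor
  products with \<open>Q\<close> are projective.  As the dual of a monomorphism is an epimorphism, extension problems
  into \<open>Q\<close> become lifting problems out of \<open>Q\<^sup>*\<close>.

  Projectivity and injectivity, together with the local endomorphism ring, give \<open>P\<close> a unique simple
  quotient \<open>\<epsilon> : P \<rightarrow> \<beta>\<close> and a unique simple subobject \<open>\<eta> : \<alpha> \<rightarrow> P\<close>.  Radical elements kill
  both \<open>\<epsilon>\<close> and \<open>\<eta>\<close>.  Therefore, for \<open>G\<close> in \<open>End(P \<otimes> V)\<close>, the partial trace of \<open>G\<close> acts on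
  \<open>\<eta>\<close> and on \<open>\<epsilon>\<close> by the same scalar (\<open>coefficients_of_trace_agree\<close>).  Apart from linearity, all that
  is asserted about the trace comes from a suitable choice of \<open>G\<close>:
  \<^item> \<open>G = \<tau> f \<sigma>\<close> shows that the two formulas for the trace agree for all choices of \<open>\<sigma>\<close> and \<open>\<tau>\<close>;
    such \<open>\<sigma>\<close> and \<open>\<tau>\<close> exist because \<open>\<alpha> \<otimes> V\<close> is injective and \<open>\<beta> \<otimes> V\<close> is projective.
  \<^item> \<open>G = \<tau> f \<sigma> (P \<otimes> g)\<close>, combined with the cyclicity of the partial trace, which is where left and
    right duals of morphisms have to agree, shows the twisted symmetry (\<open>trace_cyclic\<close>).
  \<^item> For nondegeneracy, the partial trace of a composite is the composite of the transposed maps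
    (\<open>right_partial_trace_cmp\<close>).  The transpose \<open>V \<otimes> U\<^sup>* \<rightarrow> \<beta>\<close> of a nonzero \<open>g : V \<rightarrow> \<beta> \<otimes> U\<close> is an
    epimorphism, so \<open>\<epsilon>\<close> lifts along it; the lift is the transpose of some \<open>h : P \<otimes> U \<rightarrow> V\<close> with
    \<open>tr(g h) = \<epsilon>\<close>, and \<open>G = \<tau> g h\<close> gives \<open>t(g h (\<eta> \<otimes> U)) = 1\<close>.  The other side is dual, with
    \<open>\<eta>\<close> extended along a monomorphism.
\<close>

section \<open>Finite-dimensional algebras over an algebraically closed field\<close>

abbreviation scalars :: "'k::comm_ring_1 ring" where
  "scalars \<equiv> ring_of_type_algebra"

lemma scalars_simps [simp]:
  "carrier scalars = UNIV" "\<one>\<^bsub>scalars\<^esub> = 1" "\<zero>\<^bsub>scalars\<^esub> = 0"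
  "x \<oplus>\<^bsub>scalars\<^esub> y = x + y" "x \<otimes>\<^bsub>scalars\<^esub> y = x * y"
  by (simp_all add: ring_of_type_algebra_def)

text \<open>
  A submodule is measured by the indices at which a fixed composition series jumps inside it.
  Over a field the factors of the series are one-dimensional, so a larger submodule with the
  same jumps can be absorbed step by step.
\<close>

lemma finite_length_rank:
  fixes M :: "('k::field, 'a) module"
  assumes M: "Module.module scalars M" and fl: "finite_length_module scalars M"
  obtains d :: "'a set \<Rightarrow> nat" and n where
    "\<And>L. d L \<le> n"
    "\<And>L L'. \<lbrakk>submodule L scalars M; submodule L' scalars M; L \<subset> L'\<rbrakk> \<Longrightarrow> d L < d L'"
proof -
  interpret Module.module scalars M by (rule M)
  obtain n :: nat and N where series: "N 0 = {\<zero>\<^bsub>M\<^esub>} \<and> N n = carrier M \<and>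
      (\<forall>i\<le>n. submodule (N i) scalars M) \<and>
      (\<forall>i<n. N i \<subset> N (Suc i) \<and> \<not> (\<exists>L. submodule L scalars M \<and> N i \<subset> L \<and> L \<subset> N (Suc i)))"
    using fl unfolding finite_length_module_def by (elim exE)
  have N0: "N 0 = {\<zero>\<^bsub>M\<^esub>}" and Nn: "N n = carrier M" using series by simp_all
  have Nsub: "submodule (N i) scalars M" if "i \<le> n" for i using series that by simp
  have Nlt: "N i \<subset> N (Suc i)" if "i < n" for i using series that by simp
  have Nmax: False if "i < n" "submodule L scalars M" "N i \<subset> L" "L \<subset> N (Suc i)" for i L
    using series that by blast
  define J where "J L = {i. i < n \<and> (\<exists>x\<in>L. x \<in> N (Suc i) \<and> x \<notin> N i)}" for L
  have fin: "finite (J L)" for L unfolding J_def by simp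
  have le: "card (J L) \<le> n" for L
    using card_mono[of "{..<n}" "J L"] unfolding J_def by auto
  have factor: "\<exists>c. x \<ominus>\<^bsub>M\<^esub> c \<odot>\<^bsub>M\<^esub> y \<in> N i"
    if i: "i < n" and x: "x \<in> N (Suc i)" and y: "y \<in> N (Suc i)" "y \<notin> N i" for i x y
  proof -
    have si: "submodule (N i) scalars M" and ss: "submodule (N (Suc i)) scalars M"
      using Nsub i by auto
    note Ei = submoduleE[OF si] and Es = submoduleE[OF ss]
    (* N i + k y is strictly larger than N i, so it is all of N (Suc i) *)
    define L where "L = {u \<oplus>\<^bsub>M\<^esub> c \<odot>\<^bsub>M\<^esub> y |u c. u \<in> N i}"
    have yM: "y \<in> carrier M" using Es(1) y by auto
    have NiM: "u \<in> N i \<Longrightarrow> u \<in> carrier M" for u using Ei(1) by auto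
    have subL: "submodule L scalars M"
    proof (rule submoduleI)
      show "L \<subseteq> carrier M" unfolding L_def using NiM yM by auto
      have "\<zero>\<^bsub>M\<^esub> = \<zero>\<^bsub>M\<^esub> \<oplus>\<^bsub>M\<^esub> 0 \<odot>\<^bsub>M\<^esub> y" using yM smult_l_null[of y] by simp
      moreover have "\<zero>\<^bsub>M\<^esub> \<in> N i" using submodule.axioms(1)[OF si] subgroup.one_closed by fastforce
      ultimately show "\<zero>\<^bsub>M\<^esub> \<in> L" unfolding L_def by blast
    next
      fix a assume "a \<in> L"
      then obtain u c where u: "u \<in> N i" and a: "a = u \<oplus>\<^bsub>M\<^esub> c \<odot>\<^bsub>M\<^esub> y" unfolding L_def by blast
      have "\<ominus>\<^bsub>M\<^esub> a = (\<ominus>\<^bsub>M\<^esub> u) \<oplus>\<^bsub>M\<^esub> (\<ominus>\<^bsub>M\<^esub> (c \<odot>\<^bsub>M\<^esub> y))"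
        unfolding a using NiM[OF u] yM by (simp add: M.minus_add)
      also have "\<ominus>\<^bsub>M\<^esub> (c \<odot>\<^bsub>M\<^esub> y) = (\<ominus>\<^bsub>scalars\<^esub> c) \<odot>\<^bsub>M\<^esub> y" using yM smult_l_minus[of c y] by simp
      finally show "\<ominus>\<^bsub>M\<^esub> a \<in> L" unfolding L_def using Ei(3)[OF u] by blast
    next
      fix a b assume "a \<in> L" "b \<in> L"
      then obtain u c v e where u: "u \<in> N i" "v \<in> N i"
        and ab: "a = u \<oplus>\<^bsub>M\<^esub> c \<odot>\<^bsub>M\<^esub> y" "b = v \<oplus>\<^bsub>M\<^esub> e \<odot>\<^bsub>M\<^esub> y" unfolding L_def by blast
      have "a \<oplus>\<^bsub>M\<^esub> b = (u \<oplus>\<^bsub>M\<^esub> v) \<oplus>\<^bsub>M\<^esub> (c + e) \<odot>\<^bsub>M\<^esub> y"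
        unfolding ab using NiM[OF u(1)] NiM[OF u(2)] yM smult_l_distr[of c e y]
        by (simp add: M.a_ac)
      then show "a \<oplus>\<^bsub>M\<^esub> b \<in> L" unfolding L_def using Ei(5)[OF u] by blast
    next
      fix r a assume "a \<in> L"
      then obtain u c where u: "u \<in> N i" and a: "a = u \<oplus>\<^bsub>M\<^esub> c \<odot>\<^bsub>M\<^esub> y" unfolding L_def by blast
      have "r \<odot>\<^bsub>M\<^esub> a = r \<odot>\<^bsub>M\<^esub> u \<oplus>\<^bsub>M\<^esub> (r * c) \<odot>\<^bsub>M\<^esub> y"
        unfolding a using NiM[OF u] yM smult_r_distr[of r u "c \<odot>\<^bsub>M\<^esub> y"] smult_assoc1[of r c y]
        by simp
      then show "r \<odot>\<^bsub>M\<^esub> a \<in> L" unfolding L_def using Ei(4)[of r u] u by auto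
    qed
    have sub1: "N i \<subseteq> L"
    proof
      fix u assume u: "u \<in> N i"
      have "u = u \<oplus>\<^bsub>M\<^esub> 0 \<odot>\<^bsub>M\<^esub> y" using NiM[OF u] yM smult_l_null[of y] by simp
      then show "u \<in> L" unfolding L_def using u by blast
    qed
    have "y = \<zero>\<^bsub>M\<^esub> \<oplus>\<^bsub>M\<^esub> 1 \<odot>\<^bsub>M\<^esub> y" using yM smult_one[of y] by simp
    moreover have "\<zero>\<^bsub>M\<^esub> \<in> N i" using submodule.axioms(1)[OF si] subgroup.one_closed by fastforce
    ultimately have "y \<in> L" unfolding L_def by blast
    then have st: "N i \<subset> L" using sub1 y by blast
    have "L \<subseteq> N (Suc i)"
    proof
      fix a assume "a \<in> L"
      then obtain u c where u: "u \<in> N i" and a: "a = u \<oplus>\<^bsub>M\<^esub> c \<odot>\<^bsub>M\<^esub> y" unfolding L_def by blast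
      show "a \<in> N (Suc i)" unfolding a
        by (rule Es(5)) (use u Nlt[OF i] Es(4)[of c y] y in auto)
    qed
    then have "L = N (Suc i)" using Nmax[OF i subL st] by blast
    then obtain u c where u: "u \<in> N i" and a: "x = u \<oplus>\<^bsub>M\<^esub> c \<odot>\<^bsub>M\<^esub> y" using x unfolding L_def by blast
    have "x \<ominus>\<^bsub>M\<^esub> c \<odot>\<^bsub>M\<^esub> y = u" unfolding a using NiM[OF u] yM
      by (simp add: M.minus_eq M.a_assoc M.r_neg)
    then show ?thesis using u by auto
  qed
  have strict: "card (J L) < card (J L')"
    if L: "submodule L scalars M" and L': "submodule L' scalars M" and lt: "L \<subset> L'" for L L'
  proof (rule psubset_card_mono[OF fin], rule psubsetI)
    show "J L \<subseteq> J L'" using lt unfolding J_def by blast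
    show "J L \<noteq> J L'"
    proof
      assume eq: "J L = J L'"
      note EL = submoduleE[OF L] and EL' = submoduleE[OF L']
      have "i \<le> n \<Longrightarrow> L' \<inter> N i \<subseteq> L" for i
      proof (induction i)
        case 0
        have "\<zero>\<^bsub>M\<^esub> \<in> L" using submodule.axioms(1)[OF L] subgroup.one_closed by fastforce
        then show ?case using N0 by auto
      next
        case (Suc i)
        show ?case
        proof
          fix x assume x: "x \<in> L' \<inter> N (Suc i)"
          show "x \<in> L"
          proof (cases "x \<in> N i")
            case True
            then show ?thesis using Suc x by auto
          next
            case False
            then have "i \<in> J L" unfolding eq using x Suc unfolding J_def by auto
            then obtain y where y: "y \<in> L" "y \<in> N (Suc i)" "y \<notin> N i" unfolding J_def by blast
            obtain c where c: "x \<ominus>\<^bsub>M\<^esub> c \<odot>\<^bsub>M\<^esub> y \<in> N i" using factor[of i x y] x y Suc by auto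
            have cy: "c \<odot>\<^bsub>M\<^esub> y \<in> L" using EL(4) y by auto
            have xM: "x \<in> carrier M" and cyM: "c \<odot>\<^bsub>M\<^esub> y \<in> carrier M" using EL(1) EL'(1) x cy by auto
            have "x \<ominus>\<^bsub>M\<^esub> c \<odot>\<^bsub>M\<^esub> y \<in> L'" unfolding M.minus_eq
              by (rule EL'(5)) (use x cy lt EL'(3) in auto)
            then have "x \<ominus>\<^bsub>M\<^esub> c \<odot>\<^bsub>M\<^esub> y \<in> L" using Suc c by auto
            then have "(x \<ominus>\<^bsub>M\<^esub> c \<odot>\<^bsub>M\<^esub> y) \<oplus>\<^bsub>M\<^esub> c \<odot>\<^bsub>M\<^esub> y \<in> L" using EL(5) cy by blast
            then show ?thesis using xM cyM by (simp add: M.minus_eq M.a_assoc M.l_neg)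
          qed
        qed
      qed
      from this[of n] have "L' \<subseteq> L" using Nn EL'(1) by auto
      then show False using lt by blast
    qed
  qed
  show ?thesis using that[of "\<lambda>L. card (J L)" n] le strict by blast
qed

text \<open>
  The multiplicative structure \<open>R\<close> and the linear structure \<open>M\<close> of an algebra are kept as two
  records on the same carrier, as they arise for endomorphism algebras.
\<close>

locale fin_dim_algebra = ring R for R :: "'a ring" (structure) +
  fixes M :: "('k::alg_closed_field, 'a) module"
  assumes is_module: "Module.module scalars M"
    and carrier_eq: "carrier M = carrier R"
    and add_eq: "(\<oplus>\<^bsub>M\<^esub>) = (\<oplus>)"
    and zero_eq: "\<zero>\<^bsub>M\<^esub> = \<zero>"
    and smult_mult: "\<lbrakk>x \<in> carrier R; y \<in> carrier R\<rbrakk> \<Longrightarrow> c \<odot>\<^bsub>M\<^esub> (x \<otimes> y) = (c \<odot>\<^bsub>M\<^esub> x) \<otimes> y"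
    and mult_smult: "\<lbrakk>x \<in> carrier R; y \<in> carrier R\<rbrakk> \<Longrightarrow> c \<odot>\<^bsub>M\<^esub> (x \<otimes> y) = x \<otimes> (c \<odot>\<^bsub>M\<^esub> y)"
    and finite_length: "finite_length_module scalars M"
begin

definition sc :: "'k \<Rightarrow> 'a" where "sc c = c \<odot>\<^bsub>M\<^esub> \<one>"

lemma smult_closed: "x \<in> carrier R \<Longrightarrow> c \<odot>\<^bsub>M\<^esub> x \<in> carrier R"
  using module.smult_closed[OF is_module, of c x] carrier_eq by simp

lemma sc_closed [simp, intro]: "sc c \<in> carrier R"
  unfolding sc_def by (simp add: smult_closed)

lemma sc_mult: "x \<in> carrier R \<Longrightarrow> sc c \<otimes> x = c \<odot>\<^bsub>M\<^esub> x"
  unfolding sc_def using smult_mult[of \<one> x c] by simp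

lemma mult_sc: "x \<in> carrier R \<Longrightarrow> x \<otimes> sc c = sc c \<otimes> x"
  unfolding sc_def using mult_smult[of x \<one> c] smult_mult[of \<one> x c] by simp

lemma sc_hom: "sc (a + b) = sc a \<oplus> sc b" "sc (a * b) = sc a \<otimes> sc b" "sc 1 = \<one>" "sc 0 = \<zero>"
  using module.smult_l_distr[OF is_module, of a b \<one>] module.smult_assoc1[OF is_module, of a b \<one>]
    module.smult_one[OF is_module, of \<one>] module.smult_l_null[OF is_module, of \<one>]
  by (auto simp: sc_mult carrier_eq add_eq zero_eq) (auto simp: sc_def)

lemma sc_uminus: "sc (- c) = \<ominus> sc c"
  using sc_hom(1)[of "-c" c] sc_hom(4) by (simp add: minus_equality[symmetric])

lemma sc_Units: "c \<noteq> 0 \<Longrightarrow> sc c \<in> Units R"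
  unfolding Units_def using sc_hom(2)[of c "inverse c"] sc_hom(2)[of "inverse c" c] sc_hom(3)
  by auto

lemma subspaceI:
  assumes "H \<subseteq> carrier R" "\<zero> \<in> H" "\<And>x y. \<lbrakk>x \<in> H; y \<in> H\<rbrakk> \<Longrightarrow> x \<oplus> y \<in> H"
    "\<And>c x. x \<in> H \<Longrightarrow> sc c \<otimes> x \<in> H"
  shows "submodule H scalars M"
proof (rule module.submoduleI[OF is_module])
  interpret M: Module.module scalars M by (rule is_module)
  have sm: "c \<odot>\<^bsub>M\<^esub> x \<in> H" if "x \<in> H" for c x using assms(4)[OF that] sc_mult assms(1) that by auto
  show "\<ominus>\<^bsub>M\<^esub> a \<in> H" if a: "a \<in> H" for a
  proof -
    have aM: "a \<in> carrier M" using assms(1) a carrier_eq by auto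
    have "\<ominus>\<^bsub>M\<^esub> a = (\<ominus>\<^bsub>scalars\<^esub> 1) \<odot>\<^bsub>M\<^esub> a"
      using M.smult_l_minus[of 1 a] M.smult_one[of a] aM by simp
    then show ?thesis using sm[OF a] by auto
  qed
qed (use assms in \<open>auto simp: carrier_eq add_eq zero_eq sc_mult[symmetric] subset_iff\<close>)

lemma rank_exists:
  "\<exists>(d :: 'a set \<Rightarrow> nat) n. (\<forall>L. d L \<le> n) \<and>
    (\<forall>L L'. submodule L scalars M \<and> submodule L' scalars M \<and> L \<subset> L' \<longrightarrow> d L < d L')"
proof (rule finite_length_rank[OF is_module finite_length])
  fix d :: "'a set \<Rightarrow> nat" and n
  assume "\<And>L. d L \<le> n" and
    "\<And>L L'. \<lbrakk>submodule L scalars M; submodule L' scalars M; L \<subset> L'\<rbrakk> \<Longrightarrow> d L < d L'"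
  then show ?thesis by (intro exI[of _ d] exI[of _ n]) simp
qed

lemma increasing_chain_stabilizes:
  assumes sub: "\<And>i. submodule (L i) scalars M" and inc: "\<And>i. L i \<subseteq> L (Suc i)"
  shows "\<exists>i. L (Suc i) = L i"
proof (rule ccontr)
  assume ne: "\<not> ?thesis"
  obtain d :: "'a set \<Rightarrow> nat" and n where d: "(\<forall>L. d L \<le> n) \<and>
    (\<forall>L L'. submodule L scalars M \<and> submodule L' scalars M \<and> L \<subset> L' \<longrightarrow> d L < d L')"
    using rank_exists by (elim exE)
  have less: "d (L i) < d (L (Suc i))" for i 
    by (rule d[THEN conjunct2, rule_format]) (use sub inc ne in \<open>auto simp: psubset_eq\<close>)
  have "i \<le> d (L i)" for i
  proof (induction i)
    case (Suc i)
    then show ?case using less[of i] by linarith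
  qed simp
  then have "Suc n \<le> n" using d le_trans by blast
  then show False by simp
qed

lemma decreasing_chain_stabilizes:
  assumes sub: "\<And>i. submodule (L i) scalars M" and dec: "\<And>i. L (Suc i) \<subseteq> L i"
  shows "\<exists>i. L (Suc i) = L i"
proof (rule ccontr)
  assume ne: "\<not> ?thesis"
  obtain d :: "'a set \<Rightarrow> nat" and n where d: "(\<forall>L. d L \<le> n) \<and>
    (\<forall>L L'. submodule L scalars M \<and> submodule L' scalars M \<and> L \<subset> L' \<longrightarrow> d L < d L')"
    using rank_exists by (elim exE)
  have less: "d (L (Suc i)) < d (L i)" for i 
    by (rule d[THEN conjunct2, rule_format]) (use sub dec ne in \<open>auto simp: psubset_eq\<close>)
  have "d (L i) + i \<le> n" for i
  proof (induction i)
    case 0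
    then show ?case using d by simp
  next
    case (Suc i)
    then show ?case using less[of i] by linarith
  qed
  from this[of "Suc n"] show False by linarith
qed

text \<open>Horner's rule.\<close>

definition peval :: "'k poly \<Rightarrow> 'a \<Rightarrow> 'a" where
  "peval p x = fold_coeffs (\<lambda>a y. sc a \<oplus> x \<otimes> y) p \<zero>"

lemma peval_0 [simp]: "peval 0 x = \<zero>"
  by (simp add: peval_def)

lemma peval_pCons [simp]: "x \<in> carrier R \<Longrightarrow> peval (pCons a p) x = sc a \<oplus> x \<otimes> peval p x"
  by (cases "p = 0 \<and> a = 0") (auto simp: peval_def sc_hom)

lemma peval_closed [simp]: "x \<in> carrier R \<Longrightarrow> peval p x \<in> carrier R"
  by (induction p) auto

lemma peval_add: "x \<in> carrier R \<Longrightarrow> peval (p + q) x = peval p x \<oplus> peval q x"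
  by (induction p q rule: poly_induct2) (auto simp: sc_hom r_distr a_ac)

lemma peval_smult: "x \<in> carrier R \<Longrightarrow> peval (smult c p) x = sc c \<otimes> peval p x"
proof (induction p)
  case (pCons a p)
  have "x \<otimes> (sc c \<otimes> peval p x) = sc c \<otimes> (x \<otimes> peval p x)"
    using pCons.prems by (metis m_assoc mult_sc peval_closed sc_closed)
  then show ?case using pCons by (simp add: sc_hom r_distr)
qed simp

text \<open>
  The subspaces of values at \<open>x\<close> of polynomials of degree less than \<open>i\<close> stop growing, so some power
  of \<open>x\<close> is a combination of lower powers.
\<close>

lemma exists_annihilating_poly:
  assumes x: "x \<in> carrier R"
  shows "\<exists>p. p \<noteq> 0 \<and> peval p x = \<zero>"
proof -
  define W where "W i = {peval p x |p. p = 0 \<or> degree p < i}" for i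
  have "submodule (W i) scalars M" for i
  proof (rule subspaceI)
    show "W i \<subseteq> carrier R" unfolding W_def using x by auto
    show "\<zero> \<in> W i" unfolding W_def using peval_0 by (metis (mono_tags, lifting) mem_Collect_eq)
  next
    fix u v assume "u \<in> W i" "v \<in> W i"
    then obtain p q where "u = peval p x" "v = peval q x" "p = 0 \<or> degree p < i" "q = 0 \<or> degree q < i"
      unfolding W_def by blast
    then have "u \<oplus> v = peval (p + q) x" "p + q = 0 \<or> degree (p + q) < i"
      using peval_add[OF x] by (auto simp: degree_add_less)
    then show "u \<oplus> v \<in> W i" unfolding W_def by blast
  next
    fix c u assume "u \<in> W i"
    then obtain p where "u = peval p x" "p = 0 \<or> degree p < i" unfolding W_def by blast
    then have "sc c \<otimes> u = peval (smult c p) x" "smult c p = 0 \<or> degree (smult c p) < i"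
      using peval_smult[OF x] by auto
    then show "sc c \<otimes> u \<in> W i" unfolding W_def by blast
  qed
  moreover have "W i \<subseteq> W (Suc i)" for i unfolding W_def by (auto simp: less_Suc_eq)
  ultimately obtain i where i: "W (Suc i) = W i" using increasing_chain_stabilizes by blast
  have "peval (Polynomial.monom 1 i) x \<in> W (Suc i)" unfolding W_def by (auto simp: degree_monom_eq)
  then obtain q where q: "peval (Polynomial.monom 1 i) x = peval q x" "q = 0 \<or> degree q < i"
    unfolding i unfolding W_def by blast
  define p where "p = Polynomial.monom 1 i + smult (-1) q"
  have "Polynomial.coeff p i = 1" using q(2) coeff_eq_0 by (auto simp: p_def)
  then have "p \<noteq> 0" by auto
  moreover have "peval p x = \<zero>" using x q(1)
    by (simp only: p_def peval_add peval_smult) (simp add: sc_uminus sc_hom l_minus r_neg)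
  ultimately show ?thesis by blast
qed

lemma peval_linear_factor:
  assumes x: "x \<in> carrier R"
  shows "peval (pCons (- c) 1 * q) x = (x \<ominus> sc c) \<otimes> peval q x"
proof -
  have "pCons (- c) 1 * q = smult (- c) q + pCons 0 q" by simp
  then show ?thesis using x
    by (simp only: peval_add peval_smult peval_pCons)
      (simp add: sc_hom sc_uminus minus_eq l_distr l_minus a_comm)
qed

text \<open>
  Split a linear factor \<open>x - c\<close> off an annihilating polynomial of least degree: the cofactor does not
  vanish at \<open>x\<close>, so \<open>x - c\<close> is a zero divisor.
\<close>

lemma eigenvalue:
  assumes ne: "\<one> \<noteq> \<zero>" and x: "x \<in> carrier R"
  shows "\<exists>c. x \<ominus> sc c \<notin> Units R"
proof -
  obtain p where p: "p \<noteq> 0 \<and> peval p x = \<zero>"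
    and min: "\<forall>q. q \<noteq> 0 \<and> peval q x = \<zero> \<longrightarrow> degree p \<le> degree q"
    using ex_has_least_nat[of "\<lambda>p. p \<noteq> 0 \<and> peval p x = \<zero>" _ degree]
      exists_annihilating_poly[OF x] by (elim exE) auto
  have "degree p > 0"
  proof (rule ccontr)
    assume "\<not> degree p > 0"
    then obtain a where a: "p = pCons a 0" by (cases p) (auto split: if_splits)
    then have "a \<noteq> 0" "sc a = \<zero>" using p x by auto
    then have "\<one> = \<zero>" using sc_hom(2)[of "inverse a" a] sc_hom(3) by simp
    then show False using ne by simp
  qed
  then obtain c where "poly p c = 0" using alg_closed_imp_poly_has_root by blast
  then have "pCons (- c) (pCons 1 0) dvd p" by (simp only: poly_eq_0_iff_dvd)
  then obtain q where q: "p = pCons (- c) 1 * q" unfolding one_pCons by (rule dvdE)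
  have q0: "q \<noteq> 0" using p q by auto
  have "degree p = 1 + degree q" unfolding q using q0 by (subst degree_mult_eq) auto
  then have nz: "peval q x \<noteq> \<zero>" using min q0 by fastforce
  have z: "(x \<ominus> sc c) \<otimes> peval q x = \<zero>" using p peval_linear_factor[OF x, of c q] q by simp
  have "x \<ominus> sc c \<notin> Units R"
  proof
    assume "x \<ominus> sc c \<in> Units R"
    then have "peval q x = \<zero>" using z x by (metis Units_l_cancel peval_closed r_null Units_closed zero_closed)
    then show False using nz by simp
  qed
  then show ?thesis by blast
qed

lemma scalar_if_division:
  assumes ne: "\<one> \<noteq> \<zero>" and div: "\<And>x. x \<in> carrier R \<Longrightarrow> x \<in> Units R \<or> x = \<zero>" and x: "x \<in> carrier R"
  shows "\<exists>c. x = sc c"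
proof -
  obtain c where "x \<ominus> sc c \<notin> Units R" using eigenvalue[OF ne x] by blast
  then have "x \<ominus> sc c = \<zero>" using div x by blast
  then show ?thesis using x by (metis r_right_minus_eq sc_closed)
qed

lemma peval_commutes: "x \<in> carrier R \<Longrightarrow> peval p x \<otimes> x = x \<otimes> peval p x"
  by (induction p) (simp_all add: l_distr r_distr m_assoc mult_sc)

text \<open>
  Fitting's lemma.  The chain of subspaces \<open>k[x] x\<^sup>i\<close> stabilizes, so \<open>x\<^sup>i = a x\<^sup>i\<^sup>+\<^sup>1\<close> for some \<open>a\<close> that
  commutes with \<open>x\<close>.  Then \<open>a x\<close> fixes \<open>x\<^sup>n\<close> for \<open>n > i\<close>, and \<open>(a x)\<^sup>n = a\<^sup>n x\<^sup>n\<close> is an idempotent.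
\<close>

lemma power_absorbs:
  assumes x: "x \<in> carrier R"
  shows "\<exists>(i::nat) a. a \<in> carrier R \<and> a \<otimes> x = x \<otimes> a \<and> x [^] i = a \<otimes> x [^] Suc i"
proof -
  define L where "L i = range (\<lambda>p. peval p x \<otimes> x [^] (i::nat))" for i
  have sub: "submodule (L i) scalars M" for i
  proof (rule subspaceI)
    show "L i \<subseteq> carrier R" unfolding L_def using x by auto
    show "\<zero> \<in> L i" unfolding L_def using x by (intro image_eqI[of _ _ 0]) auto
  next
    fix u v assume "u \<in> L i" "v \<in> L i"
    then obtain p q where "u = peval p x \<otimes> x [^] i" "v = peval q x \<otimes> x [^] i" unfolding L_def by blast
    then show "u \<oplus> v \<in> L i" unfolding L_def using x
      by (intro image_eqI[of _ _ "p + q"]) (simp_all add: peval_add l_distr)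
  next
    fix c u assume "u \<in> L i"
    then obtain p where "u = peval p x \<otimes> x [^] i" unfolding L_def by blast
    then show "sc c \<otimes> u \<in> L i" unfolding L_def using x
      by (intro image_eqI[of _ _ "Polynomial.smult c p"]) (simp_all add: peval_smult m_assoc)
  qed
  have "L (Suc i) \<subseteq> L i" for i
  proof
    fix u assume "u \<in> L (Suc i)"
    then obtain p where "u = peval p x \<otimes> x [^] Suc i" unfolding L_def by blast
    then show "u \<in> L i" unfolding L_def using x
      by (intro image_eqI[of _ _ "pCons 0 p"])
        (simp_all add: m_assoc nat_pow_Suc2[symmetric] sc_hom peval_commutes[symmetric])
  qed
  then obtain i where i: "L (Suc i) = L i" using decreasing_chain_stabilizes sub by blast
  have "x [^] i \<in> L i" unfolding L_def using x sc_hom(3)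
    by (intro image_eqI[of _ _ "pCons 1 0"]) simp_all
  then obtain p where "x [^] i = peval p x \<otimes> x [^] Suc i" using i unfolding L_def by blast
  then show ?thesis using peval_commutes[OF x, of p] x by (intro exI[of _ i] exI[of _ "peval p x"]) simp
qed

lemma fitting:
  assumes idem: "\<And>e. \<lbrakk>e \<in> carrier R; e \<otimes> e = e\<rbrakk> \<Longrightarrow> e = \<zero> \<or> e = \<one>" and x: "x \<in> carrier R"
  shows "x \<in> Units R \<or> (\<exists>n::nat. x [^] n = \<zero>)"
proof -
  obtain i a where a: "a \<in> carrier R" and ax: "a \<otimes> x = x \<otimes> a" and absorb: "x [^] i = a \<otimes> x [^] Suc i"
    using power_absorbs[OF x] by blast
  define n where "n = Suc i"
  define y where "y = x [^] n"
  define b where "b = a [^] n"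
  define e where "e = (a \<otimes> x) [^] n"
  have c: "y \<in> carrier R" "b \<in> carrier R" "e \<in> carrier R" "a \<otimes> x \<in> carrier R"
    using a x by (simp_all add: y_def b_def e_def)
  have "y = (a \<otimes> x [^] n) \<otimes> x" using absorb unfolding y_def n_def by simp
  then have "(a \<otimes> x) \<otimes> y = y"
    using a x nat_pow_Suc2[OF x, of n] by (simp add: y_def m_assoc)
  then have "(a \<otimes> x) [^] (m::nat) \<otimes> y = y" for m
    by (induction m) (use c in \<open>simp_all add: m_assoc\<close>)
  then have ey: "e \<otimes> y = y" by (simp add: e_def)
  have e: "e = b \<otimes> y" unfolding e_def b_def y_def by (rule pow_mult_distrib[OF ax a x])
  have "(a \<otimes> x) \<otimes> a = a \<otimes> (a \<otimes> x)" using m_assoc[OF a x a] ax by simp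
  then have "e \<otimes> a = a \<otimes> e" unfolding e_def by (rule group_commutes_pow) (use a x in simp_all)
  then have eb: "e \<otimes> b = b \<otimes> e"
    unfolding b_def using group_commutes_pow[of a e n] a c by simp
  have "e \<otimes> e = (e \<otimes> b) \<otimes> y" using c m_assoc[of e b y] unfolding e by simp
  also have "\<dots> = b \<otimes> (e \<otimes> y)" unfolding eb using c by (simp add: m_assoc)
  also have "\<dots> = e" unfolding ey by (rule e[symmetric])
  finally have "e = \<zero> \<or> e = \<one>" by (rule idem[OF c(3)])
  then show ?thesis
  proof
    assume "e = \<zero>"
    then have "y = \<zero>" using ey c by simp
    then show ?thesis unfolding y_def by blast
  next
    assume 1: "e = \<one>"
    define z where "z = x [^] i"
    have z: "z \<in> carrier R" "y = z \<otimes> x" "y = x \<otimes> z"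
      unfolding z_def y_def n_def using x nat_pow_Suc2[OF x, of i] by auto
    have bx: "b \<otimes> x = x \<otimes> b" unfolding b_def by (rule group_commutes_pow[OF ax a x])
    have "(b \<otimes> z) \<otimes> x = \<one>" using 1 e z x c by (simp add: m_assoc)
    moreover have "x \<otimes> (b \<otimes> z) = \<one>"
      using 1 e z(1,3) x c m_assoc[of x b z] m_assoc[of b x z] bx by simp
    ultimately show ?thesis unfolding Units_def using x c z(1) by auto
  qed
qed

end

section \<open>Local algebras with nilpotent radical\<close>

text \<open>The dichotomy makes the ring local: the nonunits form an ideal, which is the Jacobson radical.\<close>

locale unit_nilpotent_ring = ring R for R :: "'a ring" (structure) +
  assumes nontrivial: "\<one> \<noteq> \<zero>"
    and unit_or_nilpotent: "x \<in> carrier R \<Longrightarrow> x \<in> Units R \<or> (\<exists>n::nat. x [^] n = \<zero>)"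
begin

definition nonunits :: "'a set" where "nonunits = carrier R - Units R"

lemma nonunits_closed: "x \<in> nonunits \<Longrightarrow> x \<in> carrier R"
  by (simp add: nonunits_def)

lemma zero_nonunit: "\<zero> \<in> nonunits"
  using nontrivial Units_l_inv_ex[of \<zero>] by (auto simp: nonunits_def)

text \<open>From \<open>x y = y\<close> follows \<open>x\<^sup>n y = y\<close> for all \<open>n\<close>, and some power of \<open>x\<close> is zero.\<close>

lemma nonunit_fixes_only_zero:
  assumes x: "x \<in> nonunits" and y: "y \<in> carrier R" and xy: "x \<otimes> y = y"
  shows "y = \<zero>"
proof -
  have xc: "x \<in> carrier R" by (rule nonunits_closed[OF x])
  obtain n :: nat where n: "x [^] n = \<zero>" using unit_or_nilpotent[OF xc] x by (auto simp: nonunits_def)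
  have "x [^] (m::nat) \<otimes> y = y" for m
    by (induction m) (use xc y xy in \<open>simp_all add: m_assoc\<close>)
  from this[of n] show ?thesis using n y by simp
qed

text \<open>If \<open>a b = 1\<close>, then \<open>b y = 0\<close> forces \<open>y = 0\<close>, so no power of \<open>b\<close> can vanish.\<close>

lemma left_inverse_imp_Units:
  assumes a: "a \<in> carrier R" and b: "b \<in> carrier R" and ab: "a \<otimes> b = \<one>"
  shows "b \<in> Units R"
proof -
  have "b [^] (n::nat) \<noteq> \<zero>" for n
  proof (induction n)
    case (Suc n)
    show ?case
    proof
      assume "b [^] Suc n = \<zero>"
      then have "b \<otimes> b [^] n = \<zero>" using nat_pow_Suc2[OF b, of n] by simp
      then have "a \<otimes> (b \<otimes> b [^] n) = \<zero>" using a by simp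
      then have "b [^] n = \<zero>" using a b ab m_assoc[of a b "b [^] n"] by simp
      then show False using Suc by simp
    qed
  qed (simp add: nontrivial)
  then show ?thesis using unit_or_nilpotent[OF b] by blast
qed

lemma Units_factors:
  assumes x: "x \<in> carrier R" and y: "y \<in> carrier R" and xy: "x \<otimes> y \<in> Units R"
  shows "x \<in> Units R" "y \<in> Units R"
proof -
  have i: "inv (x \<otimes> y) \<in> carrier R" by (rule Units_inv_closed[OF xy])
  have "(inv (x \<otimes> y) \<otimes> x) \<otimes> y = \<one>" using m_assoc[OF i x y] Units_l_inv[OF xy] by simp
  then show yU: "y \<in> Units R" using left_inverse_imp_Units[of "inv (x \<otimes> y) \<otimes> x" y] i x y by simp
  have "x = (x \<otimes> y) \<otimes> inv y" using x y yU m_assoc[of x y "inv y"] by simp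
  then show "x \<in> Units R" using Units_m_closed[OF xy Units_inv_Units[OF yU]] by simp
qed

lemma nonunits_mult:
  assumes "x \<in> carrier R" "y \<in> carrier R" "x \<in> nonunits \<or> y \<in> nonunits"
  shows "x \<otimes> y \<in> nonunits"
  using assms Units_factors[of x y] unfolding nonunits_def by auto

lemma nonunits_uminus: "x \<in> nonunits \<Longrightarrow> \<ominus> x \<in> nonunits"
  using nonunits_mult[of "\<ominus> \<one>" x] by (simp add: nonunits_closed l_minus)

text \<open>If \<open>w = 1 - z\<close> were nilpotent too, it would fix the last nonzero power of \<open>z\<close>.\<close>

lemma one_minus_nonunit:
  assumes z: "z \<in> nonunits"
  shows "\<one> \<ominus> z \<in> Units R"
proof (rule ccontr)
  have zc: "z \<in> carrier R" by (rule nonunits_closed[OF z])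
  assume "\<one> \<ominus> z \<notin> Units R"
  then have w: "\<one> \<ominus> z \<in> nonunits" using zc by (simp add: nonunits_def)
  have "z [^] (n::nat) \<noteq> \<zero>" for n
  proof (induction n)
    case (Suc n)
    show ?case
    proof
      assume "z [^] Suc n = \<zero>"
      then have "z \<otimes> z [^] n = \<zero>" using nat_pow_Suc2[OF zc, of n] by simp
      then have "(\<one> \<ominus> z) \<otimes> z [^] n = z [^] n" using zc by (simp add: minus_eq l_distr l_minus)
      then have "z [^] n = \<zero>" using nonunit_fixes_only_zero[OF w] zc by simp
      then show False using Suc by simp
    qed
  qed (simp add: nontrivial)
  then show False using unit_or_nilpotent[OF zc] z by (auto simp: nonunits_def)
qed

lemma nonunits_add:
  assumes x: "x \<in> nonunits" and y: "y \<in> nonunits"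
  shows "x \<oplus> y \<in> nonunits"
proof (rule ccontr)
  have xc: "x \<in> carrier R" and yc: "y \<in> carrier R" using x y nonunits_closed by auto
  assume "x \<oplus> y \<notin> nonunits"
  then have u: "x \<oplus> y \<in> Units R" using xc yc by (simp add: nonunits_def)
  define v where "v = inv (x \<oplus> y)"
  have vc: "v \<in> carrier R" unfolding v_def using u by simp
  have 1: "v \<otimes> x \<oplus> v \<otimes> y = \<one>" unfolding v_def using u xc yc by (simp add: r_distr[symmetric])
  have "v \<otimes> x = (v \<otimes> x \<oplus> v \<otimes> y) \<ominus> v \<otimes> y"
    using vc xc yc by (simp add: minus_eq a_assoc r_neg)
  then have "v \<otimes> x = \<one> \<ominus> v \<otimes> y" unfolding 1 .
  then have "v \<otimes> x \<in> Units R" using one_minus_nonunit[of "v \<otimes> y"] nonunits_mult vc y yc by simp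
  then show False using nonunits_mult[of v x] vc x xc by (simp add: nonunits_def)
qed

lemma nonunits_ideal: "ideal nonunits R"
proof (rule idealI[OF ring_axioms])
  show "subgroup nonunits (add_monoid R)"
    by (rule add.subgroupI)
      (use zero_nonunit nonunits_add nonunits_uminus nonunits_closed in \<open>auto simp: a_inv_def[symmetric]\<close>)
qed (use nonunits_mult nonunits_closed in auto)

text \<open>A proper left ideal contains no unit, so the nonunits are the only maximal left ideal.\<close>

lemma jacobson_radical_eq: "jacobson_radical R = nonunits"
proof -
  interpret N: ideal nonunits R by (rule nonunits_ideal)
  have lN: "left_ideal nonunits R"
    unfolding left_ideal_def using N.is_additive_subgroup N.I_l_closed by blast
  have proper: "L \<subseteq> nonunits" if L: "left_ideal L R" and ne: "L \<noteq> carrier R" for L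
  proof
    fix x assume x: "x \<in> L"
    interpret L: additive_subgroup L R using L unfolding left_ideal_def by simp
    have mult: "a \<otimes> u \<in> L" if "a \<in> carrier R" "u \<in> L" for a u
      using L that unfolding left_ideal_def by simp
    show "x \<in> nonunits"
    proof (rule ccontr)
      assume "x \<notin> nonunits"
      then have "x \<in> Units R" using L.a_Hcarr[OF x] by (simp add: nonunits_def)
      then have "\<one> \<in> L" using mult[of "inv x" x] x by simp
      then have "carrier R \<subseteq> L" using mult[of _ \<one>] by auto
      then show False using ne L.a_subset by auto
    qed
  qed
  have "\<one> \<notin> nonunits" by (simp add: nonunits_def)
  then have ne: "nonunits \<noteq> carrier R" by auto
  have maxN: "maximal_left_ideal nonunits R"
    unfolding maximal_left_ideal_def
  proof (intro conjI lN ne allI impI)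
    fix L assume "left_ideal L R" "nonunits \<subseteq> L"
    then show "L = nonunits \<or> L = carrier R" using proper[of L] by auto
  qed
  have unique: "L = nonunits" if L: "maximal_left_ideal L R" for L
  proof -
    have "left_ideal L R" "L \<noteq> carrier R" using L unfolding maximal_left_ideal_def by simp_all
    then have "L \<subseteq> nonunits" by (rule proper)
    then have "nonunits = L \<or> nonunits = carrier R"
      using L lN unfolding maximal_left_ideal_def by simp
    then show ?thesis using ne by (elim disjE) simp_all
  qed
  show ?thesis unfolding jacobson_radical_def
  proof (intro equalityI subsetI)
    fix x assume "x \<in> {x \<in> carrier R. \<forall>I. maximal_left_ideal I R \<longrightarrow> x \<in> I}"
    then show "x \<in> nonunits" using maxN by simp
  next
    fix x assume x: "x \<in> nonunits"
    have "x \<in> I" if "maximal_left_ideal I R" for I using unique[OF that] x by simp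
    then show "x \<in> {x \<in> carrier R. \<forall>I. maximal_left_ideal I R \<longrightarrow> x \<in> I}"
      using nonunits_closed[OF x] by simp
  qed
qed

end

locale local_algebra = fin_dim_algebra R M + unit_nilpotent_ring R
  for R :: "'a ring" (structure) and M :: "('k::alg_closed_field, 'a) module"
begin

text \<open>An eigenvalue exists, and two of them differ by a scalar that is not a unit, hence zero.\<close>

lemma residue_unique_existence:
  assumes x: "x \<in> carrier R"
  shows "\<exists>!c. x \<ominus> sc c \<in> nonunits"
proof -
  obtain c where "x \<ominus> sc c \<notin> Units R" using eigenvalue[OF nontrivial x] by blast
  then have ex: "x \<ominus> sc c \<in> nonunits" using x by (simp add: nonunits_def)
  have "e = c" if e: "x \<ominus> sc e \<in> nonunits" for e
  proof (rule ccontr)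
    assume "e \<noteq> c"
    then have U: "sc (c - e) \<in> Units R" using sc_Units by simp
    have "(x \<ominus> sc e) \<oplus> \<ominus> (x \<ominus> sc c) \<in> nonunits"
      by (intro nonunits_add nonunits_uminus e ex)
    also have "(x \<ominus> sc e) \<oplus> \<ominus> (x \<ominus> sc c) = sc c \<ominus> sc e"
      using x sc_closed[of c] sc_closed[of e] by algebra
    also have "\<dots> = sc (c - e)" using sc_hom(1)[of c "- e"] by (simp add: sc_uminus minus_eq)
    finally show False using U by (simp add: nonunits_def)
  qed
  then show ?thesis using ex by blast
qed

definition residue :: "'a \<Rightarrow> 'k" where
  "residue x = (THE c. x \<ominus> sc c \<in> nonunits)"

lemma residue_nonunit: "x \<in> carrier R \<Longrightarrow> x \<ominus> sc (residue x) \<in> nonunits"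
  unfolding residue_def by (rule theI') (rule residue_unique_existence)

lemma residue_eqI: "\<lbrakk>x \<in> carrier R; x \<ominus> sc c \<in> nonunits\<rbrakk> \<Longrightarrow> residue x = c"
  using residue_unique_existence[of x] residue_nonunit[of x] by blast

lemma residue_sc [simp]: "residue (sc c) = c"
  by (rule residue_eqI) (simp_all add: zero_nonunit minus_eq r_neg)

lemma residue_ring_hom: "ring_hom_ring R (scalars :: 'k ring) residue"
proof (rule ring_hom_ringI)
  show "ring R" by (rule ring_axioms)
  show "ring (scalars :: 'k ring)" by (rule ring_from_type_algebra)
  show "residue \<one> = \<one>\<^bsub>scalars\<^esub>" using residue_sc[of 1] sc_hom(3) by simp
next
  fix x y assume x: "x \<in> carrier R" and y: "y \<in> carrier R"
  define n m a b where "n = x \<ominus> sc (residue x)" and "m = y \<ominus> sc (residue y)"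
    and "a = sc (residue x)" and "b = sc (residue y)"
  have N: "n \<in> nonunits" "m \<in> nonunits" using residue_nonunit x y by (auto simp: n_def m_def)
  note c = nonunits_closed[OF N(1)] nonunits_closed[OF N(2)]
  have ab: "a \<in> carrier R" "b \<in> carrier R" by (auto simp: a_def b_def)
  have xy: "x = n \<oplus> a" "y = m \<oplus> b" using x y
    by (auto simp: n_def m_def a_def b_def minus_eq a_assoc l_neg)
  have "x \<otimes> y \<ominus> a \<otimes> b = n \<otimes> y \<oplus> a \<otimes> m"
    unfolding xy using c ab by algebra
  also have "\<dots> \<in> nonunits" using N y ab c by (intro nonunits_add nonunits_mult) auto
  finally have "x \<otimes> y \<ominus> sc (residue x * residue y) \<in> nonunits" by (simp add: sc_hom a_def b_def)
  then show "residue (x \<otimes> y) = residue x \<otimes>\<^bsub>scalars\<^esub> residue y"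
    using residue_eqI[of "x \<otimes> y"] x y by simp
  have "x \<oplus> y \<ominus> (a \<oplus> b) = n \<oplus> m"
    unfolding xy using c ab by algebra
  then have "x \<oplus> y \<ominus> sc (residue x + residue y) \<in> nonunits"
    using N by (simp add: sc_hom a_def b_def nonunits_add)
  then show "residue (x \<oplus> y) = residue x \<oplus>\<^bsub>scalars\<^esub> residue y"
    using residue_eqI[of "x \<oplus> y"] x y by simp
qed (simp)

lemma quotient_by_radical:
  "\<exists>h \<in> ring_iso (R Quot jacobson_radical R) (scalars :: 'k ring).
     \<forall>c. h (jacobson_radical R +> sc c) = c"
proof -
  interpret h: ring_hom_ring R "scalars :: 'k ring" residue by (rule residue_ring_hom)
  have ker: "a_kernel R (scalars :: 'k ring) residue = nonunits"
  proof -
    have "residue x = 0 \<longleftrightarrow> x \<in> nonunits" if x: "x \<in> carrier R" for x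
      using residue_nonunit[OF x] residue_eqI[OF x, of 0] x by (auto simp: sc_hom minus_eq)
    then show ?thesis unfolding a_kernel_def' using nonunits_closed by auto
  qed
  have "residue ` carrier R = carrier scalars" using residue_sc by force
  then have "(\<lambda>Y. the_elem (residue ` Y)) \<in> ring_iso (R Quot nonunits) (scalars :: 'k ring)"
    using h.FactRing_iso_set ker by simp
  moreover have "the_elem (residue ` (nonunits +> sc c)) = c" for c
    using h.the_elem_simp[of "sc c"] ker by simp
  ultimately show ?thesis unfolding jacobson_radical_eq by (intro bexI allI)
qed

text \<open>
  A nonzero product \<open>x p\<close> with \<open>x\<close> a nonunit generates a strictly smaller left ideal than \<open>p\<close>:
  otherwise \<open>p = a x p\<close>, where \<open>a x\<close> is nilpotent.  So long products vanish.
\<close>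

lemma radical_nilpotent: "nilpotent_ideal (jacobson_radical R) R"
proof -
  obtain d :: "'a set \<Rightarrow> nat" and n where d: "(\<forall>L. d L \<le> n) \<and>
    (\<forall>L L'. submodule L scalars M \<and> submodule L' scalars M \<and> L \<subset> L' \<longrightarrow> d L < d L')"
    using rank_exists by (elim exE)
  define I where "I p = (\<lambda>a. a \<otimes> p) ` carrier R" for p
  have sub: "submodule (I p) scalars M" if p: "p \<in> carrier R" for p
  proof (rule subspaceI)
    show "I p \<subseteq> carrier R" unfolding I_def using p by auto
    show "\<zero> \<in> I p" unfolding I_def using p by (intro image_eqI[of _ _ \<zero>]) auto
  next
    fix u v assume "u \<in> I p" "v \<in> I p"
    then obtain a b where "a \<in> carrier R" "b \<in> carrier R" "u = a \<otimes> p" "v = b \<otimes> p"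
      unfolding I_def by blast
    then show "u \<oplus> v \<in> I p" unfolding I_def using p
      by (intro image_eqI[of _ _ "a \<oplus> b"]) (auto simp: l_distr)
  next
    fix c u assume "u \<in> I p"
    then obtain a where "a \<in> carrier R" "u = a \<otimes> p" unfolding I_def by blast
    then show "sc c \<otimes> u \<in> I p" unfolding I_def using p
      by (intro image_eqI[of _ _ "sc c \<otimes> a"]) (auto simp: m_assoc)
  qed
  have bound: "foldr (\<otimes>) xs \<one> \<in> carrier R \<and>
      (foldr (\<otimes>) xs \<one> = \<zero> \<or> d (I (foldr (\<otimes>) xs \<one>)) + length xs \<le> n)"
    if "set xs \<subseteq> nonunits" for xs
    using that
  proof (induction xs)
    case Nil
    then show ?case using d by simp
  next
    case (Cons x xs)
    define p where "p = foldr (\<otimes>) xs \<one>"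
    have x: "x \<in> nonunits" and xc: "x \<in> carrier R" and pc: "p \<in> carrier R"
      and IH: "p = \<zero> \<or> d (I p) + length xs \<le> n"
      using Cons nonunits_closed unfolding p_def by auto
    have "x \<otimes> p = \<zero> \<or> d (I (x \<otimes> p)) + Suc (length xs) \<le> n"
    proof (cases "x \<otimes> p = \<zero>")
      case False
      then have p0: "p \<noteq> \<zero>" using xc by auto
      have "I (x \<otimes> p) \<subseteq> I p"
      proof
        fix u assume "u \<in> I (x \<otimes> p)"
        then obtain a where "a \<in> carrier R" "u = a \<otimes> (x \<otimes> p)" unfolding I_def by blast
        then show "u \<in> I p" unfolding I_def using xc pc
          by (intro image_eqI[of _ _ "a \<otimes> x"]) (auto simp: m_assoc)
      qed
      moreover have "p \<notin> I (x \<otimes> p)"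
      proof
        assume "p \<in> I (x \<otimes> p)"
        then obtain a where a: "a \<in> carrier R" "p = a \<otimes> (x \<otimes> p)" unfolding I_def by blast
        have "a \<otimes> x \<in> nonunits" using nonunits_mult a xc x by simp
        moreover have "(a \<otimes> x) \<otimes> p = p" using a xc pc by (simp add: m_assoc)
        ultimately show False using nonunit_fixes_only_zero pc p0 by blast
      qed
      moreover have "p \<in> I p" unfolding I_def using pc by (intro image_eqI[of _ _ \<one>]) auto
      ultimately have "I (x \<otimes> p) \<subset> I p" by blast
      then have "d (I (x \<otimes> p)) < d (I p)"
        using d sub[of "x \<otimes> p"] sub[OF pc] xc pc by simp
      then show ?thesis using IH p0 by linarith
    qed simp
    then show ?case using xc pc by (simp add: p_def)
  qed
  show ?thesis unfolding nilpotent_ideal_def jacobson_radical_eq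
  proof (intro exI[of _ "Suc n"] allI impI)
    fix xs assume "length xs = Suc n \<and> set xs \<subseteq> nonunits"
    then show "foldr (\<otimes>) xs \<one> = \<zero>" using bound[of xs] by auto
  qed
qed

end

section \<open>Linear and abelian categories\<close>

lemma linear_map_zero:
  assumes "Module.module scalars M" "Module.module scalars N" "linear_map M N \<phi>"
  shows "\<phi> \<zero>\<^bsub>M\<^esub> = \<zero>\<^bsub>N\<^esub>"
proof -
  interpret M: Module.module scalars M by fact
  interpret N: Module.module scalars N by fact
  have "\<phi> (0 \<odot>\<^bsub>M\<^esub> \<zero>\<^bsub>M\<^esub>) = 0 \<odot>\<^bsub>N\<^esub> \<phi> \<zero>\<^bsub>M\<^esub>" "\<phi> \<zero>\<^bsub>M\<^esub> \<in> carrier N"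
    using assms(3) M.zero_closed unfolding linear_map_def by blast+
  then show ?thesis using M.smult_l_null[of "\<zero>\<^bsub>M\<^esub>"] N.smult_l_null[of "\<phi> \<zero>\<^bsub>M\<^esub>"] by simp
qed

lemma linear_map_diff:
  assumes "Module.module scalars M" "Module.module scalars N" "linear_map M N \<phi>"
    "x \<in> carrier M" "y \<in> carrier M"
  shows "\<phi> (x \<ominus>\<^bsub>M\<^esub> y) = \<phi> x \<ominus>\<^bsub>N\<^esub> \<phi> y"
proof -
  interpret M: Module.module scalars M by fact
  interpret N: Module.module scalars N by fact
  have c: "\<phi> x \<in> carrier N" "\<phi> y \<in> carrier N" "\<phi> (x \<ominus>\<^bsub>M\<^esub> y) \<in> carrier N"
    using assms unfolding linear_map_def by auto
  have "\<phi> (x \<ominus>\<^bsub>M\<^esub> y) \<oplus>\<^bsub>N\<^esub> \<phi> y = \<phi> ((x \<ominus>\<^bsub>M\<^esub> y) \<oplus>\<^bsub>M\<^esub> y)"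
    using assms(3-5) unfolding linear_map_def by simp
  also have "(x \<ominus>\<^bsub>M\<^esub> y) \<oplus>\<^bsub>M\<^esub> y = x"
    using assms(4,5) by (simp add: M.minus_eq M.a_assoc M.l_neg)
  finally have "\<phi> x = \<phi> (x \<ominus>\<^bsub>M\<^esub> y) \<oplus>\<^bsub>N\<^esub> \<phi> y" ..
  then show ?thesis using c by (simp add: N.minus_eq N.a_assoc N.r_neg)
qed

lemma linear_map_compose:
  "\<lbrakk>linear_map L M \<phi>; linear_map M N \<psi>\<rbrakk> \<Longrightarrow> linear_map L N (\<lambda>x. \<psi> (\<phi> x))"
  unfolding linear_map_def by simp

context linear_category
begin

definition arr :: "'m \<Rightarrow> 'o \<Rightarrow> 'o \<Rightarrow> bool" where
  "arr f A Y \<longleftrightarrow> A \<in> Ob C \<and> Y \<in> Ob C \<and> f \<in> Mor C A Y"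

lemma arrI: "\<lbrakk>A \<in> Ob C; Y \<in> Ob C; f \<in> Mor C A Y\<rbrakk> \<Longrightarrow> arr f A Y"
  by (simp add: arr_def)

lemma arrD: "arr f A Y \<Longrightarrow> A \<in> Ob C" "arr f A Y \<Longrightarrow> Y \<in> Ob C" "arr f A Y \<Longrightarrow> f \<in> Mor C A Y"
  by (simp_all add: arr_def)

lemma arr_id: "A \<in> Ob C \<Longrightarrow> arr (ident C A) A A"
  by (simp add: arr_def id_closed)

lemma arr_cmp: "\<lbrakk>arr g Y Z; arr f A Y\<rbrakk> \<Longrightarrow> arr (g \<cdot> f) A Z"
  using cmp_linear_left[of A Y Z f] unfolding arr_def linear_map_def by simp

lemma assoc: "\<lbrakk>arr h Y Z; arr g A Y; arr f W A\<rbrakk> \<Longrightarrow> (h \<cdot> g) \<cdot> f = h \<cdot> (g \<cdot> f)"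
  using cmp_assoc[of W A Y Z f g h] unfolding arr_def by simp

lemma id_l: "arr f A Y \<Longrightarrow> ident C Y \<cdot> f = f"
  using id_left[of A Y f] unfolding arr_def by simp

lemma id_r: "arr f A Y \<Longrightarrow> f \<cdot> ident C A = f"
  using id_right[of A Y f] unfolding arr_def by simp

lemma arr_zero: "\<lbrakk>A \<in> Ob C; Y \<in> Ob C\<rbrakk> \<Longrightarrow> arr \<zero>\<^bsub>Hom C A Y\<^esub> A Y"
proof -
  assume A: "A \<in> Ob C" "Y \<in> Ob C"
  interpret Module.module scalars "Hom C A Y" by (rule Hom_module[OF A])
  show ?thesis using A by (simp add: arr_def)
qed

lemma arr_diff: "\<lbrakk>arr f A Y; arr g A Y\<rbrakk> \<Longrightarrow> arr (f \<ominus>\<^bsub>Hom C A Y\<^esub> g) A Y"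
proof -
  assume f: "arr f A Y" and g: "arr g A Y"
  interpret Module.module scalars "Hom C A Y" using Hom_module f by (simp add: arr_def)
  show ?thesis using f g by (simp add: arr_def)
qed

lemma diff_zero_iff: "\<lbrakk>arr f A Y; arr g A Y\<rbrakk> \<Longrightarrow> f \<ominus>\<^bsub>Hom C A Y\<^esub> g = \<zero>\<^bsub>Hom C A Y\<^esub> \<longleftrightarrow> f = g"
proof -
  assume f: "arr f A Y" and g: "arr g A Y"
  interpret Module.module scalars "Hom C A Y" using Hom_module f by (simp add: arr_def)
  have "f = (f \<ominus>\<^bsub>Hom C A Y\<^esub> g) \<oplus>\<^bsub>Hom C A Y\<^esub> g" "g \<ominus>\<^bsub>Hom C A Y\<^esub> g = \<zero>\<^bsub>Hom C A Y\<^esub>"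
    using f g by (simp_all add: arr_def minus_eq M.a_assoc M.l_neg M.r_neg)
  then show ?thesis using g by (auto simp: arr_def)
qed

lemma cmp_diff_r: "\<lbrakk>arr h Y Z; arr f A Y; arr g A Y\<rbrakk> \<Longrightarrow>
  h \<cdot> (f \<ominus>\<^bsub>Hom C A Y\<^esub> g) = (h \<cdot> f) \<ominus>\<^bsub>Hom C A Z\<^esub> (h \<cdot> g)"
  using linear_map_diff[OF Hom_module[of A Y] Hom_module[of A Z] cmp_linear_right[of A Y Z h], of f g]
  by (simp add: arr_def)

lemma cmp_diff_l: "\<lbrakk>arr h A Y; arr f Y Z; arr g Y Z\<rbrakk> \<Longrightarrow>
  (f \<ominus>\<^bsub>Hom C Y Z\<^esub> g) \<cdot> h = (f \<cdot> h) \<ominus>\<^bsub>Hom C A Z\<^esub> (g \<cdot> h)"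
  using linear_map_diff[OF Hom_module[of Y Z] Hom_module[of A Z] cmp_linear_left[of A Y Z h], of f g]
  by (simp add: arr_def)

lemma cmp_zero_r: "\<lbrakk>A \<in> Ob C; arr h Y Z\<rbrakk> \<Longrightarrow> h \<cdot> \<zero>\<^bsub>Hom C A Y\<^esub> = \<zero>\<^bsub>Hom C A Z\<^esub>"
  using linear_map_zero[OF Hom_module[of A Y] Hom_module[of A Z] cmp_linear_right[of A Y Z h]]
  by (simp add: arr_def)

lemma cmp_zero_l: "\<lbrakk>Z \<in> Ob C; arr h A Y\<rbrakk> \<Longrightarrow> \<zero>\<^bsub>Hom C Y Z\<^esub> \<cdot> h = \<zero>\<^bsub>Hom C A Z\<^esub>"
  using linear_map_zero[OF Hom_module[of Y Z] Hom_module[of A Z] cmp_linear_left[of A Y Z h]]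
  by (simp add: arr_def)

lemma cmp_smult_r: "\<lbrakk>arr h Y Z; arr f A Y\<rbrakk> \<Longrightarrow>
  h \<cdot> (c \<odot>\<^bsub>Hom C A Y\<^esub> f) = c \<odot>\<^bsub>Hom C A Z\<^esub> (h \<cdot> f)"
  using cmp_linear_right[of A Y Z h] unfolding arr_def linear_map_def by simp

lemma cmp_smult_l: "\<lbrakk>arr h A Y; arr f Y Z\<rbrakk> \<Longrightarrow>
  (c \<odot>\<^bsub>Hom C Y Z\<^esub> f) \<cdot> h = c \<odot>\<^bsub>Hom C A Z\<^esub> (f \<cdot> h)"
  using cmp_linear_left[of A Y Z h] unfolding arr_def linear_map_def by simp

lemma arr_smult: "arr f A Y \<Longrightarrow> arr (c \<odot>\<^bsub>Hom C A Y\<^esub> f) A Y"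
  using module.smult_closed[OF Hom_module, of A Y c f] unfolding arr_def by simp

lemma mono_arr: "monomorphism C A Y m \<Longrightarrow> arr m A Y"
  by (simp add: arr_def monomorphism_def)

lemma epi_arr: "epimorphism C A Y m \<Longrightarrow> arr m A Y"
  by (simp add: arr_def epimorphism_def)

lemma mono_cancel: "\<lbrakk>monomorphism C A Y m; arr f W A; arr g W A; m \<cdot> f = m \<cdot> g\<rbrakk> \<Longrightarrow> f = g"
  unfolding arr_def monomorphism_def by (elim conjE) simp

lemma epi_cancel: "\<lbrakk>epimorphism C A Y e; arr f Y Z; arr g Y Z; f \<cdot> e = g \<cdot> e\<rbrakk> \<Longrightarrow> f = g"
  unfolding arr_def epimorphism_def by (elim conjE) simp

lemma monoI: "\<lbrakk>arr m A Y; \<And>W f. \<lbrakk>arr f W A; m \<cdot> f = \<zero>\<^bsub>Hom C W Y\<^esub>\<rbrakk> \<Longrightarrow> f = \<zero>\<^bsub>Hom C W A\<^esub>\<rbrakk> \<Longrightarrow>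
  monomorphism C A Y m"
proof -
  assume m: "arr m A Y" and z: "\<And>W f. \<lbrakk>arr f W A; m \<cdot> f = \<zero>\<^bsub>Hom C W Y\<^esub>\<rbrakk> \<Longrightarrow> f = \<zero>\<^bsub>Hom C W A\<^esub>"
  have "f = g" if f: "arr f W A" and g: "arr g W A" and eq: "m \<cdot> f = m \<cdot> g" for W f g
  proof -
    have "m \<cdot> (f \<ominus>\<^bsub>Hom C W A\<^esub> g) = \<zero>\<^bsub>Hom C W Y\<^esub>"
      using cmp_diff_r[OF m f g] eq diff_zero_iff[OF arr_cmp[OF m f] arr_cmp[OF m g]] by simp
    then show ?thesis using z[OF arr_diff[OF f g]] diff_zero_iff[OF f g] by simp
  qed
  then show ?thesis using m unfolding monomorphism_def arr_def by simp
qed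

lemma epiI: "\<lbrakk>arr e A Y; \<And>Z f. \<lbrakk>arr f Y Z; f \<cdot> e = \<zero>\<^bsub>Hom C A Z\<^esub>\<rbrakk> \<Longrightarrow> f = \<zero>\<^bsub>Hom C Y Z\<^esub>\<rbrakk> \<Longrightarrow>
  epimorphism C A Y e"
proof -
  assume e: "arr e A Y" and z: "\<And>Z f. \<lbrakk>arr f Y Z; f \<cdot> e = \<zero>\<^bsub>Hom C A Z\<^esub>\<rbrakk> \<Longrightarrow> f = \<zero>\<^bsub>Hom C Y Z\<^esub>"
  have "f = g" if f: "arr f Y Z" and g: "arr g Y Z" and eq: "f \<cdot> e = g \<cdot> e" for Z f g
  proof -
    have "(f \<ominus>\<^bsub>Hom C Y Z\<^esub> g) \<cdot> e = \<zero>\<^bsub>Hom C A Z\<^esub>"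
      using cmp_diff_l[OF e f g] eq diff_zero_iff[OF arr_cmp[OF f e] arr_cmp[OF g e]] by simp
    then show ?thesis using z[OF arr_diff[OF f g]] diff_zero_iff[OF f g] by simp
  qed
  then show ?thesis using e unfolding epimorphism_def arr_def by simp
qed

lemma isoE:
  assumes "isomorphism C A Y f"
  obtains g where "arr f A Y" "arr g Y A" "g \<cdot> f = ident C A" "f \<cdot> g = ident C Y"
  using assms unfolding isomorphism_def arr_def by blast

lemma split_mono: "\<lbrakk>arr m A Y; arr r Y A; r \<cdot> m = ident C A\<rbrakk> \<Longrightarrow> monomorphism C A Y m"
proof (rule monoI)
  fix W f
  assume m: "arr m A Y" and r: "arr r Y A" and rm: "r \<cdot> m = ident C A" and f: "arr f W A"
    and z: "m \<cdot> f = \<zero>\<^bsub>Hom C W Y\<^esub>"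
  have "f = r \<cdot> (m \<cdot> f)" using assoc[OF r m f] rm id_l[OF f] by simp
  then show "f = \<zero>\<^bsub>Hom C W A\<^esub>" using cmp_zero_r[OF arrD(1)[OF f] r] z by simp
qed

lemma mono_cmp:
  assumes m: "monomorphism C A Y m" and n: "monomorphism C Y Z n"
  shows "monomorphism C A Z (n \<cdot> m)"
proof (rule monoI)
  note m' = mono_arr[OF m] and n' = mono_arr[OF n]
  show "arr (n \<cdot> m) A Z" by (rule arr_cmp[OF n' m'])
  fix W f assume f: "arr f W A" and z: "(n \<cdot> m) \<cdot> f = \<zero>\<^bsub>Hom C W Z\<^esub>"
  have W: "W \<in> Ob C" using f by (rule arrD)
  have "n \<cdot> (m \<cdot> f) = n \<cdot> \<zero>\<^bsub>Hom C W Y\<^esub>" using z assoc[OF n' m' f] cmp_zero_r[OF W n'] by simp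
  then have "m \<cdot> f = \<zero>\<^bsub>Hom C W Y\<^esub>"
    using mono_cancel[OF n arr_cmp[OF m' f] arr_zero[OF W arrD(1)[OF n']]] by simp
  then have "m \<cdot> f = m \<cdot> \<zero>\<^bsub>Hom C W A\<^esub>" using cmp_zero_r[OF W m'] by simp
  then show "f = \<zero>\<^bsub>Hom C W A\<^esub>"
    using mono_cancel[OF m f arr_zero[OF W arrD(1)[OF m']]] by simp
qed

lemma zero_object_iff: "A \<in> Ob C \<Longrightarrow> zero_object C A \<longleftrightarrow> ident C A = \<zero>\<^bsub>Hom C A A\<^esub>"
proof
  assume A: "A \<in> Ob C" and "zero_object C A"
  then have "\<exists>!f. f \<in> Mor C A A" unfolding zero_object_def by blast
  then show "ident C A = \<zero>\<^bsub>Hom C A A\<^esub>"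
    using arr_id[OF A] arr_zero[OF A A] unfolding arr_def by blast
next
  assume A: "A \<in> Ob C" and z: "ident C A = \<zero>\<^bsub>Hom C A A\<^esub>"
  have from0: "f = \<zero>\<^bsub>Hom C A Y\<^esub>" if "arr f A Y" for f Y
    using id_r[OF that] cmp_zero_r[OF A that] z by simp
  have to0: "f = \<zero>\<^bsub>Hom C Y A\<^esub>" if "arr f Y A" for f Y
    using id_l[OF that] cmp_zero_l[OF A that] z by simp
  show "zero_object C A"
    unfolding zero_object_def
  proof (intro conjI ballI A)
    fix Y assume Y: "Y \<in> Ob C"
    show "\<exists>!f. f \<in> Mor C Y A"
      using arrD(3)[OF arr_zero[OF Y A]] to0[OF arrI[OF Y A]] by (rule ex1I)
    show "\<exists>!f. f \<in> Mor C A Y"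
      using arrD(3)[OF arr_zero[OF A Y]] from0[OF arrI[OF A Y]] by (rule ex1I)
  qed
qed

lemma from_zero_object: "\<lbrakk>zero_object C A; arr f A Y\<rbrakk> \<Longrightarrow> f = \<zero>\<^bsub>Hom C A Y\<^esub>"
  using arr_id cmp_zero_r zero_object_iff id_r arrD(1) by metis

lemma to_zero_object: "\<lbrakk>zero_object C Y; arr f A Y\<rbrakk> \<Longrightarrow> f = \<zero>\<^bsub>Hom C A Y\<^esub>"
  using arr_id cmp_zero_l zero_object_iff id_l arrD(2) by metis

lemma epi_nonzero:
  assumes e: "epimorphism C A Y e" and Y: "\<not> zero_object C Y"
  shows "e \<noteq> \<zero>\<^bsub>Hom C A Y\<^esub>"
proof
  note e' = epi_arr[OF e]
  note Y' = arrD(2)[OF e']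
  assume "e = \<zero>\<^bsub>Hom C A Y\<^esub>"
  then have "ident C Y \<cdot> e = \<zero>\<^bsub>Hom C Y Y\<^esub> \<cdot> e" using id_l[OF e'] cmp_zero_l[OF Y' e'] by simp
  then have "ident C Y = \<zero>\<^bsub>Hom C Y Y\<^esub>" using epi_cancel[OF e arr_id arr_zero] Y' by blast
  then show False using Y zero_object_iff[OF Y'] by simp
qed

lemma mono_nonzero:
  assumes m: "monomorphism C A Y m" and A: "\<not> zero_object C A"
  shows "m \<noteq> \<zero>\<^bsub>Hom C A Y\<^esub>"
proof
  note m' = mono_arr[OF m]
  note A' = arrD(1)[OF m']
  assume "m = \<zero>\<^bsub>Hom C A Y\<^esub>"
  then have "m \<cdot> ident C A = m \<cdot> \<zero>\<^bsub>Hom C A A\<^esub>" using id_r[OF m'] cmp_zero_r[OF A' m'] by simp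
  then have "ident C A = \<zero>\<^bsub>Hom C A A\<^esub>" using mono_cancel[OF m arr_id arr_zero] A' by blast
  then show False using A zero_object_iff[OF A'] by simp
qed

lemma kernelE:
  assumes "is_kernel C A Y f K i" "A \<in> Ob C" "Y \<in> Ob C"
  shows "arr i K A" "f \<cdot> i = \<zero>\<^bsub>Hom C K Y\<^esub>"
    "\<And>W g. \<lbrakk>arr g W A; f \<cdot> g = \<zero>\<^bsub>Hom C W Y\<^esub>\<rbrakk> \<Longrightarrow> \<exists>h. arr h W K \<and> i \<cdot> h = g"
  using assms unfolding is_kernel_def arr_def by blast+

lemma cokernelE:
  assumes "is_cokernel C A Y f Q q" "A \<in> Ob C" "Y \<in> Ob C"
  shows "arr q Y Q" "q \<cdot> f = \<zero>\<^bsub>Hom C A Q\<^esub>"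
    "\<And>Z g. \<lbrakk>arr g Y Z; g \<cdot> f = \<zero>\<^bsub>Hom C A Z\<^esub>\<rbrakk> \<Longrightarrow> \<exists>h. arr h Q Z \<and> h \<cdot> q = g"
  using assms unfolding is_cokernel_def arr_def by blast+

lemma kernel_mono:
  assumes k: "is_kernel C A Y f K i" and f: "arr f A Y"
  shows "monomorphism C K A i"
proof -
  note i = kernelE[OF k arrD(1,2)[OF f]]
  have "g = h" if g: "arr g W K" and h: "arr h W K" and eq: "i \<cdot> g = i \<cdot> h" for W g h
  proof -
    have "f \<cdot> (i \<cdot> g) = \<zero>\<^bsub>Hom C W Y\<^esub>"
      using assoc[OF f i(1) g] i(2) cmp_zero_l[OF arrD(2)[OF f] g] by simp
    then have "\<exists>!u. u \<in> Mor C W K \<and> i \<cdot> u = i \<cdot> g"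
      using k arr_cmp[OF i(1) g] unfolding is_kernel_def arr_def by blast
    then show ?thesis using g h eq unfolding arr_def by metis
  qed
  then show ?thesis using i(1) unfolding monomorphism_def arr_def by simp
qed

lemma cokernel_epi:
  assumes k: "is_cokernel C A Y f Q q" and f: "arr f A Y"
  shows "epimorphism C Y Q q"
proof -
  note q = cokernelE[OF k arrD(1,2)[OF f]]
  have "g = h" if g: "arr g Q Z" and h: "arr h Q Z" and eq: "g \<cdot> q = h \<cdot> q" for Z g h
  proof -
    have "(g \<cdot> q) \<cdot> f = \<zero>\<^bsub>Hom C A Z\<^esub>"
      using assoc[OF g q(1) f] q(2) cmp_zero_r[OF arrD(1)[OF f] g] by simp
    then have "\<exists>!u. u \<in> Mor C Q Z \<and> u \<cdot> q = g \<cdot> q"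
      using k arr_cmp[OF g q(1)] unfolding is_cokernel_def arr_def by blast
    then show ?thesis using g h eq unfolding arr_def by metis
  qed
  then show ?thesis using q(1) unfolding epimorphism_def arr_def by simp
qed

subsection \<open>Endomorphism algebras\<close>

lemma End_ring_simps [simp]:
  "carrier (End_ring C A) = Mor C A A" "\<one>\<^bsub>End_ring C A\<^esub> = ident C A"
  "\<zero>\<^bsub>End_ring C A\<^esub> = \<zero>\<^bsub>Hom C A A\<^esub>" "(\<otimes>\<^bsub>End_ring C A\<^esub>) = (\<cdot>)"
  "(\<oplus>\<^bsub>End_ring C A\<^esub>) = (\<oplus>\<^bsub>Hom C A A\<^esub>)"
  by (simp_all add: End_ring_def)

lemma End_ring: "A \<in> Ob C \<Longrightarrow> ring (End_ring C A)"
proof -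
  assume A: "A \<in> Ob C"
  interpret M: Module.module scalars "Hom C A A" by (rule Hom_module[OF A A])
  show ?thesis
  proof (rule ringI)
    show "abelian_group (End_ring C A)"
      by (rule abelian_groupI)
        (use M.l_neg in \<open>auto simp: M.a_ac intro!: bexI[of _ "\<ominus>\<^bsub>Hom C A A\<^esub> x" for x]\<close>)
    show "monoid (End_ring C A)"
      by (rule monoidI)
        (use A arr_cmp[of _ A A _ A] assoc[of _ A A _ A _ A] id_left[of A A] id_right[of A A] id_closed
          in \<open>auto simp: arr_def\<close>)
  qed (use A cmp_linear_left[of A A A] cmp_linear_right[of A A A] in \<open>auto simp: linear_map_def\<close>)
qed

lemma End_ring_diff: "\<lbrakk>arr f A A; arr g A A\<rbrakk> \<Longrightarrow> f \<ominus>\<^bsub>End_ring C A\<^esub> g = f \<ominus>\<^bsub>Hom C A A\<^esub> g"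
  by (simp add: a_minus_def a_inv_def m_inv_def)

lemma End_ring_Units: "A \<in> Ob C \<Longrightarrow> f \<in> Units (End_ring C A) \<longleftrightarrow> isomorphism C A A f"
  unfolding Units_def isomorphism_def by auto

lemma End_fin_dim_algebra:
  fixes C' :: "('o, 'm, 'c::alg_closed_field, 'y) lin_cat_scheme"
  assumes "linear_category C'" and A: "A \<in> Ob C'" and fl: "finite_length_module scalars (Hom C' A A)"
  shows "fin_dim_algebra (End_ring C' A) (Hom C' A A)"
proof -
  interpret D: linear_category C' by fact
  show ?thesis
    by (intro fin_dim_algebra.intro fin_dim_algebra_axioms.intro D.End_ring D.Hom_module A fl)
      (use A D.cmp_linear_left[of A A A] D.cmp_linear_right[of A A A] in \<open>auto simp: linear_map_def\<close>)
qed

text \<open>If \<open>n\<close> fixes \<open>e\<close>, so does every power of \<open>n\<close>, including the zero one.\<close>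

lemma nilpotent_fixes_only_zero:
  assumes n: "arr n A A" and nil: "n [^]\<^bsub>End_ring C A\<^esub> (k::nat) = \<zero>\<^bsub>Hom C A A\<^esub>"
  shows "\<lbrakk>arr e A Y; e \<cdot> n = e\<rbrakk> \<Longrightarrow> e = \<zero>\<^bsub>Hom C A Y\<^esub>"
    "\<lbrakk>arr e Y A; n \<cdot> e = e\<rbrakk> \<Longrightarrow> e = \<zero>\<^bsub>Hom C Y A\<^esub>"
proof -
  have A: "A \<in> Ob C" using n by (rule arrD)
  interpret R: ring "End_ring C A" by (rule End_ring[OF A])
  have nk: "arr (n [^]\<^bsub>End_ring C A\<^esub> (m::nat)) A A" for m
    using R.nat_pow_closed[of n m] n by (simp add: arr_def)
  show "e = \<zero>\<^bsub>Hom C A Y\<^esub>" if e: "arr e A Y" and en: "e \<cdot> n = e"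
  proof -
    have "e \<cdot> (n [^]\<^bsub>End_ring C A\<^esub> (m::nat)) = e" for m
    proof (induction m)
      case (Suc m)
      then show ?case using assoc[OF e nk[of m] n] en by simp
    qed (simp add: id_r[OF e])
    from this[of k] show ?thesis using nil cmp_zero_r[OF A e] by simp
  qed
  show "e = \<zero>\<^bsub>Hom C Y A\<^esub>" if e: "arr e Y A" and en: "n \<cdot> e = e"
  proof -
    have "(n [^]\<^bsub>End_ring C A\<^esub> (m::nat)) \<cdot> e = e" for m
    proof (induction m)
      case (Suc m)
      then show ?case using assoc[OF nk[of m] n e] en by simp
    qed (simp add: id_l[OF e])
    from this[of k] show ?thesis using nil cmp_zero_l[OF A e] by simp
  qed
qed

end

section \<open>Simple, projective and injective objects\<close>

definition (in linear_category) injective :: "'o \<Rightarrow> bool" where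
  "injective I \<longleftrightarrow> I \<in> Ob C \<and>
     (\<forall>A Y m. monomorphism C A Y m \<longrightarrow> (\<forall>f\<in>Mor C A I. \<exists>g\<in>Mor C Y I. g \<cdot> m = f))"

context abelian_category
begin

text \<open>
  If \<open>g f = 0\<close>, then \<open>f\<close> factors through the kernel of \<open>g\<close>, a subobject of \<open>S\<close>.  It is nonzero
  because \<open>f\<close> is, hence all of \<open>S\<close>.
\<close>

lemma nonzero_to_simple_epi:
  assumes S: "simple_object C S" and f: "arr f A S" and nz: "f \<noteq> \<zero>\<^bsub>Hom C A S\<^esub>"
  shows "epimorphism C A S f"
proof (rule epiI[OF f])
  fix Z g assume g: "arr g S Z" and gf: "g \<cdot> f = \<zero>\<^bsub>Hom C A Z\<^esub>"
  obtain K i where k: "is_kernel C S Z g K i" using kernel_exists g arrD by blast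
  note i = kernelE[OF k arrD(1,2)[OF g]]
  obtain h where h: "arr h A K" "i \<cdot> h = f" using i(3)[OF f gf] by blast
  have "zero_object C K \<or> isomorphism C K S i"
    using S kernel_mono[OF k g] unfolding simple_object_def by blast
  then show "g = \<zero>\<^bsub>Hom C S Z\<^esub>"
  proof
    assume "zero_object C K"
    then have "i = \<zero>\<^bsub>Hom C K S\<^esub>" using from_zero_object i(1) by blast
    then show ?thesis using h cmp_zero_l[OF arrD(2)[OF f] h(1)] nz by simp
  next
    assume "isomorphism C K S i"
    then obtain j where j: "arr j S K" "i \<cdot> j = ident C S" by (rule isoE)
    have "g = (g \<cdot> i) \<cdot> j" using assoc[OF g i(1) j(1)] j(2) id_r[OF g] by simp
    then show ?thesis using i(2) cmp_zero_l[OF arrD(2)[OF g] j(1)] by simp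
  qed
qed

lemma nonzero_from_simple_mono:
  assumes S: "simple_object C S" and f: "arr f S Y" and nz: "f \<noteq> \<zero>\<^bsub>Hom C S Y\<^esub>"
  shows "monomorphism C S Y f"
proof -
  obtain K i where k: "is_kernel C S Y f K i" using kernel_exists f arrD by blast
  note i = kernelE[OF k arrD(1,2)[OF f]]
  have "zero_object C K \<or> isomorphism C K S i"
    using S kernel_mono[OF k f] unfolding simple_object_def by blast
  then show ?thesis
  proof
    assume K: "zero_object C K"
    show ?thesis
    proof (rule monoI[OF f])
      fix W g assume g: "arr g W S" and fg: "f \<cdot> g = \<zero>\<^bsub>Hom C W Y\<^esub>"
      obtain h where h: "arr h W K" "i \<cdot> h = g" using i(3)[OF g fg] by blast
      show "g = \<zero>\<^bsub>Hom C W S\<^esub>"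
        using to_zero_object[OF K h(1)] h(2) cmp_zero_r[OF arrD(1)[OF g] i(1)] by simp
    qed
  next
    assume "isomorphism C K S i"
    then obtain j where j: "arr j S K" "i \<cdot> j = ident C S" by (rule isoE)
    have "f = (f \<cdot> i) \<cdot> j" using assoc[OF f i(1) j(1)] j(2) id_r[OF f] by simp
    then show ?thesis using i(2) cmp_zero_l[OF arrD(2)[OF f] j(1)] nz by simp
  qed
qed

lemma schur:
  assumes S: "simple_object C S" and T: "simple_object C T" and f: "arr f S T"
    and nz: "f \<noteq> \<zero>\<^bsub>Hom C S T\<^esub>"
  shows "isomorphism C S T f"
  using nonzero_from_simple_mono[OF S f nz] S T unfolding simple_object_def by blast

text \<open>The cokernel of a map out of zero is an isomorphism; only its inverse is recorded.\<close>

lemma cokernel_of_zero_embeds: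
  assumes f: "arr f A Y" and A: "zero_object C A" and q: "is_cokernel C A Y f S q"
  obtains h where "monomorphism C S Y h"
proof -
  note q' = cokernelE[OF q arrD(1,2)[OF f]]
  have Y: "Y \<in> Ob C" using f by (rule arrD)
  have "ident C Y \<cdot> f = \<zero>\<^bsub>Hom C A Y\<^esub>" using id_l[OF f] from_zero_object[OF A f] by simp
  then obtain h where h: "arr h S Y" "h \<cdot> q = ident C Y" using q'(3)[OF arr_id[OF Y]] by blast
  have S: "S \<in> Ob C" using h(1) by (rule arrD)
  have "(q \<cdot> h) \<cdot> q = ident C S \<cdot> q"
    using assoc[OF q'(1) h(1) q'(1)] h(2) id_r[OF q'(1)] id_l[OF q'(1)] by simp
  then have "q \<cdot> h = ident C S"
    by (rule epi_cancel[OF cokernel_epi[OF q f] arr_cmp[OF q'(1) h(1)] arr_id[OF S]])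
  then show ?thesis using that split_mono[OF h(1) q'(1)] by blast
qed

text \<open>
  The first nonzero term of a composition series is a simple subobject, its top factor a simple
  quotient.
\<close>

lemma simple_subobject_exists:
  assumes fl: "finite_length_object C A" and nz: "\<not> zero_object C A"
  obtains S m where "simple_object C S" "monomorphism C S A m"
proof -
  obtain n :: nat and Y m where series: "zero_object C (Y 0) \<and> Y n = A \<and>
      (\<forall>i<n. monomorphism C (Y i) (Y (Suc i)) (m i) \<and>
         (\<exists>S q. is_cokernel C (Y i) (Y (Suc i)) (m i) S q \<and> simple_object C S))"
    using fl unfolding finite_length_object_def by (elim exE)
  have "i \<le> n \<Longrightarrow> zero_object C (Y i) \<or> (\<exists>S j. simple_object C S \<and> monomorphism C S (Y i) j)" for i
  proof (induction i)
    case 0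
    then show ?case using series by simp
  next
    case (Suc i)
    have mi: "monomorphism C (Y i) (Y (Suc i)) (m i)" using series Suc by simp
    obtain S q where q: "is_cokernel C (Y i) (Y (Suc i)) (m i) S q" "simple_object C S"
      using series Suc by (meson Suc_le_lessD)
    have "zero_object C (Y i) \<or> (\<exists>S j. simple_object C S \<and> monomorphism C S (Y i) j)"
      using Suc by simp
    then show ?case
    proof
      assume "zero_object C (Y i)"
      then show ?thesis using cokernel_of_zero_embeds[OF mono_arr[OF mi] _ q(1)] q(2) by metis
    next
      assume "\<exists>S j. simple_object C S \<and> monomorphism C S (Y i) j"
      then show ?thesis using mono_cmp[OF _ mi] by blast
    qed
  qed
  from this[of n] show ?thesis using that series nz by auto
qed

lemma simple_quotient_exists:
  assumes fl: "finite_length_object C A" and nz: "\<not> zero_object C A"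
  obtains S q where "simple_object C S" "epimorphism C A S q"
proof -
  obtain n :: nat and Y m where series: "zero_object C (Y 0) \<and> Y n = A \<and>
      (\<forall>i<n. monomorphism C (Y i) (Y (Suc i)) (m i) \<and>
         (\<exists>S q. is_cokernel C (Y i) (Y (Suc i)) (m i) S q \<and> simple_object C S))"
    using fl unfolding finite_length_object_def by (elim exE)
  obtain i where i: "n = Suc i" using series nz by (cases n) auto
  then obtain S q where q: "is_cokernel C (Y i) A (m i) S q" "simple_object C S"
    using series by auto
  have "monomorphism C (Y i) A (m i)" using series i by auto
  then show ?thesis using that q cokernel_epi[OF q(1) mono_arr] by blast
qed

text \<open>Idempotents split: the images of \<open>e\<close> and \<open>1 - e\<close> are the kernels of \<open>1 - e\<close> and \<open>e\<close>.\<close>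

lemma indecomposable_idempotent:
  assumes P: "indecomposable C P" and e: "arr e P P" and ee: "e \<cdot> e = e"
  shows "e = \<zero>\<^bsub>Hom C P P\<^esub> \<or> e = ident C P"
proof -
  have Po: "P \<in> Ob C" using e by (rule arrD)
  define e' where "e' = ident C P \<ominus>\<^bsub>Hom C P P\<^esub> e"
  have e': "arr e' P P" unfolding e'_def by (rule arr_diff[OF arr_id[OF Po] e])
  have e'e: "e' \<cdot> e = \<zero>\<^bsub>Hom C P P\<^esub>" "e \<cdot> e' = \<zero>\<^bsub>Hom C P P\<^esub>"
    unfolding e'_def using cmp_diff_l[OF e arr_id[OF Po] e] cmp_diff_r[OF e arr_id[OF Po] e]
      id_l[OF e] id_r[OF e] ee diff_zero_iff[OF e e] by simp_all
  have act: "e' \<cdot> x = x" if x: "arr x W P" and ex: "e \<cdot> x = \<zero>\<^bsub>Hom C W P\<^esub>" for x W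
  proof -
    interpret Module.module scalars "Hom C W P" using Hom_module x by (simp add: arr_def)
    have "e' \<cdot> x = x \<ominus>\<^bsub>Hom C W P\<^esub> \<zero>\<^bsub>Hom C W P\<^esub>"
      unfolding e'_def using cmp_diff_l[OF x arr_id[OF Po] e] id_l[OF x] ex by simp
    then show ?thesis using x by (simp add: arr_def minus_eq)
  qed
  have act': "e \<cdot> x = x" if x: "arr x W P" and ex: "e' \<cdot> x = \<zero>\<^bsub>Hom C W P\<^esub>" for x W
    using ex cmp_diff_l[OF x arr_id[OF Po] e] id_l[OF x] diff_zero_iff[OF x arr_cmp[OF e x]]
    unfolding e'_def by simp
  obtain Y i where kY: "is_kernel C P P e' Y i" using kernel_exists e' Po arrD by blast
  obtain Z j where kZ: "is_kernel C P P e Z j" using kernel_exists e Po arrD by blast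
  note i = kernelE[OF kY Po Po] and j = kernelE[OF kZ Po Po]
  note im = kernel_mono[OF kY e'] and jm = kernel_mono[OF kZ e]
  obtain p where p: "arr p P Y" "i \<cdot> p = e" using i(3)[OF e e'e(1)] by blast
  obtain q where q: "arr q P Z" "j \<cdot> q = e'" using j(3)[OF e' e'e(2)] by blast
  have Y: "Y \<in> Ob C" and Z: "Z \<in> Ob C" using p q arrD by blast+
  have "i \<cdot> (p \<cdot> i) = i \<cdot> ident C Y"
    using assoc[OF i(1) p(1) i(1)] p(2) act'[OF i(1,2)] id_r[OF i(1)] by simp
  then have pi: "p \<cdot> i = ident C Y" by (rule mono_cancel[OF im arr_cmp[OF p(1) i(1)] arr_id[OF Y]])
  have "j \<cdot> (q \<cdot> j) = j \<cdot> ident C Z"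
    using assoc[OF j(1) q(1) j(1)] q(2) act[OF j(1,2)] id_r[OF j(1)] by simp
  then have qj: "q \<cdot> j = ident C Z" by (rule mono_cancel[OF jm arr_cmp[OF q(1) j(1)] arr_id[OF Z]])
  have "j \<cdot> (q \<cdot> i) = j \<cdot> \<zero>\<^bsub>Hom C Y Z\<^esub>"
    using assoc[OF j(1) q(1) i(1)] q(2) i(2) cmp_zero_r[OF Y j(1)] by simp
  then have qi: "q \<cdot> i = \<zero>\<^bsub>Hom C Y Z\<^esub>" by (rule mono_cancel[OF jm arr_cmp[OF q(1) i(1)] arr_zero[OF Y Z]])
  have "i \<cdot> (p \<cdot> j) = i \<cdot> \<zero>\<^bsub>Hom C Z Y\<^esub>"
    using assoc[OF i(1) p(1) j(1)] p(2) j(2) cmp_zero_r[OF Z i(1)] by simp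
  then have pj: "p \<cdot> j = \<zero>\<^bsub>Hom C Z Y\<^esub>" by (rule mono_cancel[OF im arr_cmp[OF p(1) j(1)] arr_zero[OF Z Y]])
  have sum: "e \<oplus>\<^bsub>Hom C P P\<^esub> e' = ident C P"
  proof -
    interpret Module.module scalars "Hom C P P" using Hom_module Po by simp
    show ?thesis unfolding e'_def using arrD(3)[OF e] arrD(3)[OF arr_id[OF Po]]
      by (simp add: minus_eq M.a_lcomm[of e] M.r_neg)
  qed
  have "is_biproduct C P Y Z i j p q"
    unfolding is_biproduct_def
    using Po Y Z arrD(3)[OF i(1)] arrD(3)[OF j(1)] arrD(3)[OF p(1)] arrD(3)[OF q(1)] pi qj qi pj p(2) q(2) sum
    by simp
  then have "zero_object C Y \<or> zero_object C Z" using P unfolding indecomposable_def by blast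
  then show ?thesis
  proof
    assume "zero_object C Y"
    then have "p = \<zero>\<^bsub>Hom C P Y\<^esub>" using to_zero_object p(1) by blast
    then show ?thesis using p(2) cmp_zero_r[OF Po i(1)] by simp
  next
    assume "zero_object C Z"
    then have "q = \<zero>\<^bsub>Hom C P Z\<^esub>" using to_zero_object q(1) by blast
    then have "e' = \<zero>\<^bsub>Hom C P P\<^esub>" using q(2) cmp_zero_r[OF Po j(1)] by simp
    then show ?thesis unfolding e'_def using diff_zero_iff[OF arr_id[OF Po] e] by simp
  qed
qed

lemma injective_extend: "\<lbrakk>injective I; monomorphism C A Y m; arr f A I\<rbrakk> \<Longrightarrow> \<exists>g. arr g Y I \<and> g \<cdot> m = f"
  unfolding injective_def arr_def monomorphism_def by blast

lemma projective_lift: "\<lbrakk>projective C P; epimorphism C A Y e; arr f P Y\<rbrakk> \<Longrightarrow> \<exists>g. arr g P A \<and> e \<cdot> g = f"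
  unfolding projective_def arr_def epimorphism_def by blast

lemma nonunit_annihilates:
  assumes loc: "unit_nilpotent_ring (End_ring C P)" and n: "arr n P P" and noniso: "\<not> isomorphism C P P n"
  shows "\<lbrakk>arr e P Y; e \<cdot> n = e\<rbrakk> \<Longrightarrow> e = \<zero>\<^bsub>Hom C P Y\<^esub>"
    "\<lbrakk>arr e Y P; n \<cdot> e = e\<rbrakk> \<Longrightarrow> e = \<zero>\<^bsub>Hom C Y P\<^esub>"
proof -
  have "n \<notin> Units (End_ring C P)" using End_ring_Units[OF arrD(1)[OF n]] noniso by simp
  then obtain k :: nat where "n [^]\<^bsub>End_ring C P\<^esub> k = \<zero>\<^bsub>Hom C P P\<^esub>"
    using unit_nilpotent_ring.unit_or_nilpotent[OF loc, of n] arrD(3)[OF n] by auto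
  then show "\<lbrakk>arr e P Y; e \<cdot> n = e\<rbrakk> \<Longrightarrow> e = \<zero>\<^bsub>Hom C P Y\<^esub>"
    "\<lbrakk>arr e Y P; n \<cdot> e = e\<rbrakk> \<Longrightarrow> e = \<zero>\<^bsub>Hom C Y P\<^esub>"
    using nilpotent_fixes_only_zero[OF n] by blast+
qed

text \<open>
  A simple quotient \<open>e\<close> of \<open>P\<close> that does not factor through \<open>\<epsilon>\<close> is an epimorphism on \<open>ker \<epsilon>\<close>.  A lift of
  \<open>e\<close> to \<open>ker \<epsilon>\<close> gives an endomorphism \<open>n\<close> of \<open>P\<close> with \<open>\<epsilon> n = 0\<close> and \<open>e n = e\<close>.  The first
  equation makes \<open>n\<close> a nonunit, hence nilpotent, and the second then gives \<open>e = 0\<close>.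
\<close>

lemma unique_simple_quotient:
  assumes P: "projective C P" and loc: "unit_nilpotent_ring (End_ring C P)"
    and \<beta>: "simple_object C \<beta>" and \<epsilon>: "epimorphism C P \<beta> \<epsilon>"
  shows "unique_simple_quotient C P \<beta> \<epsilon>"
proof -
  note \<epsilon>' = epi_arr[OF \<epsilon>]
  have Po: "P \<in> Ob C" and \<beta>o: "\<beta> \<in> Ob C" using \<epsilon>' by (auto dest: arrD)
  have \<epsilon>0: "\<epsilon> \<noteq> \<zero>\<^bsub>Hom C P \<beta>\<^esub>" using epi_nonzero[OF \<epsilon>] \<beta> unfolding simple_object_def by blast
  have "\<exists>\<phi>. isomorphism C \<beta> S \<phi> \<and> e = \<phi> \<cdot> \<epsilon>" if S: "simple_object C S" and e: "epimorphism C P S e" for S e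
  proof -
    note e' = epi_arr[OF e]
    have e0: "e \<noteq> \<zero>\<^bsub>Hom C P S\<^esub>" using epi_nonzero[OF e] S unfolding simple_object_def by blast
    obtain K k where k: "is_kernel C P \<beta> \<epsilon> K k" using kernel_exists Po \<beta>o arrD(3)[OF \<epsilon>'] by blast
    note k' = kernelE[OF k Po \<beta>o]
    have ek: "arr (e \<cdot> k) K S" by (rule arr_cmp[OF e' k'(1)])
    show ?thesis
    proof (cases "e \<cdot> k = \<zero>\<^bsub>Hom C K S\<^esub>")
      case True
      obtain W u where u: "arr u W P" and cok: "is_cokernel C W P u \<beta> \<epsilon>"
        using epi_is_cokernel[OF \<epsilon>] Po unfolding arr_def by blast
      note c = cokernelE[OF cok arrD(1,2)[OF u]]
      obtain h where h: "arr h W K" "k \<cdot> h = u" using k'(3)[OF u c(2)] by blast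
      have "e \<cdot> u = (e \<cdot> k) \<cdot> h" using assoc[OF e' k'(1) h(1)] h(2) by simp
      then have "e \<cdot> u = \<zero>\<^bsub>Hom C W S\<^esub>" using True cmp_zero_l[OF arrD(2)[OF e'] h(1)] by simp
      then obtain \<phi> where \<phi>: "arr \<phi> \<beta> S" "\<phi> \<cdot> \<epsilon> = e" using c(3)[OF e'] by blast
      have "\<phi> \<noteq> \<zero>\<^bsub>Hom C \<beta> S\<^esub>" using \<phi>(2) e0 cmp_zero_l[OF arrD(2)[OF e'] \<epsilon>'] by auto
      then show ?thesis using schur[OF \<beta> S \<phi>(1)] \<phi>(2) by blast
    next
      case False
      then have "epimorphism C K S (e \<cdot> k)" by (rule nonzero_to_simple_epi[OF S ek])
      then obtain g where g: "arr g P K" "(e \<cdot> k) \<cdot> g = e" using projective_lift[OF P _ e'] by blast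
      have n: "arr (k \<cdot> g) P P" by (rule arr_cmp[OF k'(1) g(1)])
      have \<epsilon>n: "\<epsilon> \<cdot> (k \<cdot> g) = \<zero>\<^bsub>Hom C P \<beta>\<^esub>"
        using assoc[OF \<epsilon>' k'(1) g(1)] k'(2) cmp_zero_l[OF \<beta>o g(1)] by simp
      have "\<not> isomorphism C P P (k \<cdot> g)"
      proof
        assume "isomorphism C P P (k \<cdot> g)"
        then obtain v where v: "arr v P P" "(k \<cdot> g) \<cdot> v = ident C P" by (rule isoE)
        have "\<epsilon> = (\<epsilon> \<cdot> (k \<cdot> g)) \<cdot> v" using assoc[OF \<epsilon>' n v(1)] v(2) id_r[OF \<epsilon>'] by simp
        then show False using \<epsilon>n cmp_zero_l[OF \<beta>o v(1)] \<epsilon>0 by simp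
      qed
      then have "e = \<zero>\<^bsub>Hom C P S\<^esub>"
        using nonunit_annihilates(1)[OF loc n _ e'] assoc[OF e' k'(1) g(1)] g(2) by simp
      then show ?thesis using e0 by simp
    qed
  qed
  then show ?thesis unfolding unique_simple_quotient_def using \<beta> \<epsilon> by blast
qed

text \<open>The dual argument, for an injective object.\<close>

lemma unique_simple_subobject:
  assumes P: "injective P" and loc: "unit_nilpotent_ring (End_ring C P)"
    and \<alpha>: "simple_object C \<alpha>" and \<eta>: "monomorphism C \<alpha> P \<eta>"
  shows "unique_simple_subobject C P \<alpha> \<eta>"
proof -
  note \<eta>' = mono_arr[OF \<eta>]
  have Po: "P \<in> Ob C" and \<alpha>o: "\<alpha> \<in> Ob C" using \<eta>' by (auto dest: arrD)
  have \<eta>0: "\<eta> \<noteq> \<zero>\<^bsub>Hom C \<alpha> P\<^esub>" using mono_nonzero[OF \<eta>] \<alpha> unfolding simple_object_def by blast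
  have "\<exists>\<phi>. isomorphism C S \<alpha> \<phi> \<and> m = \<eta> \<cdot> \<phi>" if S: "simple_object C S" and m: "monomorphism C S P m" for S m
  proof -
    note m' = mono_arr[OF m]
    have m0: "m \<noteq> \<zero>\<^bsub>Hom C S P\<^esub>" using mono_nonzero[OF m] S unfolding simple_object_def by blast
    have So: "S \<in> Ob C" using m' by (rule arrD)
    obtain Q q where q: "is_cokernel C \<alpha> P \<eta> Q q" using cokernel_exists Po \<alpha>o arrD(3)[OF \<eta>'] by blast
    note q' = cokernelE[OF q \<alpha>o Po]
    have qm: "arr (q \<cdot> m) S Q" by (rule arr_cmp[OF q'(1) m'])
    show ?thesis
    proof (cases "q \<cdot> m = \<zero>\<^bsub>Hom C S Q\<^esub>")
      case True
      obtain Z u where u: "arr u P Z" and ker: "is_kernel C P Z u \<alpha> \<eta>"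
        using mono_is_kernel[OF \<eta>] Po unfolding arr_def by blast
      note c = kernelE[OF ker arrD(1,2)[OF u]]
      obtain h where h: "arr h Q Z" "h \<cdot> q = u" using q'(3)[OF u c(2)] by blast
      have "u \<cdot> m = h \<cdot> (q \<cdot> m)" using assoc[OF h(1) q'(1) m'] h(2) by simp
      then have "u \<cdot> m = \<zero>\<^bsub>Hom C S Z\<^esub>" using True cmp_zero_r[OF So h(1)] by simp
      then obtain \<phi> where \<phi>: "arr \<phi> S \<alpha>" "\<eta> \<cdot> \<phi> = m" using c(3)[OF m'] by blast
      have "\<phi> \<noteq> \<zero>\<^bsub>Hom C S \<alpha>\<^esub>" using \<phi>(2) m0 cmp_zero_r[OF So \<eta>'] by auto
      then show ?thesis using schur[OF S \<alpha> \<phi>(1)] \<phi>(2) by blast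
    next
      case False
      then have "monomorphism C S Q (q \<cdot> m)" by (rule nonzero_from_simple_mono[OF S qm])
      then obtain g where g: "arr g Q P" "g \<cdot> (q \<cdot> m) = m" using injective_extend[OF P _ m'] by blast
      have n: "arr (g \<cdot> q) P P" by (rule arr_cmp[OF g(1) q'(1)])
      have n\<eta>: "(g \<cdot> q) \<cdot> \<eta> = \<zero>\<^bsub>Hom C \<alpha> P\<^esub>"
        using assoc[OF g(1) q'(1) \<eta>'] q'(2) cmp_zero_r[OF \<alpha>o g(1)] by simp
      have "\<not> isomorphism C P P (g \<cdot> q)"
      proof
        assume "isomorphism C P P (g \<cdot> q)"
        then obtain v where v: "arr v P P" "v \<cdot> (g \<cdot> q) = ident C P" by (rule isoE)
        have "\<eta> = v \<cdot> ((g \<cdot> q) \<cdot> \<eta>)" using assoc[OF v(1) n \<eta>'] v(2) id_l[OF \<eta>'] by simp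
        then show False using n\<eta> cmp_zero_r[OF \<alpha>o v(1)] \<eta>0 by simp
      qed
      then have "m = \<zero>\<^bsub>Hom C S P\<^esub>"
        using nonunit_annihilates(2)[OF loc n _ m'] assoc[OF g(1) q'(1) m'] g(2) by simp
      then show ?thesis using m0 by simp
    qed
  qed
  then show ?thesis unfolding unique_simple_subobject_def using \<alpha> \<eta> by blast
qed

end

locale finite_abelian_category = abelian_category C
  for C :: "('o, 'm, 'k::alg_closed_field, 'z) lin_cat_scheme" (structure) +
  assumes loc_fin: "locally_finite C"
begin

lemma End_algebra: "A \<in> Ob C \<Longrightarrow> fin_dim_algebra (End_ring C A) (Hom C A A)"
  using End_fin_dim_algebra[OF linear_category_axioms, of A] loc_fin unfolding locally_finite_def by blast

lemma End_local:
  assumes P: "indecomposable C P"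
  shows "local_algebra (End_ring C P) (Hom C P P)"
proof -
  have Po: "P \<in> Ob C" using P unfolding indecomposable_def by blast
  interpret R: fin_dim_algebra "End_ring C P" "Hom C P P" by (rule End_algebra[OF Po])
  have "ident C P \<noteq> \<zero>\<^bsub>Hom C P P\<^esub>"
    using P zero_object_iff[OF Po] unfolding indecomposable_def by blast
  moreover have "x \<in> Units (End_ring C P) \<or> (\<exists>n::nat. x [^]\<^bsub>End_ring C P\<^esub> n = \<zero>\<^bsub>End_ring C P\<^esub>)"
    if x: "x \<in> carrier (End_ring C P)" for x
  proof (rule R.fitting[OF _ x])
    fix e assume "e \<in> carrier (End_ring C P)" "e \<otimes>\<^bsub>End_ring C P\<^esub> e = e"
    then show "e = \<zero>\<^bsub>End_ring C P\<^esub> \<or> e = \<one>\<^bsub>End_ring C P\<^esub>"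
      using indecomposable_idempotent[OF P, of e] Po by (simp add: arr_def)
  qed
  ultimately show ?thesis
    by (intro local_algebra.intro R.fin_dim_algebra_axioms unit_nilpotent_ring.intro R.ring_axioms
        unit_nilpotent_ring_axioms.intro) simp_all
qed

text \<open>
  By Schur's lemma the endomorphisms form a division algebra, and a finite-dimensional one over an
  algebraically closed field consists of scalars.
\<close>

lemma End_simple:
  assumes S: "simple_object C S" and f: "arr f S S"
  shows "\<exists>c. f = c \<odot>\<^bsub>Hom C S S\<^esub> ident C S"
proof -
  have So: "S \<in> Ob C" using f by (rule arrD)
  interpret R: fin_dim_algebra "End_ring C S" "Hom C S S" by (rule End_algebra[OF So])
  have "\<one>\<^bsub>End_ring C S\<^esub> \<noteq> \<zero>\<^bsub>End_ring C S\<^esub>"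
    using S zero_object_iff[OF So] unfolding simple_object_def by simp
  moreover have "x \<in> Units (End_ring C S) \<or> x = \<zero>\<^bsub>End_ring C S\<^esub>" if "x \<in> carrier (End_ring C S)" for x
    using schur[OF S S, of x] that So End_ring_Units[OF So, of x] by (auto simp: arr_def)
  ultimately have "\<exists>c. f = R.sc c" using R.scalar_if_division[of f] f by (simp add: arr_def)
  then show ?thesis by (simp add: R.sc_def)
qed

lemma smult_inj:
  assumes f: "arr f A Y" and nz: "f \<noteq> \<zero>\<^bsub>Hom C A Y\<^esub>"
    and eq: "c \<odot>\<^bsub>Hom C A Y\<^esub> f = e \<odot>\<^bsub>Hom C A Y\<^esub> f"
  shows "c = e"
proof (rule ccontr)
  interpret Module.module scalars "Hom C A Y" using Hom_module f by (simp add: arr_def)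
  have fM: "f \<in> Mor C A Y" using f by (rule arrD)
  assume ne: "c \<noteq> e"
  have "(c - e) \<odot>\<^bsub>Hom C A Y\<^esub> f \<oplus>\<^bsub>Hom C A Y\<^esub> e \<odot>\<^bsub>Hom C A Y\<^esub> f = c \<odot>\<^bsub>Hom C A Y\<^esub> f"
    using smult_l_distr[of "c - e" e f] fM by simp
  then have z: "(c - e) \<odot>\<^bsub>Hom C A Y\<^esub> f = \<zero>\<^bsub>Hom C A Y\<^esub>"
    using eq fM by (simp add: M.add.r_cancel_one)
  have "f = (inverse (c - e) * (c - e)) \<odot>\<^bsub>Hom C A Y\<^esub> f" using ne fM smult_one[of f] by simp
  also have "\<dots> = \<zero>\<^bsub>Hom C A Y\<^esub>"
    using smult_assoc1[of "inverse (c - e)" "c - e" f] fM z smult_r_null[of "inverse (c - e)"] by simp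
  finally show False using nz by simp
qed

text \<open>
  A nonzero map \<open>\<alpha> \<rightarrow> P\<close> is a simple subobject, so it equals \<open>\<eta>\<close> up to an automorphism of \<open>\<alpha>\<close>,
  which is a scalar; likewise for \<open>P \<rightarrow> \<beta>\<close>.
\<close>

lemma trace_tuple_of_corresponding:
  assumes P: "indecomposable C P" and tup: "corresponding_tuple C P \<alpha> \<beta> \<eta> \<epsilon>"
  shows "trace_tuple C P \<alpha> \<beta> \<eta> \<epsilon>"
proof -
  interpret R: local_algebra "End_ring C P" "Hom C P P" by (rule End_local[OF P])
  have \<beta>: "simple_object C \<beta>" and \<epsilon>: "epimorphism C P \<beta> \<epsilon>" and \<alpha>: "simple_object C \<alpha>"
    and \<eta>: "monomorphism C \<alpha> P \<eta>"
    and u\<epsilon>: "\<And>S e. \<lbrakk>simple_object C S; epimorphism C P S e\<rbrakk> \<Longrightarrow> \<exists>\<phi>. isomorphism C \<beta> S \<phi> \<and> e = \<phi> \<cdot> \<epsilon>"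
    and u\<eta>: "\<And>S m. \<lbrakk>simple_object C S; monomorphism C S P m\<rbrakk> \<Longrightarrow> \<exists>\<phi>. isomorphism C S \<alpha> \<phi> \<and> m = \<eta> \<cdot> \<phi>"
    using tup unfolding corresponding_tuple_def unique_simple_quotient_def unique_simple_subobject_def
    by simp_all
  note \<epsilon>' = epi_arr[OF \<epsilon>] and \<eta>' = mono_arr[OF \<eta>]
  have ob: "P \<in> Ob C" "\<alpha> \<in> Ob C" "\<beta> \<in> Ob C" using \<epsilon>' \<eta>' by (auto dest: arrD)
  have \<epsilon>0: "\<epsilon> \<noteq> \<zero>\<^bsub>Hom C P \<beta>\<^esub>" using epi_nonzero[OF \<epsilon>] \<beta> unfolding simple_object_def by blast
  have \<eta>0: "\<eta> \<noteq> \<zero>\<^bsub>Hom C \<alpha> P\<^esub>" using mono_nonzero[OF \<eta>] \<alpha> unfolding simple_object_def by blast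
  have gen\<eta>: "\<exists>!c. g = c \<odot>\<^bsub>Hom C \<alpha> P\<^esub> \<eta>" if "g \<in> Mor C \<alpha> P" for g
  proof -
    have g: "arr g \<alpha> P" using that ob by (simp add: arr_def)
    have "\<exists>c. g = c \<odot>\<^bsub>Hom C \<alpha> P\<^esub> \<eta>"
    proof (cases "g = \<zero>\<^bsub>Hom C \<alpha> P\<^esub>")
      case True
      interpret V: Module.module scalars "Hom C \<alpha> P" using Hom_module ob by simp
      show ?thesis using True V.smult_l_null[of \<eta>] arrD(3)[OF \<eta>'] by (intro exI[of _ 0]) simp
    next
      case False
      obtain \<phi> where \<phi>: "isomorphism C \<alpha> \<alpha> \<phi>" "g = \<eta> \<cdot> \<phi>"
        using u\<eta>[OF \<alpha> nonzero_from_simple_mono[OF \<alpha> g False]] by blast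
      have "arr \<phi> \<alpha> \<alpha>" using \<phi>(1) by (rule isoE)
      then obtain c where "\<phi> = c \<odot>\<^bsub>Hom C \<alpha> \<alpha>\<^esub> ident C \<alpha>" using End_simple[OF \<alpha>] by blast
      then show ?thesis using \<phi>(2) cmp_smult_r[OF \<eta>' arr_id[OF ob(2)]] id_r[OF \<eta>'] by auto
    qed
    then show ?thesis using smult_inj[OF \<eta>' \<eta>0] by blast
  qed
  have gen\<epsilon>: "\<exists>!c. g = c \<odot>\<^bsub>Hom C P \<beta>\<^esub> \<epsilon>" if "g \<in> Mor C P \<beta>" for g
  proof -
    have g: "arr g P \<beta>" using that ob by (simp add: arr_def)
    have "\<exists>c. g = c \<odot>\<^bsub>Hom C P \<beta>\<^esub> \<epsilon>"
    proof (cases "g = \<zero>\<^bsub>Hom C P \<beta>\<^esub>")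
      case True
      interpret V: Module.module scalars "Hom C P \<beta>" using Hom_module ob by simp
      show ?thesis using True V.smult_l_null[of \<epsilon>] arrD(3)[OF \<epsilon>'] by (intro exI[of _ 0]) simp
    next
      case False
      obtain \<phi> where \<phi>: "isomorphism C \<beta> \<beta> \<phi>" "g = \<phi> \<cdot> \<epsilon>"
        using u\<epsilon>[OF \<beta> nonzero_to_simple_epi[OF \<beta> g False]] by blast
      have "arr \<phi> \<beta> \<beta>" using \<phi>(1) by (rule isoE)
      then obtain c where "\<phi> = c \<odot>\<^bsub>Hom C \<beta> \<beta>\<^esub> ident C \<beta>" using End_simple[OF \<beta>] by blast
      then show ?thesis using \<phi>(2) cmp_smult_l[OF \<epsilon>' arr_id[OF ob(3)]] id_l[OF \<epsilon>'] by auto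
    qed
    then show ?thesis using smult_inj[OF \<epsilon>' \<epsilon>0] by blast
  qed
  show ?thesis
    unfolding trace_tuple_def
    using ob arrD(3)[OF \<epsilon>'] arrD(3)[OF \<eta>'] \<epsilon>0 \<eta>0 gen\<eta> gen\<epsilon> R.quotient_by_radical R.radical_nilpotent
    by (simp add: R.sc_def)
qed

text \<open>
  Both coefficients are the residue of \<open>T\<close>: an invertible endomorphism kills neither \<open>\<eta>\<close> nor
  \<open>\<epsilon>\<close>, so \<open>T - a\<close> and \<open>T - b\<close> lie in the radical.
\<close>

lemma coefficients_agree:
  assumes P: "indecomposable C P" and T: "arr T P P"
    and \<eta>: "arr \<eta> \<alpha> P" "\<eta> \<noteq> \<zero>\<^bsub>Hom C \<alpha> P\<^esub>" and \<epsilon>: "arr \<epsilon> P \<beta>" "\<epsilon> \<noteq> \<zero>\<^bsub>Hom C P \<beta>\<^esub>"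
    and T\<eta>: "T \<cdot> \<eta> = a \<odot>\<^bsub>Hom C \<alpha> P\<^esub> \<eta>" and \<epsilon>T: "\<epsilon> \<cdot> T = b \<odot>\<^bsub>Hom C P \<beta>\<^esub> \<epsilon>"
  shows "a = b"
proof -
  interpret R: local_algebra "End_ring C P" "Hom C P P" by (rule End_local[OF P])
  have Po: "P \<in> Ob C" using T by (rule arrD)
  have residue: "c = R.residue T" if z: "\<And>n. arr n P P \<Longrightarrow> n = T \<ominus>\<^bsub>Hom C P P\<^esub> (c \<odot>\<^bsub>Hom C P P\<^esub> ident C P) \<Longrightarrow> \<not> isomorphism C P P n" for c
  proof -
    have s: "arr (c \<odot>\<^bsub>Hom C P P\<^esub> ident C P) P P" by (rule arr_smult[OF arr_id[OF Po]])
    have "T \<ominus>\<^bsub>End_ring C P\<^esub> R.sc c \<in> R.nonunits"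
      unfolding R.nonunits_def
      using End_ring_diff[OF T s] z[OF arr_diff[OF T s] refl] arrD(3)[OF arr_diff[OF T s]] End_ring_Units[OF Po]
      by (simp add: R.sc_def)
    then show ?thesis using R.residue_eqI[of T c] arrD(3)[OF T] by simp
  qed
  have "a = R.residue T"
  proof (rule residue)
    fix n assume n: "arr n P P" and nT: "n = T \<ominus>\<^bsub>Hom C P P\<^esub> (a \<odot>\<^bsub>Hom C P P\<^esub> ident C P)"
    have "n \<cdot> \<eta> = \<zero>\<^bsub>Hom C \<alpha> P\<^esub>"
      using cmp_diff_l[OF \<eta>(1) T arr_smult[OF arr_id[OF Po]]] cmp_smult_l[OF \<eta>(1) arr_id[OF Po]] id_l[OF \<eta>(1)]
        T\<eta> diff_zero_iff[OF arr_smult[OF \<eta>(1)] arr_smult[OF \<eta>(1)]] unfolding nT by simp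
    then have z: "v \<cdot> (n \<cdot> \<eta>) = \<zero>\<^bsub>Hom C \<alpha> P\<^esub>" if "arr v P P" for v
      using cmp_zero_r[OF arrD(1)[OF \<eta>(1)] that] by simp
    show "\<not> isomorphism C P P n"
    proof
      assume "isomorphism C P P n"
      then obtain v where v: "arr v P P" "v \<cdot> n = ident C P" by (rule isoE)
      show False using assoc[OF v(1) n \<eta>(1)] v(2) id_l[OF \<eta>(1)] z[OF v(1)] \<eta>(2) by simp
    qed
  qed
  moreover have "b = R.residue T"
  proof (rule residue)
    fix n assume n: "arr n P P" and nT: "n = T \<ominus>\<^bsub>Hom C P P\<^esub> (b \<odot>\<^bsub>Hom C P P\<^esub> ident C P)"
    have "\<epsilon> \<cdot> n = \<zero>\<^bsub>Hom C P \<beta>\<^esub>"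
      using cmp_diff_r[OF \<epsilon>(1) T arr_smult[OF arr_id[OF Po]]] cmp_smult_r[OF \<epsilon>(1) arr_id[OF Po]] id_r[OF \<epsilon>(1)]
        \<epsilon>T diff_zero_iff[OF arr_smult[OF \<epsilon>(1)] arr_smult[OF \<epsilon>(1)]] unfolding nT by simp
    then have z: "(\<epsilon> \<cdot> n) \<cdot> v = \<zero>\<^bsub>Hom C P \<beta>\<^esub>" if "arr v P P" for v
      using cmp_zero_l[OF arrD(2)[OF \<epsilon>(1)] that] by simp
    show "\<not> isomorphism C P P n"
    proof
      assume "isomorphism C P P n"
      then obtain v where v: "arr v P P" "n \<cdot> v = ident C P" by (rule isoE)
      show False using assoc[OF \<epsilon>(1) n v(1)] v(2) id_r[OF \<epsilon>(1)] z[OF v(1)] \<epsilon>(2) by simp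
    qed
  qed
  ultimately show ?thesis by simp
qed

end

section \<open>Diagrams in a strict monoidal category\<close>

text \<open>
  Composition and tensor product carry no objects.  Tagging a morphism with its source and target
  lets the simplifier decide composability, so that interchange and associativity can be used as
  rewrite rules in diagram computations.
\<close>

datatype ('o, 'm) tagged = Tag (src: 'o) (under: 'm) (tgt: 'o)

context tensor_category
begin

definition ok :: "('o, 'm) tagged \<Rightarrow> bool" where
  "ok x \<longleftrightarrow> arr (under x) (src x) (tgt x)"

lemma arr_underI: "\<lbrakk>ok x; src x = A; tgt x = Y; under x = f\<rbrakk> \<Longrightarrow> arr f A Y"
  by (auto simp: ok_def)

definition tcmp :: "('o, 'm) tagged \<Rightarrow> ('o, 'm) tagged \<Rightarrow> ('o, 'm) tagged" (infixr "\<bullet>" 70) where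
  "x \<bullet> y = Tag (src y) (under x \<cdot> under y) (tgt x)"

definition ttensor :: "('o, 'm) tagged \<Rightarrow> ('o, 'm) tagged \<Rightarrow> ('o, 'm) tagged" (infixr "\<boxtimes>" 75) where
  "x \<boxtimes> y = Tag (src x \<otimes>\<^sub>o src y) (under x \<otimes>\<^sub>m under y) (tgt x \<otimes>\<^sub>o tgt y)"

definition tid :: "'o \<Rightarrow> ('o, 'm) tagged" ("\<iota>") where
  "\<iota> A = Tag A (ident C A) A"

lemma arr_tensor: "\<lbrakk>arr f A Y; arr g V W\<rbrakk> \<Longrightarrow> arr (f \<otimes>\<^sub>m g) (A \<otimes>\<^sub>o V) (Y \<otimes>\<^sub>o W)"
  using tensor_linear_left[of A Y V W g] tensor_ob_closed unfolding arr_def linear_map_def by simp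

lemma tagged_simps [simp]:
  "src (x \<bullet> y) = src y" "tgt (x \<bullet> y) = tgt x" "under (x \<bullet> y) = under x \<cdot> under y"
  "src (x \<boxtimes> y) = src x \<otimes>\<^sub>o src y" "tgt (x \<boxtimes> y) = tgt x \<otimes>\<^sub>o tgt y"
  "under (x \<boxtimes> y) = under x \<otimes>\<^sub>m under y"
  "src (\<iota> A) = A" "tgt (\<iota> A) = A" "under (\<iota> A) = ident C A"
  by (simp_all add: tcmp_def ttensor_def tid_def)

lemma ok_Tag [simp]: "ok (Tag A f Y) \<longleftrightarrow> arr f A Y"
  by (simp add: ok_def)

lemma ok_cmp [simp]: "\<lbrakk>ok x; ok y; tgt y = src x\<rbrakk> \<Longrightarrow> ok (x \<bullet> y)"
  by (simp add: ok_def arr_cmp)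

lemma ok_tensor [simp]: "\<lbrakk>ok x; ok y\<rbrakk> \<Longrightarrow> ok (x \<boxtimes> y)"
  by (simp add: ok_def arr_tensor)

lemma ok_id [simp]: "A \<in> Ob C \<Longrightarrow> ok (\<iota> A)"
  by (simp add: ok_def arr_id)

lemma ok_Ob: "ok x \<Longrightarrow> src x \<in> Ob C" "ok x \<Longrightarrow> tgt x \<in> Ob C"
  by (auto simp: ok_def arr_def)

lemma objects [simp]:
  "\<one>\<^sub>o \<in> Ob C" "\<lbrakk>A \<in> Ob C; Y \<in> Ob C\<rbrakk> \<Longrightarrow> A \<otimes>\<^sub>o Y \<in> Ob C"
  "\<lbrakk>A \<in> Ob C; Y \<in> Ob C; Z \<in> Ob C\<rbrakk> \<Longrightarrow> (A \<otimes>\<^sub>o Y) \<otimes>\<^sub>o Z = A \<otimes>\<^sub>o (Y \<otimes>\<^sub>o Z)"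
  "A \<in> Ob C \<Longrightarrow> \<one>\<^sub>o \<otimes>\<^sub>o A = A" "A \<in> Ob C \<Longrightarrow> A \<otimes>\<^sub>o \<one>\<^sub>o = A"
  by (simp_all add: unit_closed tensor_ob_closed tensor_ob_assoc tensor_ob_unit_left tensor_ob_unit_right)

lemma tcmp_assoc: "\<lbrakk>ok x; ok y; ok z; tgt y = src x; tgt z = src y\<rbrakk> \<Longrightarrow> (x \<bullet> y) \<bullet> z = x \<bullet> (y \<bullet> z)"
  using assoc[of "under x" "src x" "tgt x" "under y" "src y" "under z" "src z"]
  by (simp add: ok_def tcmp_def)

lemma tid_l [simp]: "\<lbrakk>ok x; A = tgt x\<rbrakk> \<Longrightarrow> \<iota> A \<bullet> x = x"
  by (cases x) (simp add: tcmp_def tid_def id_l)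

lemma tid_r [simp]: "\<lbrakk>ok x; A = src x\<rbrakk> \<Longrightarrow> x \<bullet> \<iota> A = x"
  by (cases x) (simp add: tcmp_def tid_def id_r)

lemma ttensor_assoc: "\<lbrakk>ok x; ok y; ok z\<rbrakk> \<Longrightarrow> (x \<boxtimes> y) \<boxtimes> z = x \<boxtimes> (y \<boxtimes> z)"
  using tensor_mor_assoc[of "src x" "tgt x" "src y" "tgt y" "src z" "tgt z" "under x" "under y" "under z"]
  by (simp add: ok_def arr_def ttensor_def)

lemma ttensor_unit [simp]: "ok x \<Longrightarrow> \<iota> \<one>\<^sub>o \<boxtimes> x = x" "ok x \<Longrightarrow> x \<boxtimes> \<iota> \<one>\<^sub>o = x"
  using tensor_mor_unit_left[of "src x" "tgt x" "under x"] tensor_mor_unit_right[of "src x" "tgt x" "under x"]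
  by (cases x; simp add: ok_def arr_def ttensor_def tid_def)+

lemma ttensor_id: "\<lbrakk>A \<in> Ob C; Y \<in> Ob C\<rbrakk> \<Longrightarrow> \<iota> A \<boxtimes> \<iota> Y = \<iota> (A \<otimes>\<^sub>o Y)"
  by (simp add: ttensor_def tid_def tensor_id)

lemma interchange: "\<lbrakk>ok x; ok y; ok z; ok w; tgt z = src x; tgt w = src y\<rbrakk> \<Longrightarrow>
  (x \<boxtimes> y) \<bullet> (z \<boxtimes> w) = (x \<bullet> z) \<boxtimes> (y \<bullet> w)"
  using tensor_cmp[of "src z" "src x" "tgt x" "src w" "src y" "tgt y" "under z" "under x" "under w" "under y"]
  by (simp add: ok_def arr_def ttensor_def tcmp_def)

lemma whisker_l: "\<lbrakk>A \<in> Ob C; ok x; ok y; tgt y = src x\<rbrakk> \<Longrightarrow>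
  \<iota> A \<boxtimes> (x \<bullet> y) = (\<iota> A \<boxtimes> x) \<bullet> (\<iota> A \<boxtimes> y)"
  using interchange[of "\<iota> A" x "\<iota> A" y] by simp

lemma whisker_r: "\<lbrakk>A \<in> Ob C; ok x; ok y; tgt y = src x\<rbrakk> \<Longrightarrow>
  (x \<bullet> y) \<boxtimes> \<iota> A = (x \<boxtimes> \<iota> A) \<bullet> (y \<boxtimes> \<iota> A)"
  using interchange[of x "\<iota> A" y "\<iota> A"] by simp

lemma slide: "\<lbrakk>ok x; ok y\<rbrakk> \<Longrightarrow> (\<iota> (tgt x) \<boxtimes> y) \<bullet> (x \<boxtimes> \<iota> (src y)) = (x \<boxtimes> \<iota> (tgt y)) \<bullet> (\<iota> (src x) \<boxtimes> y)"
  using interchange[of "\<iota> (tgt x)" y x "\<iota> (src y)"] interchange[of x "\<iota> (tgt y)" "\<iota> (src x)" y] ok_Ob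
  by simp

text \<open>
  Both duals of an object \<open>V\<close> are instances: \<open>(V, V\<^sup>*)\<close> with \<open>coev, ev\<close>, and \<open>(V\<^sup>*, V)\<close> with their
  tilde versions.  So each statement about dual pairs serves for the left and the right side.
\<close>

definition dual_pair :: "'o \<Rightarrow> 'o \<Rightarrow> 'm \<Rightarrow> 'm \<Rightarrow> bool" where
  "dual_pair U Y c e \<longleftrightarrow> U \<in> Ob C \<and> Y \<in> Ob C \<and> arr c \<one>\<^sub>o (U \<otimes>\<^sub>o Y) \<and> arr e (Y \<otimes>\<^sub>o U) \<one>\<^sub>o \<and>
     (ident C U \<otimes>\<^sub>m e) \<cdot> (c \<otimes>\<^sub>m ident C U) = ident C U \<and>
     (e \<otimes>\<^sub>m ident C Y) \<cdot> (ident C Y \<otimes>\<^sub>m c) = ident C Y"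

lemma dual_pairD:
  assumes "dual_pair U Y c e"
  shows "U \<in> Ob C" "Y \<in> Ob C" "arr c \<one>\<^sub>o (U \<otimes>\<^sub>o Y)" "arr e (Y \<otimes>\<^sub>o U) \<one>\<^sub>o"
    "(\<iota> U \<boxtimes> Tag (Y \<otimes>\<^sub>o U) e \<one>\<^sub>o) \<bullet> (Tag \<one>\<^sub>o c (U \<otimes>\<^sub>o Y) \<boxtimes> \<iota> U) = \<iota> U"
    "(Tag (Y \<otimes>\<^sub>o U) e \<one>\<^sub>o \<boxtimes> \<iota> Y) \<bullet> (\<iota> Y \<boxtimes> Tag \<one>\<^sub>o c (U \<otimes>\<^sub>o Y)) = \<iota> Y"
  using assms unfolding dual_pair_def by (simp_all add: tcmp_def ttensor_def tid_def)

text \<open>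
  For a dual pair, \<open>Y \<otimes> -\<close> is left adjoint to \<open>U \<otimes> -\<close> and \<open>- \<otimes> U\<close> is left adjoint to \<open>- \<otimes> Y\<close>.
  The adjunction bijections are \<open>lower_l\<close>, \<open>raise_l\<close> and \<open>lower_r\<close>, \<open>raise_r\<close>.
\<close>

definition lower_l :: "'o \<Rightarrow> 'm \<Rightarrow> 'o \<Rightarrow> 'm \<Rightarrow> 'm" where
  "lower_l Y e A g = (e \<otimes>\<^sub>m ident C A) \<cdot> (ident C Y \<otimes>\<^sub>m g)"

definition raise_l :: "'o \<Rightarrow> 'm \<Rightarrow> 'o \<Rightarrow> 'm \<Rightarrow> 'm" where
  "raise_l U c W h = (ident C U \<otimes>\<^sub>m h) \<cdot> (c \<otimes>\<^sub>m ident C W)"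

definition lower_r :: "'o \<Rightarrow> 'm \<Rightarrow> 'o \<Rightarrow> 'm \<Rightarrow> 'm" where
  "lower_r U e A g = (ident C A \<otimes>\<^sub>m e) \<cdot> (g \<otimes>\<^sub>m ident C U)"

definition raise_r :: "'o \<Rightarrow> 'm \<Rightarrow> 'o \<Rightarrow> 'm \<Rightarrow> 'm" where
  "raise_r Y c W k = (k \<otimes>\<^sub>m ident C Y) \<cdot> (ident C W \<otimes>\<^sub>m c)"

context
  fixes U Y c e
  assumes dp: "dual_pair U Y c e"
begin

abbreviation (input) "Tc \<equiv> Tag \<one>\<^sub>o c (U \<otimes>\<^sub>o Y)"
abbreviation (input) "Te \<equiv> Tag (Y \<otimes>\<^sub>o U) e \<one>\<^sub>o"

lemmas dual_pair_simps [simp] = dual_pairD(1-4)[OF dp]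

lemma arr_lower_l: "\<lbrakk>arr g W (U \<otimes>\<^sub>o A); A \<in> Ob C\<rbrakk> \<Longrightarrow> arr (lower_l Y e A g) (Y \<otimes>\<^sub>o W) A"
  by (rule arr_underI[of "(Te \<boxtimes> \<iota> A) \<bullet> (\<iota> Y \<boxtimes> Tag W g (U \<otimes>\<^sub>o A))"]) (auto simp: lower_l_def dest: arrD)

lemma arr_raise_l: "\<lbrakk>arr h (Y \<otimes>\<^sub>o W) A; W \<in> Ob C\<rbrakk> \<Longrightarrow> arr (raise_l U c W h) W (U \<otimes>\<^sub>o A)"
  by (rule arr_underI[of "(\<iota> U \<boxtimes> Tag (Y \<otimes>\<^sub>o W) h A) \<bullet> (Tc \<boxtimes> \<iota> W)"]) (auto simp: raise_l_def dest: arrD)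

lemma arr_lower_r: "\<lbrakk>arr g W (A \<otimes>\<^sub>o Y); A \<in> Ob C\<rbrakk> \<Longrightarrow> arr (lower_r U e A g) (W \<otimes>\<^sub>o U) A"
  by (rule arr_underI[of "(\<iota> A \<boxtimes> Te) \<bullet> (Tag W g (A \<otimes>\<^sub>o Y) \<boxtimes> \<iota> U)"]) (auto simp: lower_r_def dest: arrD)

lemma arr_raise_r: "\<lbrakk>arr k (W \<otimes>\<^sub>o U) A; W \<in> Ob C\<rbrakk> \<Longrightarrow> arr (raise_r Y c W k) W (A \<otimes>\<^sub>o Y)"
  by (rule arr_underI[of "(Tag (W \<otimes>\<^sub>o U) k A \<boxtimes> \<iota> Y) \<bullet> (\<iota> W \<boxtimes> Tc)"]) (auto simp: raise_r_def dest: arrD)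

lemma raise_lower_l:
  assumes g: "arr g W (U \<otimes>\<^sub>o A)" and A: "A \<in> Ob C"
  shows "raise_l U c W (lower_l Y e A g) = g"
proof -
  have [simp]: "W \<in> Ob C" "A \<in> Ob C" using g A arrD by auto
  define G where "G = Tag W g (U \<otimes>\<^sub>o A)"
  have [simp]: "ok G" "src G = W" "tgt G = U \<otimes>\<^sub>o A" using g by (simp_all add: G_def)
  have "(\<iota> U \<boxtimes> ((Te \<boxtimes> \<iota> A) \<bullet> (\<iota> Y \<boxtimes> G))) \<bullet> (Tc \<boxtimes> \<iota> W)
    = (\<iota> U \<boxtimes> Te \<boxtimes> \<iota> A) \<bullet> ((\<iota> U \<boxtimes> \<iota> Y) \<boxtimes> G) \<bullet> (Tc \<boxtimes> \<iota> W)"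
    by (simp add: whisker_l tcmp_assoc ttensor_assoc)
  also have "((\<iota> U \<boxtimes> \<iota> Y) \<boxtimes> G) \<bullet> (Tc \<boxtimes> \<iota> W) = (Tc \<boxtimes> \<iota> (U \<otimes>\<^sub>o A)) \<bullet> G"
    using slide[of Tc G] by (simp add: ttensor_id)
  also have "(\<iota> U \<boxtimes> Te \<boxtimes> \<iota> A) \<bullet> (Tc \<boxtimes> \<iota> (U \<otimes>\<^sub>o A)) \<bullet> G
    = (((\<iota> U \<boxtimes> Te) \<boxtimes> \<iota> A) \<bullet> ((Tc \<boxtimes> \<iota> U) \<boxtimes> \<iota> A)) \<bullet> G"
    by (simp add: tcmp_assoc ttensor_assoc ttensor_id[symmetric])
  also have "\<dots> = G"
    by (subst interchange) (simp_all add: dual_pairD(5)[OF dp] ttensor_id)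
  finally show ?thesis
    by (simp add: raise_l_def lower_l_def G_def tcmp_def ttensor_def tid_def)
qed

lemma lower_raise_l:
  assumes h: "arr h (Y \<otimes>\<^sub>o W) A" and W: "W \<in> Ob C"
  shows "lower_l Y e A (raise_l U c W h) = h"
proof -
  have [simp]: "W \<in> Ob C" "A \<in> Ob C" using h W arrD by auto
  define H where "H = Tag (Y \<otimes>\<^sub>o W) h A"
  have [simp]: "ok H" "src H = Y \<otimes>\<^sub>o W" "tgt H = A" using h by (simp_all add: H_def)
  have "(Te \<boxtimes> \<iota> A) \<bullet> (\<iota> Y \<boxtimes> ((\<iota> U \<boxtimes> H) \<bullet> (Tc \<boxtimes> \<iota> W)))
    = ((Te \<boxtimes> \<iota> A) \<bullet> ((\<iota> Y \<boxtimes> \<iota> U) \<boxtimes> H)) \<bullet> (\<iota> Y \<boxtimes> Tc \<boxtimes> \<iota> W)"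
    by (simp add: whisker_l tcmp_assoc ttensor_assoc)
  also have "(Te \<boxtimes> \<iota> A) \<bullet> ((\<iota> Y \<boxtimes> \<iota> U) \<boxtimes> H) = H \<bullet> (Te \<boxtimes> \<iota> (Y \<otimes>\<^sub>o W))"
    using slide[of Te H] by (simp add: ttensor_id)
  also have "(H \<bullet> (Te \<boxtimes> \<iota> (Y \<otimes>\<^sub>o W))) \<bullet> (\<iota> Y \<boxtimes> Tc \<boxtimes> \<iota> W)
    = H \<bullet> (((Te \<boxtimes> \<iota> Y) \<boxtimes> \<iota> W) \<bullet> ((\<iota> Y \<boxtimes> Tc) \<boxtimes> \<iota> W))"
    by (simp add: tcmp_assoc ttensor_assoc ttensor_id[symmetric])
  also have "\<dots> = H"
    by (subst interchange) (simp_all add: dual_pairD(6)[OF dp] ttensor_id)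
  finally show ?thesis
    by (simp add: raise_l_def lower_l_def H_def tcmp_def ttensor_def tid_def)
qed

lemma raise_lower_r:
  assumes g: "arr g W (A \<otimes>\<^sub>o Y)" and A: "A \<in> Ob C"
  shows "raise_r Y c W (lower_r U e A g) = g"
proof -
  have [simp]: "W \<in> Ob C" "A \<in> Ob C" using g A arrD by auto
  define G where "G = Tag W g (A \<otimes>\<^sub>o Y)"
  have [simp]: "ok G" "src G = W" "tgt G = A \<otimes>\<^sub>o Y" using g by (simp_all add: G_def)
  have "(((\<iota> A \<boxtimes> Te) \<bullet> (G \<boxtimes> \<iota> U)) \<boxtimes> \<iota> Y) \<bullet> (\<iota> W \<boxtimes> Tc)
    = (\<iota> A \<boxtimes> Te \<boxtimes> \<iota> Y) \<bullet> (G \<boxtimes> (\<iota> U \<boxtimes> \<iota> Y)) \<bullet> (\<iota> W \<boxtimes> Tc)"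
    by (simp add: whisker_r tcmp_assoc ttensor_assoc)
  also have "(G \<boxtimes> (\<iota> U \<boxtimes> \<iota> Y)) \<bullet> (\<iota> W \<boxtimes> Tc) = (\<iota> (A \<otimes>\<^sub>o Y) \<boxtimes> Tc) \<bullet> G"
    using slide[of G Tc] by (simp add: ttensor_id)
  also have "(\<iota> A \<boxtimes> Te \<boxtimes> \<iota> Y) \<bullet> (\<iota> (A \<otimes>\<^sub>o Y) \<boxtimes> Tc) \<bullet> G
    = ((\<iota> A \<boxtimes> (Te \<boxtimes> \<iota> Y)) \<bullet> (\<iota> A \<boxtimes> (\<iota> Y \<boxtimes> Tc))) \<bullet> G"
    by (simp add: tcmp_assoc ttensor_assoc ttensor_id[symmetric])
  also have "\<dots> = G"
    by (subst interchange) (simp_all add: dual_pairD(6)[OF dp] ttensor_id)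
  finally show ?thesis
    by (simp add: raise_r_def lower_r_def G_def tcmp_def ttensor_def tid_def)
qed

lemma lower_raise_r:
  assumes k: "arr k (W \<otimes>\<^sub>o U) A" and W: "W \<in> Ob C"
  shows "lower_r U e A (raise_r Y c W k) = k"
proof -
  have [simp]: "W \<in> Ob C" "A \<in> Ob C" using k W arrD by auto
  define K where "K = Tag (W \<otimes>\<^sub>o U) k A"
  have [simp]: "ok K" "src K = W \<otimes>\<^sub>o U" "tgt K = A" using k by (simp_all add: K_def)
  have "(\<iota> A \<boxtimes> Te) \<bullet> (((K \<boxtimes> \<iota> Y) \<bullet> (\<iota> W \<boxtimes> Tc)) \<boxtimes> \<iota> U)
    = ((\<iota> A \<boxtimes> Te) \<bullet> (K \<boxtimes> (\<iota> Y \<boxtimes> \<iota> U))) \<bullet> (\<iota> W \<boxtimes> Tc \<boxtimes> \<iota> U)"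
    by (simp add: whisker_r tcmp_assoc ttensor_assoc)
  also have "(\<iota> A \<boxtimes> Te) \<bullet> (K \<boxtimes> (\<iota> Y \<boxtimes> \<iota> U)) = K \<bullet> (\<iota> (W \<otimes>\<^sub>o U) \<boxtimes> Te)"
    using slide[of K Te] by (simp add: ttensor_id)
  also have "(K \<bullet> (\<iota> (W \<otimes>\<^sub>o U) \<boxtimes> Te)) \<bullet> (\<iota> W \<boxtimes> Tc \<boxtimes> \<iota> U)
    = K \<bullet> ((\<iota> W \<boxtimes> (\<iota> U \<boxtimes> Te)) \<bullet> (\<iota> W \<boxtimes> (Tc \<boxtimes> \<iota> U)))"
    by (simp add: tcmp_assoc ttensor_assoc ttensor_id[symmetric])
  also have "\<dots> = K"
    by (subst interchange) (simp_all add: dual_pairD(5)[OF dp] ttensor_id)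
  finally show ?thesis
    by (simp add: raise_r_def lower_r_def K_def tcmp_def ttensor_def tid_def)
qed

lemma lower_l_natural:
  assumes g: "arr g W (U \<otimes>\<^sub>o A)" and m: "arr m A B"
  shows "lower_l Y e B ((ident C U \<otimes>\<^sub>m m) \<cdot> g) = m \<cdot> lower_l Y e A g"
proof -
  have [simp]: "W \<in> Ob C" "A \<in> Ob C" "B \<in> Ob C" using g m arrD by auto
  define G where "G = Tag W g (U \<otimes>\<^sub>o A)"
  define N where "N = Tag A m B"
  have [simp]: "ok G" "src G = W" "tgt G = U \<otimes>\<^sub>o A" "ok N" "src N = A" "tgt N = B"
    using g m by (simp_all add: G_def N_def)
  have "(Te \<boxtimes> \<iota> B) \<bullet> (\<iota> Y \<boxtimes> ((\<iota> U \<boxtimes> N) \<bullet> G)) = ((Te \<boxtimes> \<iota> B) \<bullet> (\<iota> (Y \<otimes>\<^sub>o U) \<boxtimes> N)) \<bullet> (\<iota> Y \<boxtimes> G)"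
    by (simp add: whisker_l tcmp_assoc ttensor_assoc ttensor_id[symmetric])
  also have "(Te \<boxtimes> \<iota> B) \<bullet> (\<iota> (Y \<otimes>\<^sub>o U) \<boxtimes> N) = N \<bullet> (Te \<boxtimes> \<iota> A)"
    using slide[of Te N] by simp
  finally show ?thesis
    by (simp add: lower_l_def tcmp_assoc) (simp add: G_def N_def tcmp_def ttensor_def tid_def)
qed

lemma raise_l_natural:
  assumes h: "arr h (Y \<otimes>\<^sub>o W) A" and f: "arr f V W"
  shows "raise_l U c V (h \<cdot> (ident C Y \<otimes>\<^sub>m f)) = raise_l U c W h \<cdot> f"
proof -
  have [simp]: "W \<in> Ob C" "A \<in> Ob C" "V \<in> Ob C" using h f arrD by auto
  define H where "H = Tag (Y \<otimes>\<^sub>o W) h A"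
  define N where "N = Tag V f W"
  have [simp]: "ok H" "src H = Y \<otimes>\<^sub>o W" "tgt H = A" "ok N" "src N = V" "tgt N = W"
    using h f by (simp_all add: H_def N_def)
  have "(\<iota> U \<boxtimes> (H \<bullet> (\<iota> Y \<boxtimes> N))) \<bullet> (Tc \<boxtimes> \<iota> V) = (\<iota> U \<boxtimes> H) \<bullet> (\<iota> (U \<otimes>\<^sub>o Y) \<boxtimes> N) \<bullet> (Tc \<boxtimes> \<iota> V)"
    by (simp add: whisker_l tcmp_assoc ttensor_assoc ttensor_id[symmetric])
  also have "(\<iota> (U \<otimes>\<^sub>o Y) \<boxtimes> N) \<bullet> (Tc \<boxtimes> \<iota> V) = (Tc \<boxtimes> \<iota> W) \<bullet> N"
    using slide[of Tc N] by simp
  also have "(\<iota> U \<boxtimes> H) \<bullet> (Tc \<boxtimes> \<iota> W) \<bullet> N = ((\<iota> U \<boxtimes> H) \<bullet> (Tc \<boxtimes> \<iota> W)) \<bullet> N"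
    by (simp add: tcmp_assoc)
  finally show ?thesis
    by (simp add: raise_l_def H_def N_def tcmp_def ttensor_def tid_def)
qed

lemma lower_r_natural:
  assumes g: "arr g W (A \<otimes>\<^sub>o Y)" and m: "arr m A B"
  shows "lower_r U e B ((m \<otimes>\<^sub>m ident C Y) \<cdot> g) = m \<cdot> lower_r U e A g"
proof -
  have [simp]: "W \<in> Ob C" "A \<in> Ob C" "B \<in> Ob C" using g m arrD by auto
  define G where "G = Tag W g (A \<otimes>\<^sub>o Y)"
  define N where "N = Tag A m B"
  have [simp]: "ok G" "src G = W" "tgt G = A \<otimes>\<^sub>o Y" "ok N" "src N = A" "tgt N = B"
    using g m by (simp_all add: G_def N_def)
  have "(\<iota> B \<boxtimes> Te) \<bullet> (((N \<boxtimes> \<iota> Y) \<bullet> G) \<boxtimes> \<iota> U) = ((\<iota> B \<boxtimes> Te) \<bullet> (N \<boxtimes> \<iota> (Y \<otimes>\<^sub>o U))) \<bullet> (G \<boxtimes> \<iota> U)"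
    by (simp add: whisker_r tcmp_assoc ttensor_assoc ttensor_id[symmetric])
  also have "(\<iota> B \<boxtimes> Te) \<bullet> (N \<boxtimes> \<iota> (Y \<otimes>\<^sub>o U)) = N \<bullet> (\<iota> A \<boxtimes> Te)"
    using slide[of N Te] by simp
  finally show ?thesis
    by (simp add: lower_r_def tcmp_assoc) (simp add: G_def N_def tcmp_def ttensor_def tid_def)
qed

lemma raise_r_natural:
  assumes k: "arr k (W \<otimes>\<^sub>o U) A" and f: "arr f V W"
  shows "raise_r Y c V (k \<cdot> (f \<otimes>\<^sub>m ident C U)) = raise_r Y c W k \<cdot> f"
proof -
  have [simp]: "W \<in> Ob C" "A \<in> Ob C" "V \<in> Ob C" using k f arrD by auto
  define K where "K = Tag (W \<otimes>\<^sub>o U) k A"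
  define N where "N = Tag V f W"
  have [simp]: "ok K" "src K = W \<otimes>\<^sub>o U" "tgt K = A" "ok N" "src N = V" "tgt N = W"
    using k f by (simp_all add: K_def N_def)
  have "((K \<bullet> (N \<boxtimes> \<iota> U)) \<boxtimes> \<iota> Y) \<bullet> (\<iota> V \<boxtimes> Tc) = (K \<boxtimes> \<iota> Y) \<bullet> (N \<boxtimes> \<iota> (U \<otimes>\<^sub>o Y)) \<bullet> (\<iota> V \<boxtimes> Tc)"
    by (simp add: whisker_r tcmp_assoc ttensor_assoc ttensor_id[symmetric])
  also have "(N \<boxtimes> \<iota> (U \<otimes>\<^sub>o Y)) \<bullet> (\<iota> V \<boxtimes> Tc) = (\<iota> W \<boxtimes> Tc) \<bullet> N"
    using slide[of N Tc] by simp
  also have "(K \<boxtimes> \<iota> Y) \<bullet> (\<iota> W \<boxtimes> Tc) \<bullet> N = ((K \<boxtimes> \<iota> Y) \<bullet> (\<iota> W \<boxtimes> Tc)) \<bullet> N"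
    by (simp add: tcmp_assoc)
  finally show ?thesis
    by (simp add: raise_r_def K_def N_def tcmp_def ttensor_def tid_def)
qed

lemma raise_r_post:
  assumes k: "arr k (W \<otimes>\<^sub>o U) A" and W: "W \<in> Ob C" and a: "arr a A B"
  shows "raise_r Y c W (a \<cdot> k) = (a \<otimes>\<^sub>m ident C Y) \<cdot> raise_r Y c W k"
proof -
  have [simp]: "W \<in> Ob C" "A \<in> Ob C" "B \<in> Ob C" using k W a arrD by auto
  define K where "K = Tag (W \<otimes>\<^sub>o U) k A"
  define N where "N = Tag A a B"
  have [simp]: "ok K" "src K = W \<otimes>\<^sub>o U" "tgt K = A" "ok N" "src N = A" "tgt N = B"
    using k a by (simp_all add: K_def N_def)
  have "((N \<bullet> K) \<boxtimes> \<iota> Y) \<bullet> (\<iota> W \<boxtimes> Tc) = (N \<boxtimes> \<iota> Y) \<bullet> (K \<boxtimes> \<iota> Y) \<bullet> (\<iota> W \<boxtimes> Tc)"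
    by (simp add: whisker_r tcmp_assoc)
  then show ?thesis
    by (simp add: raise_r_def tcmp_assoc) (simp add: K_def N_def tcmp_def ttensor_def tid_def)
qed

end

end

section \<open>Projective objects of a pivotal category\<close>

locale finite_pivotal_category = pivotal_tensor_category C + finite_abelian_category C
  for C :: "('o, 'm, 'k::alg_closed_field, 'z) piv_cat_scheme" (structure)
begin

lemma dual_pair_left: "V \<in> Ob C \<Longrightarrow> dual_pair V (dual C V) (coev C V) (ev C V)"
  unfolding dual_pair_def
  by (simp add: arr_def dual_closed coev_closed ev_closed zigzag_1 zigzag_2)

lemma dual_pair_right: "V \<in> Ob C \<Longrightarrow> dual_pair (dual C V) V (coev_tilde C V) (ev_tilde C V)"
  unfolding dual_pair_def
  by (simp add: arr_def dual_closed coev_tilde_closed ev_tilde_closed zigzag_tilde_1 zigzag_tilde_2)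

lemma mono_cancelI: "\<lbrakk>arr m A Y; \<And>W f g. \<lbrakk>arr f W A; arr g W A; m \<cdot> f = m \<cdot> g\<rbrakk> \<Longrightarrow> f = g\<rbrakk> \<Longrightarrow>
  monomorphism C A Y m"
  unfolding monomorphism_def arr_def by blast

lemma epi_cancelI: "\<lbrakk>arr e A Y; \<And>Z f g. \<lbrakk>arr f Y Z; arr g Y Z; f \<cdot> e = g \<cdot> e\<rbrakk> \<Longrightarrow> f = g\<rbrakk> \<Longrightarrow>
  epimorphism C A Y e"
  unfolding epimorphism_def arr_def by blast

lemma projectiveI: "\<lbrakk>P \<in> Ob C; \<And>A Y e f. \<lbrakk>epimorphism C A Y e; arr f P Y\<rbrakk> \<Longrightarrow> \<exists>g. arr g P A \<and> e \<cdot> g = f\<rbrakk> \<Longrightarrow>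
  projective C P"
  unfolding projective_def arr_def epimorphism_def by blast

lemma injectiveI: "\<lbrakk>I \<in> Ob C; \<And>A Y m f. \<lbrakk>monomorphism C A Y m; arr f A I\<rbrakk> \<Longrightarrow> \<exists>g. arr g Y I \<and> g \<cdot> m = f\<rbrakk> \<Longrightarrow>
  injective I"
  unfolding injective_def arr_def monomorphism_def by blast

text \<open>
  \<open>- \<otimes> V\<close> is a right adjoint, hence preserves monomorphisms; \<open>V \<otimes> -\<close> and \<open>- \<otimes> V\<close> are left
  adjoints, hence preserve epimorphisms.
\<close>

lemma tensor_mono_r:
  assumes V: "V \<in> Ob C" and m: "monomorphism C A B m"
  shows "monomorphism C (A \<otimes>\<^sub>o V) (B \<otimes>\<^sub>o V) (m \<otimes>\<^sub>m ident C V)"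
proof (rule mono_cancelI)
  note dp = dual_pair_right[OF V] and m' = mono_arr[OF m]
  show "arr (m \<otimes>\<^sub>m ident C V) (A \<otimes>\<^sub>o V) (B \<otimes>\<^sub>o V)" by (rule arr_tensor[OF m' arr_id[OF V]])
  fix W f g assume f: "arr f W (A \<otimes>\<^sub>o V)" and g: "arr g W (A \<otimes>\<^sub>o V)"
    and eq: "(m \<otimes>\<^sub>m ident C V) \<cdot> f = (m \<otimes>\<^sub>m ident C V) \<cdot> g"
  have A: "A \<in> Ob C" using m' by (rule arrD)
  have "m \<cdot> lower_r (dual C V) (ev_tilde C V) A f = m \<cdot> lower_r (dual C V) (ev_tilde C V) A g"
    using lower_r_natural[OF dp f m'] lower_r_natural[OF dp g m'] eq by simp
  then have "lower_r (dual C V) (ev_tilde C V) A f = lower_r (dual C V) (ev_tilde C V) A g"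
    by (rule mono_cancel[OF m arr_lower_r[OF dp f A] arr_lower_r[OF dp g A]])
  then show "f = g" by (metis raise_lower_r[OF dp f A] raise_lower_r[OF dp g A])
qed

lemma tensor_epi_l:
  assumes V: "V \<in> Ob C" and e: "epimorphism C A B e"
  shows "epimorphism C (V \<otimes>\<^sub>o A) (V \<otimes>\<^sub>o B) (ident C V \<otimes>\<^sub>m e)"
proof (rule epi_cancelI)
  note dp = dual_pair_right[OF V] and e' = epi_arr[OF e]
  show "arr (ident C V \<otimes>\<^sub>m e) (V \<otimes>\<^sub>o A) (V \<otimes>\<^sub>o B)" by (rule arr_tensor[OF arr_id[OF V] e'])
  fix Z f g assume f: "arr f (V \<otimes>\<^sub>o B) Z" and g: "arr g (V \<otimes>\<^sub>o B) Z"
    and eq: "f \<cdot> (ident C V \<otimes>\<^sub>m e) = g \<cdot> (ident C V \<otimes>\<^sub>m e)"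
  have B: "B \<in> Ob C" using e' by (rule arrD)
  have "raise_l (dual C V) (coev_tilde C V) B f \<cdot> e = raise_l (dual C V) (coev_tilde C V) B g \<cdot> e"
    using raise_l_natural[OF dp f e'] raise_l_natural[OF dp g e'] eq by simp
  then have "raise_l (dual C V) (coev_tilde C V) B f = raise_l (dual C V) (coev_tilde C V) B g"
    by (rule epi_cancel[OF e arr_raise_l[OF dp f B] arr_raise_l[OF dp g B]])
  then show "f = g" by (metis lower_raise_l[OF dp f B] lower_raise_l[OF dp g B])
qed

lemma tensor_epi_r:
  assumes V: "V \<in> Ob C" and e: "epimorphism C A B e"
  shows "epimorphism C (A \<otimes>\<^sub>o V) (B \<otimes>\<^sub>o V) (e \<otimes>\<^sub>m ident C V)"
proof (rule epi_cancelI)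
  note dp = dual_pair_left[OF V] and e' = epi_arr[OF e]
  show "arr (e \<otimes>\<^sub>m ident C V) (A \<otimes>\<^sub>o V) (B \<otimes>\<^sub>o V)" by (rule arr_tensor[OF e' arr_id[OF V]])
  fix Z f g assume f: "arr f (B \<otimes>\<^sub>o V) Z" and g: "arr g (B \<otimes>\<^sub>o V) Z"
    and eq: "f \<cdot> (e \<otimes>\<^sub>m ident C V) = g \<cdot> (e \<otimes>\<^sub>m ident C V)"
  have B: "B \<in> Ob C" using e' by (rule arrD)
  have "raise_r (dual C V) (coev C V) B f \<cdot> e = raise_r (dual C V) (coev C V) B g \<cdot> e"
    using raise_r_natural[OF dp f e'] raise_r_natural[OF dp g e'] eq by simp
  then have "raise_r (dual C V) (coev C V) B f = raise_r (dual C V) (coev C V) B g"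
    by (rule epi_cancel[OF e arr_raise_r[OF dp f B] arr_raise_r[OF dp g B]])
  then show "f = g" by (metis lower_raise_r[OF dp f B] lower_raise_r[OF dp g B])
qed

lemma tensor_zero_l:
  assumes ob: "A \<in> Ob C" "B \<in> Ob C" "V \<in> Ob C"
  shows "\<zero>\<^bsub>Hom C A B\<^esub> \<otimes>\<^sub>m ident C V = \<zero>\<^bsub>Hom C (A \<otimes>\<^sub>o V) (B \<otimes>\<^sub>o V)\<^esub>"
  using linear_map_zero[OF Hom_module[of A B] Hom_module[of "A \<otimes>\<^sub>o V" "B \<otimes>\<^sub>o V"]
      tensor_linear_left[of A B V V "ident C V"]] ob
  by (simp add: id_closed)

lemma projective_Ob: "projective C P \<Longrightarrow> P \<in> Ob C"
  by (simp add: projective_def)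

text \<open>
  \<open>V \<otimes> -\<close> and \<open>- \<otimes> V\<close> have right adjoints that preserve epimorphisms, so they preserve projectives:
  transpose, lift, and transpose back.
\<close>

lemma projective_tensor_l:
  assumes Q: "projective C Q" and V: "V \<in> Ob C"
  shows "projective C (V \<otimes>\<^sub>o Q)"
proof (rule projectiveI)
  note Qo = projective_Ob[OF Q] and dp = dual_pair_right[OF V]
  show "V \<otimes>\<^sub>o Q \<in> Ob C" using V Qo by simp
  fix A B e f assume e: "epimorphism C A B e" and f: "arr f (V \<otimes>\<^sub>o Q) B"
  note e' = epi_arr[OF e]
  have A: "A \<in> Ob C" using e' by (rule arrD)
  obtain g where g: "arr g Q (dual C V \<otimes>\<^sub>o A)"
    "(ident C (dual C V) \<otimes>\<^sub>m e) \<cdot> g = raise_l (dual C V) (coev_tilde C V) Q f"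
    using projective_lift[OF Q tensor_epi_l[OF dual_closed[OF V] e] arr_raise_l[OF dp f Qo]] by blast
  have "e \<cdot> lower_l V (ev_tilde C V) A g = f"
    using lower_l_natural[OF dp g(1) e'] g(2) lower_raise_l[OF dp f Qo] by simp
  then show "\<exists>g. arr g (V \<otimes>\<^sub>o Q) A \<and> e \<cdot> g = f" using arr_lower_l[OF dp g(1) A] by blast
qed

lemma projective_tensor_r:
  assumes Q: "projective C Q" and V: "V \<in> Ob C"
  shows "projective C (Q \<otimes>\<^sub>o V)"
proof (rule projectiveI)
  note Qo = projective_Ob[OF Q] and dp = dual_pair_left[OF V]
  show "Q \<otimes>\<^sub>o V \<in> Ob C" using V Qo by simp
  fix A B e f assume e: "epimorphism C A B e" and f: "arr f (Q \<otimes>\<^sub>o V) B"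
  note e' = epi_arr[OF e]
  have A: "A \<in> Ob C" using e' by (rule arrD)
  obtain g where g: "arr g Q (A \<otimes>\<^sub>o dual C V)"
    "(e \<otimes>\<^sub>m ident C (dual C V)) \<cdot> g = raise_r (dual C V) (coev C V) Q f"
    using projective_lift[OF Q tensor_epi_r[OF dual_closed[OF V] e] arr_raise_r[OF dp f Qo]] by blast
  have "e \<cdot> lower_r V (ev C V) A g = f"
    using lower_r_natural[OF dp g(1) e'] g(2) lower_raise_r[OF dp f Qo] by simp
  then show "\<exists>g. arr g (Q \<otimes>\<^sub>o V) A \<and> e \<cdot> g = f" using arr_lower_r[OF dp g(1) A] by blast
qed

text \<open>
  Maps \<open>Q\<^sup>* \<rightarrow> B\<close> are maps \<open>1 \<rightarrow> Q \<otimes> B\<close>, and \<open>Q \<otimes> e\<close> splits for every epimorphism \<open>e\<close> because its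
  target is projective.
\<close>

lemma projective_dual:
  assumes Q: "projective C Q"
  shows "projective C (dual C Q)"
proof (rule projectiveI)
  note Qo = projective_Ob[OF Q]
  note dp = dual_pair_left[OF Qo] and Qd = dual_closed[OF Qo]
  show "dual C Q \<in> Ob C" by (rule Qd)
  fix A B e f assume e: "epimorphism C A B e" and f: "arr f (dual C Q) B"
  note e' = epi_arr[OF e]
  have A: "A \<in> Ob C" and B: "B \<in> Ob C" using e' by (auto dest: arrD)
  have f1: "arr f (dual C Q \<otimes>\<^sub>o \<one>\<^sub>o) B" using f Qd by simp
  note fr = arr_raise_l[OF dp f1 unit_closed]
  note Qe = tensor_epi_l[OF Qo e]
  have QB: "Q \<otimes>\<^sub>o B \<in> Ob C" using Qo B by simp
  obtain s where s: "arr s (Q \<otimes>\<^sub>o B) (Q \<otimes>\<^sub>o A)" "(ident C Q \<otimes>\<^sub>m e) \<cdot> s = ident C (Q \<otimes>\<^sub>o B)"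
    using projective_lift[OF projective_tensor_r[OF Q B] Qe arr_id[OF QB]] by blast
  define g where "g = s \<cdot> raise_l Q (coev C Q) \<one>\<^sub>o f"
  have g: "arr g \<one>\<^sub>o (Q \<otimes>\<^sub>o A)" unfolding g_def by (rule arr_cmp[OF s(1) fr])
  have "(ident C Q \<otimes>\<^sub>m e) \<cdot> g = raise_l Q (coev C Q) \<one>\<^sub>o f"
    unfolding g_def using assoc[OF epi_arr[OF Qe] s(1) fr] s(2) id_l[OF fr] by simp
  then have "e \<cdot> lower_l (dual C Q) (ev C Q) A g = f"
    using lower_l_natural[OF dp g e'] lower_raise_l[OF dp f1 unit_closed] by simp
  then show "\<exists>g. arr g (dual C Q) A \<and> e \<cdot> g = f" using arr_lower_l[OF dp g A] Qd by auto
qed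

text \<open>
  Two descriptions of the dual of \<open>m\<close>: as a transpose of \<open>ev (B\<^sup>* \<otimes> m)\<close>, where precomposition is easy
  to follow, and as a transpose of \<open>(m \<otimes> A\<^sup>*) coev\<close>, where postcomposition is.
\<close>

lemma dual_mor_formulas:
  assumes m: "arr m A B" and A: "A \<in> Ob C" and B: "B \<in> Ob C"
  shows "raise_r (dual C A) (coev C A) (dual C B) (ev C B \<cdot> (ident C (dual C B) \<otimes>\<^sub>m m))
    = lower_l (dual C B) (ev C B) (dual C A) ((m \<otimes>\<^sub>m ident C (dual C A)) \<cdot> coev C A)"
proof -
  note dA = dual_pairD[OF dual_pair_left[OF A]] and dB = dual_pairD[OF dual_pair_left[OF B]]
  note [simp] = dA(1-4) dB(1-4)
  define N where "N = Tag A m B"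
  define c where "c = Tag \<one>\<^sub>o (coev C A) (A \<otimes>\<^sub>o dual C A)"
  define e where "e = Tag (dual C B \<otimes>\<^sub>o B) (ev C B) \<one>\<^sub>o"
  have [simp]: "ok N" "src N = A" "tgt N = B" "ok c" "src c = \<one>\<^sub>o" "tgt c = A \<otimes>\<^sub>o dual C A"
    "ok e" "src e = dual C B \<otimes>\<^sub>o B" "tgt e = \<one>\<^sub>o"
    using m by (simp_all add: N_def c_def e_def)
  have "((e \<bullet> (\<iota> (dual C B) \<boxtimes> N)) \<boxtimes> \<iota> (dual C A)) \<bullet> (\<iota> (dual C B) \<boxtimes> c)
    = (e \<boxtimes> \<iota> (dual C A)) \<bullet> (\<iota> (dual C B) \<boxtimes> ((N \<boxtimes> \<iota> (dual C A)) \<bullet> c))"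
    by (simp add: whisker_l whisker_r tcmp_assoc ttensor_assoc)
  then show ?thesis
    by (simp add: raise_r_def lower_l_def N_def c_def e_def tcmp_def ttensor_def tid_def)
qed

lemma raise_l_post:
  assumes dp: "dual_pair U Y c e" and h: "arr h (Y \<otimes>\<^sub>o W) A" and W: "W \<in> Ob C" and a: "arr a A B"
  shows "raise_l U c W (a \<cdot> h) = (ident C U \<otimes>\<^sub>m a) \<cdot> raise_l U c W h"
proof -
  note [simp] = dual_pairD(1-4)[OF dp]
  have [simp]: "W \<in> Ob C" "A \<in> Ob C" "B \<in> Ob C" using h W a arrD by auto
  define H where "H = Tag (Y \<otimes>\<^sub>o W) h A"
  define N where "N = Tag A a B"
  define T where "T = Tag \<one>\<^sub>o c (U \<otimes>\<^sub>o Y)"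
  have [simp]: "ok H" "src H = Y \<otimes>\<^sub>o W" "tgt H = A" "ok N" "src N = A" "tgt N = B"
    "ok T" "src T = \<one>\<^sub>o" "tgt T = U \<otimes>\<^sub>o Y"
    using h a by (simp_all add: H_def N_def T_def)
  have "(\<iota> U \<boxtimes> (N \<bullet> H)) \<bullet> (T \<boxtimes> \<iota> W) = (\<iota> U \<boxtimes> N) \<bullet> (\<iota> U \<boxtimes> H) \<bullet> (T \<boxtimes> \<iota> W)"
    by (simp add: whisker_l tcmp_assoc)
  then show ?thesis
    by (simp add: raise_l_def H_def N_def T_def tcmp_def ttensor_def tid_def)
qed

text \<open>
  Under the adjunctions, \<open>u\<close> after the dual of \<open>m\<close> corresponds to \<open>m \<otimes> Z\<close> after the transpose of
  \<open>u\<close>, and \<open>m \<otimes> Z\<close> is a monomorphism.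
\<close>

lemma dual_of_mono_epi:
  assumes m: "monomorphism C A B m"
  shows "epimorphism C (dual C B) (dual C A)
    (lower_l (dual C B) (ev C B) (dual C A) ((m \<otimes>\<^sub>m ident C (dual C A)) \<cdot> coev C A))"
    (is "epimorphism C _ _ ?m'")
proof (rule epi_cancelI)
  note m1 = mono_arr[OF m]
  have A: "A \<in> Ob C" and B: "B \<in> Ob C" using m1 by (auto dest: arrD)
  note dA = dual_pair_left[OF A] and dB = dual_pair_left[OF B]
  have dAo: "dual C A \<in> Ob C" and dBo: "dual C B \<in> Ob C" using A B dual_closed by auto
  note cA = dual_pairD(3)[OF dA]
  have w: "arr ((m \<otimes>\<^sub>m ident C (dual C A)) \<cdot> coev C A) \<one>\<^sub>o (B \<otimes>\<^sub>o dual C A)"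
    by (rule arr_cmp[OF arr_tensor[OF m1 arr_id[OF dAo]] cA])
  have m': "arr ?m' (dual C B) (dual C A)" using arr_lower_l[OF dB w dAo] dBo by simp
  then show "arr ?m' (dual C B) (dual C A)" .
  have m'1: "arr ?m' (dual C B \<otimes>\<^sub>o \<one>\<^sub>o) (dual C A)" using m' dBo by simp
  fix Z u v assume u: "arr u (dual C A) Z" and v: "arr v (dual C A) Z" and eq: "u \<cdot> ?m' = v \<cdot> ?m'"
  have Z: "Z \<in> Ob C" using u by (rule arrD)
  have key: "raise_l B (coev C B) \<one>\<^sub>o (x \<cdot> ?m') = (m \<otimes>\<^sub>m ident C Z) \<cdot> raise_l A (coev C A) \<one>\<^sub>o x"
    if x: "arr x (dual C A) Z" for x
  proof -
    have "raise_l B (coev C B) \<one>\<^sub>o (x \<cdot> ?m') = (ident C B \<otimes>\<^sub>m x) \<cdot> ((m \<otimes>\<^sub>m ident C (dual C A)) \<cdot> coev C A)"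
      using raise_l_post[OF dB m'1 unit_closed x] raise_lower_l[OF dB w dAo] by simp
    also have "\<dots> = ((ident C B \<otimes>\<^sub>m x) \<cdot> (m \<otimes>\<^sub>m ident C (dual C A))) \<cdot> coev C A"
      using assoc[OF arr_tensor[OF arr_id[OF B] x] arr_tensor[OF m1 arr_id[OF dAo]] cA] by simp
    also have "(ident C B \<otimes>\<^sub>m x) \<cdot> (m \<otimes>\<^sub>m ident C (dual C A)) = (m \<otimes>\<^sub>m ident C Z) \<cdot> (ident C A \<otimes>\<^sub>m x)"
      using slide[of "Tag A m B" "Tag (dual C A) x Z"] m1 x
      by (simp add: tcmp_def ttensor_def tid_def)
    also have "((m \<otimes>\<^sub>m ident C Z) \<cdot> (ident C A \<otimes>\<^sub>m x)) \<cdot> coev C A = (m \<otimes>\<^sub>m ident C Z) \<cdot> ((ident C A \<otimes>\<^sub>m x) \<cdot> coev C A)"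
      by (rule assoc[OF arr_tensor[OF m1 arr_id[OF Z]] arr_tensor[OF arr_id[OF A] x] cA])
    also have "(ident C A \<otimes>\<^sub>m x) \<cdot> coev C A = raise_l A (coev C A) \<one>\<^sub>o x"
      using ttensor_unit(2)[of "Tag \<one>\<^sub>o (coev C A) (A \<otimes>\<^sub>o dual C A)"] cA
      by (simp add: raise_l_def ttensor_def tid_def)
    finally show ?thesis .
  qed
  have u1: "arr u (dual C A \<otimes>\<^sub>o \<one>\<^sub>o) Z" and v1: "arr v (dual C A \<otimes>\<^sub>o \<one>\<^sub>o) Z" using u v dAo by simp_all
  have "raise_l A (coev C A) \<one>\<^sub>o u = raise_l A (coev C A) \<one>\<^sub>o v"
    using mono_cancel[OF tensor_mono_r[OF Z m] arr_raise_l[OF dA u1 unit_closed] arr_raise_l[OF dA v1 unit_closed]]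
      key[OF u] key[OF v] eq by simp
  then show "u = v" by (metis lower_raise_l[OF dA u1 unit_closed] lower_raise_l[OF dA v1 unit_closed])
qed

text \<open>
  To extend \<open>f : A \<rightarrow> Q\<close> along a monomorphism \<open>m : A \<rightarrow> B\<close>, lift \<open>f\<^sup>* : Q\<^sup>* \<rightarrow> A\<^sup>*\<close> along the
  epimorphism \<open>m\<^sup>* : B\<^sup>* \<rightarrow> A\<^sup>*\<close> and dualize back.
\<close>

lemma projective_imp_injective:
  assumes Q: "projective C Q"
  shows "injective Q"
proof (rule injectiveI)
  note Qo = projective_Ob[OF Q]
  show "Q \<in> Ob C" by (rule Qo)
  fix A B m f assume m: "monomorphism C A B m" and f: "arr f A Q"
  note m1 = mono_arr[OF m]
  have A: "A \<in> Ob C" and B: "B \<in> Ob C" using m1 by (auto dest: arrD)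
  note dA = dual_pair_left[OF A] and dB = dual_pair_left[OF B] and dQ = dual_pair_left[OF Qo]
  have dAo: "dual C A \<in> Ob C" and dBo: "dual C B \<in> Ob C" and dQo: "dual C Q \<in> Ob C"
    using A B Qo dual_closed by auto
  let ?k = "lower_l (dual C Q) (ev C Q) \<one>\<^sub>o f"
  let ?mB = "ev C B \<cdot> (ident C (dual C B) \<otimes>\<^sub>m m)"
  let ?m' = "raise_r (dual C A) (coev C A) (dual C B) ?mB"
  have f1: "arr f A (Q \<otimes>\<^sub>o \<one>\<^sub>o)" using f Qo by simp
  have k: "arr ?k (dual C Q \<otimes>\<^sub>o A) \<one>\<^sub>o" by (rule arr_lower_l[OF dQ f1 unit_closed])
  have k': "arr (raise_r (dual C A) (coev C A) (dual C Q) ?k) (dual C Q) (dual C A)"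
    using arr_raise_r[OF dA k dQo] dAo by simp
  have "epimorphism C (dual C B) (dual C A) ?m'"
    using dual_of_mono_epi[OF m] dual_mor_formulas[OF m1 A B] by simp
  then obtain h where h: "arr h (dual C Q) (dual C B)"
    and lift: "?m' \<cdot> h = raise_r (dual C A) (coev C A) (dual C Q) ?k"
    using projective_lift[OF projective_dual[OF Q] _ k'] by blast
  have mB: "arr ?mB (dual C B \<otimes>\<^sub>o A) \<one>\<^sub>o"
    by (rule arr_cmp[OF dual_pairD(4)[OF dB] arr_tensor[OF arr_id[OF dBo] m1]])
  have evB: "arr (ev C B) (dual C B \<otimes>\<^sub>o B) \<one>\<^sub>o" by (rule dual_pairD(4)[OF dB])
  define h' where "h' = ev C B \<cdot> (h \<otimes>\<^sub>m ident C B)"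
  have h': "arr h' (dual C Q \<otimes>\<^sub>o B) \<one>\<^sub>o"
    unfolding h'_def by (rule arr_cmp[OF evB arr_tensor[OF h arr_id[OF B]]])
  have "?mB \<cdot> (h \<otimes>\<^sub>m ident C A) = h' \<cdot> (ident C (dual C Q) \<otimes>\<^sub>m m)"
  proof -
    have "?mB \<cdot> (h \<otimes>\<^sub>m ident C A) = ev C B \<cdot> ((ident C (dual C B) \<otimes>\<^sub>m m) \<cdot> (h \<otimes>\<^sub>m ident C A))"
      by (rule assoc[OF evB arr_tensor[OF arr_id[OF dBo] m1] arr_tensor[OF h arr_id[OF A]]])
    also have "(ident C (dual C B) \<otimes>\<^sub>m m) \<cdot> (h \<otimes>\<^sub>m ident C A) = (h \<otimes>\<^sub>m ident C B) \<cdot> (ident C (dual C Q) \<otimes>\<^sub>m m)"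
      using slide[of "Tag (dual C Q) h (dual C B)" "Tag A m B"] m1 h
      by (simp add: tcmp_def ttensor_def tid_def)
    also have "ev C B \<cdot> \<dots> = h' \<cdot> (ident C (dual C Q) \<otimes>\<^sub>m m)"
      unfolding h'_def
      by (rule assoc[OF evB arr_tensor[OF h arr_id[OF B]] arr_tensor[OF arr_id[OF dQo] m1], symmetric])
    finally show ?thesis .
  qed
  then have "raise_r (dual C A) (coev C A) (dual C Q) (h' \<cdot> (ident C (dual C Q) \<otimes>\<^sub>m m))
      = raise_r (dual C A) (coev C A) (dual C Q) ?k"
    using raise_r_natural[OF dA mB h] lift by simp
  then have hk: "h' \<cdot> (ident C (dual C Q) \<otimes>\<^sub>m m) = ?k"
    by (metis lower_raise_r[OF dA k dQo]
      lower_raise_r[OF dA arr_cmp[OF h' arr_tensor[OF arr_id[OF dQo] m1]] dQo])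
  have "raise_l Q (coev C Q) B h' \<cdot> m = f"
    using raise_l_natural[OF dQ h' m1] hk raise_lower_l[OF dQ f1 unit_closed] by simp
  moreover have "arr (raise_l Q (coev C Q) B h') B Q" using arr_raise_l[OF dQ h' B] Qo by simp
  ultimately show "\<exists>g. arr g B Q \<and> g \<cdot> m = f" by blast
qed

lemma corresponding_tuple_exists:
  assumes P: "projective C P" and ind: "indecomposable C P"
  shows "\<exists>\<alpha> \<beta> \<eta> \<epsilon>. corresponding_tuple C P \<alpha> \<beta> \<eta> \<epsilon>"
proof -
  have fl: "finite_length_object C P" and nz: "\<not> zero_object C P"
    using loc_fin ind unfolding locally_finite_def indecomposable_def by blast+
  interpret R: local_algebra "End_ring C P" "Hom C P P" by (rule End_local[OF ind])
  obtain \<beta> \<epsilon> where \<epsilon>: "simple_object C \<beta>" "epimorphism C P \<beta> \<epsilon>"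
    using simple_quotient_exists[OF fl nz] by blast
  obtain \<alpha> \<eta> where \<eta>: "simple_object C \<alpha>" "monomorphism C \<alpha> P \<eta>"
    using simple_subobject_exists[OF fl nz] by blast
  show ?thesis unfolding corresponding_tuple_def
    using unique_simple_quotient[OF P R.unit_nilpotent_ring_axioms \<epsilon>]
      unique_simple_subobject[OF projective_imp_injective[OF P] R.unit_nilpotent_ring_axioms \<eta>] by blast
qed

section \<open>Right partial traces\<close>

lemma arr_cap: "\<lbrakk>A \<in> Ob C; W \<in> Ob C\<rbrakk> \<Longrightarrow> arr (ident C A \<otimes>\<^sub>m ev_tilde C W) (A \<otimes>\<^sub>o W \<otimes>\<^sub>o dual C W) A"
  using arr_tensor[OF arr_id dual_pairD(4)[OF dual_pair_right], of A W] by simp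

lemma arr_cup: "\<lbrakk>V \<in> Ob C; W \<in> Ob C\<rbrakk> \<Longrightarrow> arr (ident C V \<otimes>\<^sub>m coev C W) V (V \<otimes>\<^sub>o W \<otimes>\<^sub>o dual C W)"
  using arr_tensor[OF arr_id dual_pairD(3)[OF dual_pair_left], of V W] by simp

lemma right_partial_trace_eq:
  assumes g: "arr g (V \<otimes>\<^sub>o W) (A \<otimes>\<^sub>o W)" and ob: "V \<in> Ob C" "A \<in> Ob C" "W \<in> Ob C"
  shows "right_partial_trace C V A W g
    = (ident C A \<otimes>\<^sub>m ev_tilde C W) \<cdot> raise_r (dual C W) (coev C W) V g"
proof -
  note Wd = dual_closed[OF ob(3)]
  note 1 = arr_cap[OF ob(2,3)]
  have 2: "arr (g \<otimes>\<^sub>m ident C (dual C W)) (V \<otimes>\<^sub>o W \<otimes>\<^sub>o dual C W) (A \<otimes>\<^sub>o W \<otimes>\<^sub>o dual C W)"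
    using arr_tensor[OF g arr_id[OF Wd]] ob Wd by simp
  note 3 = arr_cup[OF ob(1,3)]
  show ?thesis unfolding right_partial_trace_def raise_r_def by (rule assoc[OF 1 2 3])
qed

lemma arr_right_partial_trace:
  assumes g: "arr g (V \<otimes>\<^sub>o W) (A \<otimes>\<^sub>o W)" and ob: "V \<in> Ob C" "A \<in> Ob C" "W \<in> Ob C"
  shows "arr (right_partial_trace C V A W g) V A"
proof -
  note Wd = dual_closed[OF ob(3)]
  note 1 = arr_cap[OF ob(2,3)]
  have 2: "arr (raise_r (dual C W) (coev C W) V g) V (A \<otimes>\<^sub>o W \<otimes>\<^sub>o dual C W)"
    using arr_raise_r[OF dual_pair_left[OF ob(3)] g ob(1)] ob Wd by simp
  show ?thesis unfolding right_partial_trace_eq[OF g ob] by (rule arr_cmp[OF 1 2])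
qed

lemma linear_right_partial_trace:
  assumes ob: "V \<in> Ob C" "A \<in> Ob C" "W \<in> Ob C"
  shows "linear_map (Hom C (V \<otimes>\<^sub>o W) (A \<otimes>\<^sub>o W)) (Hom C V A) (right_partial_trace C V A W)"
proof -
  note Wd = dual_closed[OF ob(3)]
  note 1 = arr_cap[OF ob(2,3)]
  note 3 = arr_cup[OF ob(1,3)]
  have a: "linear_map (Hom C (V \<otimes>\<^sub>o W) (A \<otimes>\<^sub>o W)) (Hom C (V \<otimes>\<^sub>o W \<otimes>\<^sub>o dual C W) (A \<otimes>\<^sub>o W \<otimes>\<^sub>o dual C W))
      (\<lambda>g. g \<otimes>\<^sub>m ident C (dual C W))"
    using tensor_linear_left[of "V \<otimes>\<^sub>o W" "A \<otimes>\<^sub>o W" "dual C W" "dual C W" "ident C (dual C W)"] ob Wd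
    by (simp add: id_closed)
  have b: "linear_map (Hom C (V \<otimes>\<^sub>o W \<otimes>\<^sub>o dual C W) (A \<otimes>\<^sub>o W \<otimes>\<^sub>o dual C W)) (Hom C (V \<otimes>\<^sub>o W \<otimes>\<^sub>o dual C W) A)
      (\<lambda>x. (ident C A \<otimes>\<^sub>m ev_tilde C W) \<cdot> x)"
    by (rule cmp_linear_right) (use ob Wd 1 in \<open>simp_all add: arr_def\<close>)
  have c: "linear_map (Hom C (V \<otimes>\<^sub>o W \<otimes>\<^sub>o dual C W) A) (Hom C V A) (\<lambda>x. x \<cdot> (ident C V \<otimes>\<^sub>m coev C W))"
    by (rule cmp_linear_left) (use ob Wd 3 in \<open>simp_all add: arr_def\<close>)
  show ?thesis
    using linear_map_compose[OF linear_map_compose[OF a b] c] by (simp add: right_partial_trace_def[abs_def])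
qed

text \<open>
  The trace of a composite \<open>g h\<close> is the composite of the transposes of \<open>g\<close> and \<open>h\<close>.  This turns
  questions about traces of morphisms through \<open>B\<close> into questions about maps in and out of \<open>B \<otimes> W\<^sup>*\<close>.
\<close>

lemma right_partial_trace_cmp:
  assumes h: "arr h (V \<otimes>\<^sub>o W) B" and g: "arr g B (A \<otimes>\<^sub>o W)" and ob: "V \<in> Ob C" "A \<in> Ob C" "W \<in> Ob C"
  shows "right_partial_trace C V A W (g \<cdot> h)
    = lower_r (dual C W) (ev_tilde C W) A g \<cdot> raise_r (dual C W) (coev C W) V h"
proof -
  note Wd = dual_closed[OF ob(3)]
  note 1 = arr_cap[OF ob(2,3)]
  have 2: "arr (g \<otimes>\<^sub>m ident C (dual C W)) (B \<otimes>\<^sub>o dual C W) (A \<otimes>\<^sub>o W \<otimes>\<^sub>o dual C W)"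
    using arr_tensor[OF g arr_id[OF Wd]] ob Wd by simp
  have 3: "arr (raise_r (dual C W) (coev C W) V h) V (B \<otimes>\<^sub>o dual C W)"
    by (rule arr_raise_r[OF dual_pair_left[OF ob(3)] h ob(1)])
  show ?thesis
    unfolding right_partial_trace_eq[OF arr_cmp[OF g h] ob] raise_r_post[OF dual_pair_left[OF ob(3)] h ob(1) g]
      lower_r_def
    by (rule assoc[OF 1 2 3, symmetric])
qed

lemma right_partial_trace_post:
  assumes g: "arr g (V \<otimes>\<^sub>o W) (A \<otimes>\<^sub>o W)" and u: "arr u A B" and ob: "V \<in> Ob C" "W \<in> Ob C"
  shows "right_partial_trace C V B W ((u \<otimes>\<^sub>m ident C W) \<cdot> g) = u \<cdot> right_partial_trace C V A W g"
proof -
  have A: "A \<in> Ob C" and B: "B \<in> Ob C" using u by (auto dest: arrD)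
  note uW = arr_tensor[OF u arr_id[OF ob(2)]]
  have AW: "arr (ident C (A \<otimes>\<^sub>o W)) (A \<otimes>\<^sub>o W) (A \<otimes>\<^sub>o W)" using A ob by (simp add: arr_id)
  have 1: "lower_r (dual C W) (ev_tilde C W) B (u \<otimes>\<^sub>m ident C W)
      = u \<cdot> lower_r (dual C W) (ev_tilde C W) A (ident C (A \<otimes>\<^sub>o W))"
    using lower_r_natural[OF dual_pair_right[OF ob(2)] AW u] id_r[OF uW] by simp
  have r: "arr (raise_r (dual C W) (coev C W) V g) V ((A \<otimes>\<^sub>o W) \<otimes>\<^sub>o dual C W)"
    by (rule arr_raise_r[OF dual_pair_left[OF ob(2)] g ob(1)])
  have l: "arr (lower_r (dual C W) (ev_tilde C W) A (ident C (A \<otimes>\<^sub>o W))) ((A \<otimes>\<^sub>o W) \<otimes>\<^sub>o dual C W) A"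
    by (rule arr_lower_r[OF dual_pair_right[OF ob(2)] AW A])
  have 2: "right_partial_trace C V A W g
      = lower_r (dual C W) (ev_tilde C W) A (ident C (A \<otimes>\<^sub>o W)) \<cdot> raise_r (dual C W) (coev C W) V g"
    using right_partial_trace_cmp[OF g AW ob(1) A ob(2)] id_l[OF g] by simp
  show ?thesis
    unfolding right_partial_trace_cmp[OF g uW ob(1) B ob(2)] 1 2 by (rule assoc[OF u l r])
qed

lemma right_partial_trace_pre:
  assumes g: "arr g (V \<otimes>\<^sub>o W) (A \<otimes>\<^sub>o W)" and v: "arr v B V" and ob: "A \<in> Ob C" "W \<in> Ob C"
  shows "right_partial_trace C B A W (g \<cdot> (v \<otimes>\<^sub>m ident C W)) = right_partial_trace C V A W g \<cdot> v"
proof -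
  have V: "V \<in> Ob C" and B: "B \<in> Ob C" using v by (auto dest: arrD)
  note Wd = dual_closed[OF ob(2)]
  note 1 = arr_cap[OF ob]
  have r: "arr (raise_r (dual C W) (coev C W) V g) V (A \<otimes>\<^sub>o W \<otimes>\<^sub>o dual C W)"
    using arr_raise_r[OF dual_pair_left[OF ob(2)] g V] ob Wd by simp
  have gv: "arr (g \<cdot> (v \<otimes>\<^sub>m ident C W)) (B \<otimes>\<^sub>o W) (A \<otimes>\<^sub>o W)"
    by (rule arr_cmp[OF g arr_tensor[OF v arr_id[OF ob(2)]]])
  show ?thesis
    unfolding right_partial_trace_eq[OF gv B ob] right_partial_trace_eq[OF g V ob]
      raise_r_natural[OF dual_pair_left[OF ob(2)] g v]
    by (rule assoc[OF 1 r v, symmetric])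
qed

text \<open>
  Cyclicity holds because a morphism slides around the loop as its dual.  It leaves the cup as the
  left dual and enters the cap as the right dual, so this is where the two notions must agree.
\<close>

lemma coev_slide:
  assumes f: "arr f V W"
  shows "(ident C W \<otimes>\<^sub>m left_dual_mor C V W f) \<cdot> coev C W = (f \<otimes>\<^sub>m ident C (dual C V)) \<cdot> coev C V"
    "arr (left_dual_mor C V W f) (dual C W) (dual C V)"
proof -
  have V: "V \<in> Ob C" and W: "W \<in> Ob C" using f by (auto dest: arrD)
  note dV = dual_pairD[OF dual_pair_left[OF V]] and dW = dual_pairD[OF dual_pair_left[OF W]]
  let ?w = "(f \<otimes>\<^sub>m ident C (dual C V)) \<cdot> coev C V"
  note fV = arr_tensor[OF f arr_id[OF dV(2)]]
  have w: "arr ?w \<one>\<^sub>o (W \<otimes>\<^sub>o dual C V)" by (rule arr_cmp[OF fV dV(3)])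
  have eq: "left_dual_mor C V W f = lower_l (dual C W) (ev C W) (dual C V) ?w"
  proof -
    have [simp]: "V \<in> Ob C" "W \<in> Ob C" "dual C V \<in> Ob C" "dual C W \<in> Ob C"
      using V W dV(2) dW(2) by simp_all
    define F where "F = Tag V f W"
    define c where "c = Tag \<one>\<^sub>o (coev C V) (V \<otimes>\<^sub>o dual C V)"
    define e where "e = Tag (dual C W \<otimes>\<^sub>o W) (ev C W) \<one>\<^sub>o"
    have [simp]: "ok F" "src F = V" "tgt F = W" "ok c" "src c = \<one>\<^sub>o" "tgt c = V \<otimes>\<^sub>o dual C V"
      "ok e" "src e = dual C W \<otimes>\<^sub>o W" "tgt e = \<one>\<^sub>o"
      using f dV(3) dW(4) by (simp_all add: F_def c_def e_def)
    have "((e \<boxtimes> \<iota> (dual C V)) \<bullet> (\<iota> (dual C W) \<boxtimes> F \<boxtimes> \<iota> (dual C V))) \<bullet> (\<iota> (dual C W) \<boxtimes> c)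
      = (e \<boxtimes> \<iota> (dual C V)) \<bullet> (\<iota> (dual C W) \<boxtimes> ((F \<boxtimes> \<iota> (dual C V)) \<bullet> c))"
      by (simp add: whisker_l tcmp_assoc)
    then show ?thesis
      by (simp add: left_dual_mor_def lower_l_def F_def c_def e_def tcmp_def ttensor_def tid_def)
  qed
  show "arr (left_dual_mor C V W f) (dual C W) (dual C V)"
    unfolding eq using arr_lower_l[OF dual_pair_left[OF W] w dV(2)] dW(2) by simp
  have "coev C W \<otimes>\<^sub>m ident C \<one>\<^sub>o = coev C W"
    using ttensor_unit(2)[of "Tag \<one>\<^sub>o (coev C W) (W \<otimes>\<^sub>o dual C W)"] dW(3)
    by (simp add: ttensor_def tid_def)
  then show "(ident C W \<otimes>\<^sub>m left_dual_mor C V W f) \<cdot> coev C W = ?w"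
    using raise_lower_l[OF dual_pair_left[OF W] w dV(2)] unfolding eq by (simp add: raise_l_def)
qed

lemma ev_tilde_slide:
  assumes f: "arr f V W"
  shows "ev_tilde C V \<cdot> (ident C V \<otimes>\<^sub>m left_dual_mor C V W f)
    = ev_tilde C W \<cdot> (f \<otimes>\<^sub>m ident C (dual C W))"
proof -
  have V: "V \<in> Ob C" and W: "W \<in> Ob C" using f by (auto dest: arrD)
  note dV = dual_pairD[OF dual_pair_right[OF V]] and dW = dual_pairD[OF dual_pair_right[OF W]]
  let ?h = "ev_tilde C W \<cdot> (f \<otimes>\<^sub>m ident C (dual C W))"
  have h: "arr ?h (V \<otimes>\<^sub>o dual C W) \<one>\<^sub>o"
    by (rule arr_cmp[OF dW(4) arr_tensor[OF f arr_id[OF dW(1)]]])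
  have eq: "left_dual_mor C V W f = raise_l (dual C V) (coev_tilde C V) (dual C W) ?h"
  proof -
    have [simp]: "V \<in> Ob C" "W \<in> Ob C" "dual C V \<in> Ob C" "dual C W \<in> Ob C"
      using V W dV(1) dW(1) by simp_all
    define F where "F = Tag V f W"
    define c where "c = Tag \<one>\<^sub>o (coev_tilde C V) (dual C V \<otimes>\<^sub>o V)"
    define e where "e = Tag (W \<otimes>\<^sub>o dual C W) (ev_tilde C W) \<one>\<^sub>o"
    have [simp]: "ok F" "src F = V" "tgt F = W" "ok c" "src c = \<one>\<^sub>o" "tgt c = dual C V \<otimes>\<^sub>o V"
      "ok e" "src e = W \<otimes>\<^sub>o dual C W" "tgt e = \<one>\<^sub>o"
      using f dV(3) dW(4) by (simp_all add: F_def c_def e_def)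
    have "((\<iota> (dual C V) \<boxtimes> e) \<bullet> (\<iota> (dual C V) \<boxtimes> F \<boxtimes> \<iota> (dual C W))) \<bullet> (c \<boxtimes> \<iota> (dual C W))
      = (\<iota> (dual C V) \<boxtimes> (e \<bullet> (F \<boxtimes> \<iota> (dual C W)))) \<bullet> (c \<boxtimes> \<iota> (dual C W))"
      by (simp add: whisker_l tcmp_assoc)
    then show ?thesis
      unfolding dual_mor_coincide[OF V W arrD(3)[OF f]]
      by (simp add: right_dual_mor_def raise_l_def F_def c_def e_def tcmp_def ttensor_def tid_def)
  qed
  have "ev_tilde C V \<otimes>\<^sub>m ident C \<one>\<^sub>o = ev_tilde C V"
    using ttensor_unit(2)[of "Tag (V \<otimes>\<^sub>o dual C V) (ev_tilde C V) \<one>\<^sub>o"] dV(4)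
    by (simp add: ttensor_def tid_def)
  then show ?thesis
    using lower_raise_l[OF dual_pair_right[OF V] h dW(1)] unfolding eq by (simp add: lower_l_def)
qed

lemma right_partial_trace_cyclic:
  assumes f: "arr f U V" and h: "arr h (B \<otimes>\<^sub>o V) (A \<otimes>\<^sub>o U)" and ob: "A \<in> Ob C" "B \<in> Ob C"
  shows "right_partial_trace C B A V ((ident C A \<otimes>\<^sub>m f) \<cdot> h)
    = right_partial_trace C B A U (h \<cdot> (ident C B \<otimes>\<^sub>m f))"
proof -
  have U: "U \<in> Ob C" and V: "V \<in> Ob C" using f by (auto dest: arrD)
  note lU = dual_pairD[OF dual_pair_left[OF U]] and lV = dual_pairD[OF dual_pair_left[OF V]]
  note rU = dual_pairD[OF dual_pair_right[OF U]] and rV = dual_pairD[OF dual_pair_right[OF V]]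
  have [simp]: "U \<in> Ob C" "V \<in> Ob C" "dual C U \<in> Ob C" "dual C V \<in> Ob C" "A \<in> Ob C" "B \<in> Ob C"
    using U V lU(2) lV(2) ob by simp_all
  define F where "F = Tag U f V"
  define F' where "F' = Tag (dual C V) (left_dual_mor C U V f) (dual C U)"
  define H where "H = Tag (B \<otimes>\<^sub>o V) h (A \<otimes>\<^sub>o U)"
  define cU where "cU = Tag \<one>\<^sub>o (coev C U) (U \<otimes>\<^sub>o dual C U)"
  define cV where "cV = Tag \<one>\<^sub>o (coev C V) (V \<otimes>\<^sub>o dual C V)"
  define eU where "eU = Tag (U \<otimes>\<^sub>o dual C U) (ev_tilde C U) \<one>\<^sub>o"
  define eV where "eV = Tag (V \<otimes>\<^sub>o dual C V) (ev_tilde C V) \<one>\<^sub>o"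
  note defs = F_def F'_def H_def cU_def cV_def eU_def eV_def
  have [simp]: "ok F" "src F = U" "tgt F = V" "ok F'" "src F' = dual C V" "tgt F' = dual C U"
    "ok H" "src H = B \<otimes>\<^sub>o V" "tgt H = A \<otimes>\<^sub>o U" "ok cU" "src cU = \<one>\<^sub>o" "tgt cU = U \<otimes>\<^sub>o dual C U"
    "ok cV" "src cV = \<one>\<^sub>o" "tgt cV = V \<otimes>\<^sub>o dual C V" "ok eU" "src eU = U \<otimes>\<^sub>o dual C U" "tgt eU = \<one>\<^sub>o"
    "ok eV" "src eV = V \<otimes>\<^sub>o dual C V" "tgt eV = \<one>\<^sub>o"
    using f h coev_slide(2)[OF f] lU(3) lV(3) rU(4) rV(4) by (simp_all add: defs)
  have cup: "(F \<boxtimes> \<iota> (dual C U)) \<bullet> cU = (\<iota> V \<boxtimes> F') \<bullet> cV"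
    using coev_slide(1)[OF f] by (simp add: defs tcmp_def ttensor_def tid_def)
  have cap: "eV \<bullet> (F \<boxtimes> \<iota> (dual C V)) = eU \<bullet> (\<iota> U \<boxtimes> F')"
    using ev_tilde_slide[OF f] by (simp add: defs tcmp_def ttensor_def tid_def)
  have "((\<iota> A \<boxtimes> eV) \<bullet> (((\<iota> A \<boxtimes> F) \<bullet> H) \<boxtimes> \<iota> (dual C V))) \<bullet> (\<iota> B \<boxtimes> cV)
    = (\<iota> A \<boxtimes> (eV \<bullet> (F \<boxtimes> \<iota> (dual C V)))) \<bullet> (H \<boxtimes> \<iota> (dual C V)) \<bullet> (\<iota> B \<boxtimes> cV)"
    by (simp add: whisker_l whisker_r tcmp_assoc ttensor_assoc)
  also have "\<dots> = (\<iota> A \<boxtimes> eU) \<bullet> ((\<iota> (A \<otimes>\<^sub>o U) \<boxtimes> F') \<bullet> (H \<boxtimes> \<iota> (dual C V))) \<bullet> (\<iota> B \<boxtimes> cV)"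
    unfolding cap by (simp add: whisker_l tcmp_assoc ttensor_assoc ttensor_id[symmetric])
  also have "(\<iota> (A \<otimes>\<^sub>o U) \<boxtimes> F') \<bullet> (H \<boxtimes> \<iota> (dual C V)) = (H \<boxtimes> \<iota> (dual C U)) \<bullet> (\<iota> (B \<otimes>\<^sub>o V) \<boxtimes> F')"
    using slide[of H F'] by simp
  also have "(\<iota> A \<boxtimes> eU) \<bullet> ((H \<boxtimes> \<iota> (dual C U)) \<bullet> (\<iota> (B \<otimes>\<^sub>o V) \<boxtimes> F')) \<bullet> (\<iota> B \<boxtimes> cV)
    = (\<iota> A \<boxtimes> eU) \<bullet> (H \<boxtimes> \<iota> (dual C U)) \<bullet> (\<iota> B \<boxtimes> ((\<iota> V \<boxtimes> F') \<bullet> cV))"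
    by (simp add: whisker_l tcmp_assoc ttensor_assoc ttensor_id[symmetric])
  also have "\<dots> = ((\<iota> A \<boxtimes> eU) \<bullet> ((H \<bullet> (\<iota> B \<boxtimes> F)) \<boxtimes> \<iota> (dual C U))) \<bullet> (\<iota> B \<boxtimes> cU)"
    unfolding cup[symmetric] by (simp add: whisker_l whisker_r tcmp_assoc ttensor_assoc)
  finally show ?thesis
    by (simp add: right_partial_trace_def defs tcmp_def ttensor_def tid_def)
qed

end

section \<open>The trace of an indecomposable projective object\<close>

locale projective_trace_tuple = finite_pivotal_category C
  for C :: "('o, 'm, 'k::alg_closed_field, 'z) piv_cat_scheme" (structure) +
  fixes P \<alpha> \<beta> \<eta> \<epsilon>
  assumes P_projective: "projective C P" and P_indecomposable: "indecomposable C P"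
    and tuple: "corresponding_tuple C P \<alpha> \<beta> \<eta> \<epsilon>"
begin

lemma tuple_facts:
  "simple_object C \<alpha>" "simple_object C \<beta>" "monomorphism C \<alpha> P \<eta>" "epimorphism C P \<beta> \<epsilon>"
  using tuple unfolding corresponding_tuple_def unique_simple_quotient_def unique_simple_subobject_def
  by simp_all

lemma arr_\<eta>: "arr \<eta> \<alpha> P" and arr_\<epsilon>: "arr \<epsilon> P \<beta>"
  using mono_arr epi_arr tuple_facts by blast+

lemma tuple_objects: "P \<in> Ob C" "\<alpha> \<in> Ob C" "\<beta> \<in> Ob C"
  using arr_\<eta> arr_\<epsilon> by (auto dest: arrD)

lemma is_trace_tuple: "trace_tuple C P \<alpha> \<beta> \<eta> \<epsilon>"
  by (rule trace_tuple_of_corresponding[OF P_indecomposable tuple])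

lemma \<eta>_nonzero: "\<eta> \<noteq> \<zero>\<^bsub>Hom C \<alpha> P\<^esub>" and \<epsilon>_nonzero: "\<epsilon> \<noteq> \<zero>\<^bsub>Hom C P \<beta>\<^esub>"
  using is_trace_tuple unfolding trace_tuple_def by simp_all

abbreviation "coeff_\<eta> \<equiv> coefficient (Hom C \<alpha> P) \<eta>"
abbreviation "coeff_\<epsilon> \<equiv> coefficient (Hom C P \<beta>) \<epsilon>"

lemma coeff_\<eta>: "arr g \<alpha> P \<Longrightarrow> g = coeff_\<eta> g \<odot>\<^bsub>Hom C \<alpha> P\<^esub> \<eta>"
  and coeff_\<epsilon>: "arr h P \<beta> \<Longrightarrow> h = coeff_\<epsilon> h \<odot>\<^bsub>Hom C P \<beta>\<^esub> \<epsilon>"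
proof -
  show "g = coeff_\<eta> g \<odot>\<^bsub>Hom C \<alpha> P\<^esub> \<eta>" if "arr g \<alpha> P"
  proof -
    have "\<exists>!c. g = c \<odot>\<^bsub>Hom C \<alpha> P\<^esub> \<eta>"
      using is_trace_tuple arrD(3)[OF that] unfolding trace_tuple_def by simp
    then show ?thesis unfolding coefficient_def by (rule theI')
  qed
  show "h = coeff_\<epsilon> h \<odot>\<^bsub>Hom C P \<beta>\<^esub> \<epsilon>" if "arr h P \<beta>"
  proof -
    have "\<exists>!c. h = c \<odot>\<^bsub>Hom C P \<beta>\<^esub> \<epsilon>"
      using is_trace_tuple arrD(3)[OF that] unfolding trace_tuple_def by simp
    then show ?thesis unfolding coefficient_def by (rule theI')
  qed
qed

lemma coeff_\<eta>_eqI: "coeff_\<eta> (c \<odot>\<^bsub>Hom C \<alpha> P\<^esub> \<eta>) = c"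
  using smult_inj[OF arr_\<eta> \<eta>_nonzero coeff_\<eta>[OF arr_smult[OF arr_\<eta>]]] by metis

lemma coeff_\<epsilon>_eqI: "coeff_\<epsilon> (c \<odot>\<^bsub>Hom C P \<beta>\<^esub> \<epsilon>) = c"
  using smult_inj[OF arr_\<epsilon> \<epsilon>_nonzero coeff_\<epsilon>[OF arr_smult[OF arr_\<epsilon>]]] by metis

lemma coeff_generator: "coeff_\<eta> \<eta> = 1" "coeff_\<epsilon> \<epsilon> = 1"
proof -
  have "1 \<odot>\<^bsub>Hom C \<alpha> P\<^esub> \<eta> = \<eta>" "1 \<odot>\<^bsub>Hom C P \<beta>\<^esub> \<epsilon> = \<epsilon>"
    using module.smult_one[OF Hom_module] arr_\<eta> arr_\<epsilon> unfolding arr_def by fastforce+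
  then show "coeff_\<eta> \<eta> = 1" "coeff_\<epsilon> \<epsilon> = 1" using coeff_\<eta>_eqI[of 1] coeff_\<epsilon>_eqI[of 1] by simp_all
qed

text \<open>
  Both coefficients are read off from the endomorphism \<open>tr (G)\<close> of \<open>P\<close>, whose action on \<open>\<eta>\<close> and on
  \<open>\<epsilon>\<close> is by one and the same scalar.
\<close>

lemma coefficients_of_trace_agree:
  assumes V: "V \<in> Ob C" and G: "arr G (P \<otimes>\<^sub>o V) (P \<otimes>\<^sub>o V)"
  shows "coeff_\<eta> (right_partial_trace C \<alpha> P V (G \<cdot> (\<eta> \<otimes>\<^sub>m ident C V)))
    = coeff_\<epsilon> (right_partial_trace C P \<beta> V ((\<epsilon> \<otimes>\<^sub>m ident C V) \<cdot> G))"
proof -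
  define T where "T = right_partial_trace C P P V G"
  have T: "arr T P P" unfolding T_def by (rule arr_right_partial_trace[OF G tuple_objects(1) tuple_objects(1) V])
  show ?thesis
    unfolding right_partial_trace_pre[OF G arr_\<eta> tuple_objects(1) V]
      right_partial_trace_post[OF G arr_\<epsilon> tuple_objects(1) V] T_def[symmetric]
    by (rule coefficients_agree[OF P_indecomposable T arr_\<eta> \<eta>_nonzero arr_\<epsilon> \<epsilon>_nonzero
          coeff_\<eta>[OF arr_cmp[OF T arr_\<eta>]] coeff_\<epsilon>[OF arr_cmp[OF arr_\<epsilon> T]]])
qed

definition retraction :: "'o \<Rightarrow> 'm \<Rightarrow> bool" where
  "retraction V \<sigma> \<longleftrightarrow> arr \<sigma> (P \<otimes>\<^sub>o V) (\<alpha> \<otimes>\<^sub>o V) \<and> \<sigma> \<cdot> (\<eta> \<otimes>\<^sub>m ident C V) = ident C (\<alpha> \<otimes>\<^sub>o V)"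

definition section_of :: "'o \<Rightarrow> 'm \<Rightarrow> bool" where
  "section_of V \<tau> \<longleftrightarrow> arr \<tau> (\<beta> \<otimes>\<^sub>o V) (P \<otimes>\<^sub>o V) \<and> (\<epsilon> \<otimes>\<^sub>m ident C V) \<cdot> \<tau> = ident C (\<beta> \<otimes>\<^sub>o V)"

lemma retraction_exists: "projective C V \<Longrightarrow> \<exists>\<sigma>. retraction V \<sigma>"
  unfolding retraction_def
  by (rule injective_extend[OF projective_imp_injective[OF projective_tensor_l[OF _ tuple_objects(2)]]
        tensor_mono_r[OF projective_Ob tuple_facts(3)]])
    (use tuple_objects projective_Ob in \<open>auto intro!: arr_id\<close>)

lemma section_exists: "projective C V \<Longrightarrow> \<exists>\<tau>. section_of V \<tau>"
  unfolding section_of_def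
  by (rule projective_lift[OF projective_tensor_l[OF _ tuple_objects(3)]
        tensor_epi_r[OF projective_Ob tuple_facts(4)]])
    (use tuple_objects projective_Ob in \<open>auto intro!: arr_id\<close>)

lemma retraction_cancel:
  assumes "retraction V \<sigma>" "V \<in> Ob C" "arr f (\<alpha> \<otimes>\<^sub>o V) B"
  shows "(f \<cdot> \<sigma>) \<cdot> (\<eta> \<otimes>\<^sub>m ident C V) = f"
  using assms assoc[OF assms(3) _ arr_tensor[OF arr_\<eta> arr_id], of \<sigma> V] id_r[OF assms(3)]
  unfolding retraction_def by simp

lemma section_cancel:
  assumes "section_of V \<tau>" "V \<in> Ob C" "arr f B (\<beta> \<otimes>\<^sub>o V)"
  shows "(\<epsilon> \<otimes>\<^sub>m ident C V) \<cdot> (\<tau> \<cdot> f) = f"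
  using assms assoc[OF arr_tensor[OF arr_\<epsilon> arr_id] _ assms(3), of V \<tau>] id_l[OF assms(3)]
  unfolding section_of_def by simp

text \<open>
  The endomorphism of \<open>P \<otimes> V\<close> in question is \<open>\<tau> f \<sigma> (P \<otimes> g)\<close>.  For \<open>g = 1\<close> this compares the two
  formulas for the trace; the general case is needed for cyclicity, where \<open>\<sigma>\<close> and \<open>\<tau>\<close> belong to
  different objects.
\<close>

lemma two_formulas:
  assumes V: "V \<in> Ob C" and W: "W \<in> Ob C" and \<sigma>: "retraction W \<sigma>" and \<tau>: "section_of V \<tau>"
    and f: "arr f (\<alpha> \<otimes>\<^sub>o W) (\<beta> \<otimes>\<^sub>o V)" and g: "arr g V W"
  shows "coeff_\<eta> (right_partial_trace C \<alpha> P V (\<tau> \<cdot> (f \<cdot> (ident C \<alpha> \<otimes>\<^sub>m g))))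
    = coeff_\<epsilon> (right_partial_trace C P \<beta> V ((f \<cdot> \<sigma>) \<cdot> (ident C P \<otimes>\<^sub>m g)))"
proof -
  note s = \<sigma>[unfolded retraction_def, THEN conjunct1] and t = \<tau>[unfolded section_of_def, THEN conjunct1]
  note ag = arr_tensor[OF arr_id[OF tuple_objects(2)] g] and Pg = arr_tensor[OF arr_id[OF tuple_objects(1)] g]
  note fs = arr_cmp[OF f s]
  note fsg = arr_cmp[OF fs Pg]
  have "((f \<cdot> \<sigma>) \<cdot> (ident C P \<otimes>\<^sub>m g)) \<cdot> (\<eta> \<otimes>\<^sub>m ident C V)
      = (f \<cdot> \<sigma>) \<cdot> ((ident C P \<otimes>\<^sub>m g) \<cdot> (\<eta> \<otimes>\<^sub>m ident C V))"
    by (rule assoc[OF fs Pg arr_tensor[OF arr_\<eta> arr_id[OF V]]])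
  also have "(ident C P \<otimes>\<^sub>m g) \<cdot> (\<eta> \<otimes>\<^sub>m ident C V) = (\<eta> \<otimes>\<^sub>m ident C W) \<cdot> (ident C \<alpha> \<otimes>\<^sub>m g)"
    using slide[of "Tag \<alpha> \<eta> P" "Tag V g W"] arr_\<eta> g by (simp add: tcmp_def ttensor_def tid_def)
  also have "(f \<cdot> \<sigma>) \<cdot> \<dots> = f \<cdot> (ident C \<alpha> \<otimes>\<^sub>m g)"
    using assoc[OF fs arr_tensor[OF arr_\<eta> arr_id[OF W]] ag] retraction_cancel[OF \<sigma> W f] by simp
  finally have 1: "((f \<cdot> \<sigma>) \<cdot> (ident C P \<otimes>\<^sub>m g)) \<cdot> (\<eta> \<otimes>\<^sub>m ident C V) = f \<cdot> (ident C \<alpha> \<otimes>\<^sub>m g)" .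
  show ?thesis
    using coefficients_of_trace_agree[OF V arr_cmp[OF t fsg]] section_cancel[OF \<tau> V fsg]
      assoc[OF t fsg arr_tensor[OF arr_\<eta> arr_id[OF V]]] 1 by simp
qed

lemma two_formulas_id:
  assumes V: "V \<in> Ob C" and \<sigma>: "retraction V \<sigma>" and \<tau>: "section_of V \<tau>" and f: "arr f (\<alpha> \<otimes>\<^sub>o V) (\<beta> \<otimes>\<^sub>o V)"
  shows "coeff_\<eta> (right_partial_trace C \<alpha> P V (\<tau> \<cdot> f)) = coeff_\<epsilon> (right_partial_trace C P \<beta> V (f \<cdot> \<sigma>))"
  using two_formulas[OF V V \<sigma> \<tau> f arr_id[OF V]] tuple_objects V
    id_r[OF f] id_r[OF arr_cmp[OF f \<sigma>[unfolded retraction_def, THEN conjunct1]]]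
  by (simp add: tensor_id)

lemma associated_right_trace_iff:
  "associated_right_trace C P \<alpha> \<beta> \<eta> \<epsilon> t \<longleftrightarrow>
     (\<forall>V f \<sigma> \<tau>. projective C V \<and> arr f (\<alpha> \<otimes>\<^sub>o V) (\<beta> \<otimes>\<^sub>o V) \<and> retraction V \<sigma> \<and> section_of V \<tau> \<longrightarrow>
        t V f = coeff_\<eta> (right_partial_trace C \<alpha> P V (\<tau> \<cdot> f)) \<and>
        t V f = coeff_\<epsilon> (right_partial_trace C P \<beta> V (f \<cdot> \<sigma>)))" (is "?L \<longleftrightarrow> ?R")
proof -
  have Sig: "{\<sigma> \<in> Mor C (P \<otimes>\<^sub>o V) (\<alpha> \<otimes>\<^sub>o V). \<sigma> \<cdot> (\<eta> \<otimes>\<^sub>m ident C V) = ident C (\<alpha> \<otimes>\<^sub>o V)} = {\<sigma>. retraction V \<sigma>}"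
    and Tau: "{\<tau> \<in> Mor C (\<beta> \<otimes>\<^sub>o V) (P \<otimes>\<^sub>o V). (\<epsilon> \<otimes>\<^sub>m ident C V) \<cdot> \<tau> = ident C (\<beta> \<otimes>\<^sub>o V)} = {\<tau>. section_of V \<tau>}"
    and Mor: "f \<in> Mor C (\<alpha> \<otimes>\<^sub>o V) (\<beta> \<otimes>\<^sub>o V) \<longleftrightarrow> arr f (\<alpha> \<otimes>\<^sub>o V) (\<beta> \<otimes>\<^sub>o V)"
    if "V \<in> Ob C" for V f
    using that tuple_objects by (auto simp: retraction_def section_of_def arr_def)
  show ?thesis
  proof
    assume L: ?L
    show ?R
    proof (intro allI impI, elim conjE)
      fix V f \<sigma> \<tau>
      assume V: "projective C V" and f: "arr f (\<alpha> \<otimes>\<^sub>o V) (\<beta> \<otimes>\<^sub>o V)" and "retraction V \<sigma>" "section_of V \<tau>"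
      then show "t V f = coeff_\<eta> (right_partial_trace C \<alpha> P V (\<tau> \<cdot> f)) \<and>
        t V f = coeff_\<epsilon> (right_partial_trace C P \<beta> V (f \<cdot> \<sigma>))"
        using L[unfolded associated_right_trace_def, rule_format, OF V]
        unfolding Let_def Sig[OF projective_Ob[OF V]] Tau[OF projective_Ob[OF V]]
        using arrD(3)[OF f] by blast
    qed
  next
    assume R: ?R
    show ?L unfolding associated_right_trace_def
    proof (intro allI impI)
      fix V assume V: "projective C V"
      obtain \<sigma>\<^sub>0 \<tau>\<^sub>0 where "retraction V \<sigma>\<^sub>0" "section_of V \<tau>\<^sub>0"
        using retraction_exists[OF V] section_exists[OF V] by blast
      then show "let Sig = {\<sigma> \<in> Mor C (P \<otimes>\<^sub>o V) (\<alpha> \<otimes>\<^sub>o V). \<sigma> \<cdot> (\<eta> \<otimes>\<^sub>m ident C V) = ident C (\<alpha> \<otimes>\<^sub>o V)};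
          Tau = {\<tau> \<in> Mor C (\<beta> \<otimes>\<^sub>o V) (P \<otimes>\<^sub>o V). (\<epsilon> \<otimes>\<^sub>m ident C V) \<cdot> \<tau> = ident C (\<beta> \<otimes>\<^sub>o V)}
        in Sig \<noteq> {} \<and> Tau \<noteq> {} \<and> (\<forall>f\<in>Mor C (\<alpha> \<otimes>\<^sub>o V) (\<beta> \<otimes>\<^sub>o V).
          (\<forall>\<tau>\<in>Tau. t V f = coeff_\<eta> (right_partial_trace C \<alpha> P V (\<tau> \<cdot> f))) \<and>
          (\<forall>\<sigma>\<in>Sig. t V f = coeff_\<epsilon> (right_partial_trace C P \<beta> V (f \<cdot> \<sigma>))))"
        using R V
        unfolding Let_def Sig[OF projective_Ob[OF V]] Tau[OF projective_Ob[OF V]] Mor[OF projective_Ob[OF V]] Ball_def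
        by blast
    qed
  qed
qed

text \<open>
  Every section gives the same value, because every section agrees with every retraction.
\<close>

lemma associated_right_trace_exists: "\<exists>t. associated_right_trace C P \<alpha> \<beta> \<eta> \<epsilon> t"
proof -
  define t where "t V f = coeff_\<eta> (right_partial_trace C \<alpha> P V ((SOME \<tau>. section_of V \<tau>) \<cdot> f))" for V f
  have "associated_right_trace C P \<alpha> \<beta> \<eta> \<epsilon> t"
    unfolding associated_right_trace_iff
  proof (intro allI impI, elim conjE)
    fix V f \<sigma> \<tau>
    assume V: "projective C V" and f: "arr f (\<alpha> \<otimes>\<^sub>o V) (\<beta> \<otimes>\<^sub>o V)" and \<sigma>: "retraction V \<sigma>" and \<tau>: "section_of V \<tau>"
    have some: "section_of V (SOME \<tau>. section_of V \<tau>)" using \<tau> by (rule someI)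
    show "t V f = coeff_\<eta> (right_partial_trace C \<alpha> P V (\<tau> \<cdot> f)) \<and>
        t V f = coeff_\<epsilon> (right_partial_trace C P \<beta> V (f \<cdot> \<sigma>))"
      unfolding t_def two_formulas_id[OF projective_Ob[OF V] \<sigma> some f]
        two_formulas_id[OF projective_Ob[OF V] \<sigma> \<tau> f] by simp
  qed
  then show ?thesis by blast
qed

context
  fixes t
  assumes t: "associated_right_trace C P \<alpha> \<beta> \<eta> \<epsilon> t"
begin

lemma trace_formulas:
  assumes "projective C V" "arr f (\<alpha> \<otimes>\<^sub>o V) (\<beta> \<otimes>\<^sub>o V)" "retraction V \<sigma>" "section_of V \<tau>"
  shows "t V f = coeff_\<eta> (right_partial_trace C \<alpha> P V (\<tau> \<cdot> f))"
    "t V f = coeff_\<epsilon> (right_partial_trace C P \<beta> V (f \<cdot> \<sigma>))"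
  using t[unfolded associated_right_trace_iff] assms by blast+

lemma trace_linear:
  assumes V: "projective C V"
  shows "linear_functional (Hom C (\<alpha> \<otimes>\<^sub>o V) (\<beta> \<otimes>\<^sub>o V)) (t V)"
proof -
  note Vo = projective_Ob[OF V]
  obtain \<sigma> \<tau> where \<sigma>: "retraction V \<sigma>" and \<tau>: "section_of V \<tau>"
    using retraction_exists[OF V] section_exists[OF V] by blast
  have ob: "\<alpha> \<otimes>\<^sub>o V \<in> Ob C" "\<beta> \<otimes>\<^sub>o V \<in> Ob C" "P \<otimes>\<^sub>o V \<in> Ob C" using tuple_objects Vo by simp_all
  define \<phi> where "\<phi> f = right_partial_trace C \<alpha> P V (\<tau> \<cdot> f)" for f
  have lin: "linear_map (Hom C (\<alpha> \<otimes>\<^sub>o V) (\<beta> \<otimes>\<^sub>o V)) (Hom C \<alpha> P) \<phi>"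
    unfolding \<phi>_def
    by (rule linear_map_compose[OF cmp_linear_right linear_right_partial_trace])
      (use ob tuple_objects Vo \<tau> in \<open>auto simp: section_of_def arr_def\<close>)
  have t\<phi>: "t V f = coeff_\<eta> (\<phi> f)" and \<phi>: "\<phi> f = t V f \<odot>\<^bsub>Hom C \<alpha> P\<^esub> \<eta>" and \<phi>c: "\<phi> f \<in> Mor C \<alpha> P"
    if f: "f \<in> Mor C (\<alpha> \<otimes>\<^sub>o V) (\<beta> \<otimes>\<^sub>o V)" for f
  proof -
    show 1: "t V f = coeff_\<eta> (\<phi> f)" unfolding \<phi>_def by (rule trace_formulas[OF V arrI[OF ob(1,2) f] \<sigma> \<tau>])
    show 2: "\<phi> f \<in> Mor C \<alpha> P" using lin f unfolding linear_map_def by simp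
    show "\<phi> f = t V f \<odot>\<^bsub>Hom C \<alpha> P\<^esub> \<eta>"
      unfolding 1 by (rule coeff_\<eta>[OF arrI[OF tuple_objects(2,1) 2]])
  qed
  interpret N: Module.module scalars "Hom C (\<alpha> \<otimes>\<^sub>o V) (\<beta> \<otimes>\<^sub>o V)" by (rule Hom_module[OF ob(1,2)])
  interpret M: Module.module scalars "Hom C \<alpha> P" by (rule Hom_module[OF tuple_objects(2,1)])
  note \<eta>c = arrD(3)[OF arr_\<eta>]
  show ?thesis unfolding linear_functional_def
  proof (intro conjI ballI allI)
    fix f g assume f: "f \<in> Mor C (\<alpha> \<otimes>\<^sub>o V) (\<beta> \<otimes>\<^sub>o V)" and g: "g \<in> Mor C (\<alpha> \<otimes>\<^sub>o V) (\<beta> \<otimes>\<^sub>o V)"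
    have "\<phi> (f \<oplus>\<^bsub>Hom C (\<alpha> \<otimes>\<^sub>o V) (\<beta> \<otimes>\<^sub>o V)\<^esub> g) = \<phi> f \<oplus>\<^bsub>Hom C \<alpha> P\<^esub> \<phi> g"
      using lin f g unfolding linear_map_def by simp
    also have "\<dots> = (t V f + t V g) \<odot>\<^bsub>Hom C \<alpha> P\<^esub> \<eta>"
      unfolding \<phi>[OF f] \<phi>[OF g] using M.smult_l_distr[of "t V f" "t V g" \<eta>] \<eta>c by simp
    finally show "t V (f \<oplus>\<^bsub>Hom C (\<alpha> \<otimes>\<^sub>o V) (\<beta> \<otimes>\<^sub>o V)\<^esub> g) = t V f + t V g"
      using t\<phi>[OF N.a_closed[OF f g]] coeff_\<eta>_eqI by simp
  next
    fix c f assume f: "f \<in> Mor C (\<alpha> \<otimes>\<^sub>o V) (\<beta> \<otimes>\<^sub>o V)"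
    have "\<phi> (c \<odot>\<^bsub>Hom C (\<alpha> \<otimes>\<^sub>o V) (\<beta> \<otimes>\<^sub>o V)\<^esub> f) = c \<odot>\<^bsub>Hom C \<alpha> P\<^esub> \<phi> f"
      using lin f unfolding linear_map_def by simp
    also have "\<dots> = (c * t V f) \<odot>\<^bsub>Hom C \<alpha> P\<^esub> \<eta>"
      unfolding \<phi>[OF f] using M.smult_assoc1[of c "t V f" \<eta>] \<eta>c by simp
    finally show "t V (c \<odot>\<^bsub>Hom C (\<alpha> \<otimes>\<^sub>o V) (\<beta> \<otimes>\<^sub>o V)\<^esub> f) = c * t V f"
      using t\<phi>[OF N.smult_closed[of c f]] f coeff_\<eta>_eqI by simp
  qed
qed

lemma trace_cyclic:
  assumes U: "projective C U" and V: "projective C V"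
    and f: "arr f (\<alpha> \<otimes>\<^sub>o V) (\<beta> \<otimes>\<^sub>o U)" and g: "arr g U V"
  shows "t V ((ident C \<beta> \<otimes>\<^sub>m g) \<cdot> f) = t U (f \<cdot> (ident C \<alpha> \<otimes>\<^sub>m g))"
proof -
  note Uo = projective_Ob[OF U] and Vo = projective_Ob[OF V]
  obtain \<sigma>U \<tau>U \<sigma>V \<tau>V where \<sigma>U: "retraction U \<sigma>U" and \<tau>U: "section_of U \<tau>U"
    and \<sigma>V: "retraction V \<sigma>V" and \<tau>V: "section_of V \<tau>V"
    using retraction_exists[OF U] section_exists[OF U] retraction_exists[OF V] section_exists[OF V] by blast
  note sV = \<sigma>V[unfolded retraction_def, THEN conjunct1]
  note bg = arr_tensor[OF arr_id[OF tuple_objects(3)] g] and ag = arr_tensor[OF arr_id[OF tuple_objects(2)] g]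
  have "t V ((ident C \<beta> \<otimes>\<^sub>m g) \<cdot> f) = coeff_\<epsilon> (right_partial_trace C P \<beta> V ((ident C \<beta> \<otimes>\<^sub>m g) \<cdot> (f \<cdot> \<sigma>V)))"
    using trace_formulas(2)[OF V arr_cmp[OF bg f] \<sigma>V \<tau>V] assoc[OF bg f sV] by simp
  also have "\<dots> = coeff_\<epsilon> (right_partial_trace C P \<beta> U ((f \<cdot> \<sigma>V) \<cdot> (ident C P \<otimes>\<^sub>m g)))"
    using right_partial_trace_cyclic[OF g arr_cmp[OF f sV] tuple_objects(3,1)] by simp
  also have "\<dots> = coeff_\<eta> (right_partial_trace C \<alpha> P U (\<tau>U \<cdot> (f \<cdot> (ident C \<alpha> \<otimes>\<^sub>m g))))"
    by (rule two_formulas[OF Uo Vo \<sigma>V \<tau>U f g, symmetric])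
  also have "\<dots> = t U (f \<cdot> (ident C \<alpha> \<otimes>\<^sub>m g))"
    by (rule trace_formulas(1)[OF U arr_cmp[OF f ag] \<sigma>U \<tau>U, symmetric])
  finally show ?thesis .
qed

text \<open>
  A nonzero \<open>g : V \<rightarrow> \<beta> \<otimes> U\<close> has a nonzero transpose \<open>V \<otimes> U\<^sup>* \<rightarrow> \<beta>\<close>.  It is an epimorphism since
  \<open>\<beta>\<close> is simple, so \<open>\<epsilon>\<close> lifts along it; the transpose \<open>h : P \<otimes> U \<rightarrow> V\<close> of the lift satisfies
  \<open>tr (g h) = \<epsilon>\<close>.
\<close>

lemma trace_nondegenerate_left:
  assumes U: "projective C U" and g: "arr g V (\<beta> \<otimes>\<^sub>o U)" and nz: "g \<noteq> \<zero>\<^bsub>Hom C V (\<beta> \<otimes>\<^sub>o U)\<^esub>"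
  shows "\<exists>f. arr f (\<alpha> \<otimes>\<^sub>o U) V \<and> t U (g \<cdot> f) = 1"
proof -
  note Uo = projective_Ob[OF U] and ob = tuple_objects
  note dl = dual_pair_left[OF Uo] and dr = dual_pair_right[OF Uo] and Ud = dual_closed[OF Uo]
  have V: "V \<in> Ob C" using g by (rule arrD)
  obtain \<sigma> \<tau> where \<sigma>: "retraction U \<sigma>" and \<tau>: "section_of U \<tau>"
    using retraction_exists[OF U] section_exists[OF U] by blast
  define g' where "g' = lower_r (dual C U) (ev_tilde C U) \<beta> g"
  have g': "arr g' (V \<otimes>\<^sub>o dual C U) \<beta>" unfolding g'_def by (rule arr_lower_r[OF dr g ob(3)])
  have "g' \<noteq> \<zero>\<^bsub>Hom C (V \<otimes>\<^sub>o dual C U) \<beta>\<^esub>"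
  proof
    assume z: "g' = \<zero>\<^bsub>Hom C (V \<otimes>\<^sub>o dual C U) \<beta>\<^esub>"
    have VU: "V \<otimes>\<^sub>o dual C U \<in> Ob C" using V Ud by simp
    have "arr (ident C V \<otimes>\<^sub>m coev_tilde C U) V ((V \<otimes>\<^sub>o dual C U) \<otimes>\<^sub>o U)"
      using arr_tensor[OF arr_id[OF V] dual_pairD(3)[OF dr]] V Uo Ud by simp
    then have "raise_r U (coev_tilde C U) V g' = \<zero>\<^bsub>Hom C V (\<beta> \<otimes>\<^sub>o U)\<^esub>"
      unfolding raise_r_def z tensor_zero_l[OF VU ob(3) Uo] using ob(3) Uo by (intro cmp_zero_l) simp_all
    then show False using nz raise_lower_r[OF dr g ob(3)] unfolding g'_def by simp
  qed
  then have "epimorphism C (V \<otimes>\<^sub>o dual C U) \<beta> g'" by (rule nonzero_to_simple_epi[OF tuple_facts(2) g'])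
  then obtain h' where h': "arr h' P (V \<otimes>\<^sub>o dual C U)" "g' \<cdot> h' = \<epsilon>"
    using projective_lift[OF P_projective _ arr_\<epsilon>] by blast
  define h where "h = lower_r U (ev C U) V h'"
  have h: "arr h (P \<otimes>\<^sub>o U) V" unfolding h_def by (rule arr_lower_r[OF dl h'(1) V])
  have tr: "right_partial_trace C P \<beta> U (g \<cdot> h) = \<epsilon>"
    using right_partial_trace_cmp[OF h g ob(1,3) Uo] raise_lower_r[OF dl h'(1) V] h'(2)
    unfolding g'_def h_def by simp
  note gh = arr_cmp[OF g h] and \<eta>U = arr_tensor[OF arr_\<eta> arr_id[OF Uo]]
  note t' = \<tau>[unfolded section_of_def, THEN conjunct1]
  define f where "f = h \<cdot> (\<eta> \<otimes>\<^sub>m ident C U)"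
  have f: "arr f (\<alpha> \<otimes>\<^sub>o U) V" unfolding f_def by (rule arr_cmp[OF h \<eta>U])
  have "t U (g \<cdot> f) = coeff_\<eta> (right_partial_trace C \<alpha> P U ((\<tau> \<cdot> (g \<cdot> h)) \<cdot> (\<eta> \<otimes>\<^sub>m ident C U)))"
    using trace_formulas(1)[OF U arr_cmp[OF g f] \<sigma> \<tau>] assoc[OF t' gh \<eta>U] assoc[OF g h \<eta>U]
    unfolding f_def by simp
  also have "\<dots> = coeff_\<epsilon> (right_partial_trace C P \<beta> U (g \<cdot> h))"
    using coefficients_of_trace_agree[OF Uo arr_cmp[OF t' gh]] section_cancel[OF \<tau> Uo gh] by simp
  also have "\<dots> = 1" unfolding tr by (rule coeff_generator)
  finally show ?thesis using f by blast
qed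

text \<open>Dually, \<open>\<eta>\<close> extends along the transpose of a nonzero \<open>f\<close>, because \<open>P\<close> is injective.\<close>

lemma trace_nondegenerate_right:
  assumes U: "projective C U" and f: "arr f (\<alpha> \<otimes>\<^sub>o U) V" and nz: "f \<noteq> \<zero>\<^bsub>Hom C (\<alpha> \<otimes>\<^sub>o U) V\<^esub>"
  shows "\<exists>g. arr g V (\<beta> \<otimes>\<^sub>o U) \<and> t U (g \<cdot> f) = 1"
proof -
  note Uo = projective_Ob[OF U] and ob = tuple_objects
  note dl = dual_pair_left[OF Uo] and dr = dual_pair_right[OF Uo] and Ud = dual_closed[OF Uo]
  have V: "V \<in> Ob C" using f by (rule arrD)
  obtain \<sigma> \<tau> where \<sigma>: "retraction U \<sigma>" and \<tau>: "section_of U \<tau>"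
    using retraction_exists[OF U] section_exists[OF U] by blast
  define f' where "f' = raise_r (dual C U) (coev C U) \<alpha> f"
  have f': "arr f' \<alpha> (V \<otimes>\<^sub>o dual C U)" unfolding f'_def by (rule arr_raise_r[OF dl f ob(2)])
  have "f' \<noteq> \<zero>\<^bsub>Hom C \<alpha> (V \<otimes>\<^sub>o dual C U)\<^esub>"
  proof
    assume z: "f' = \<zero>\<^bsub>Hom C \<alpha> (V \<otimes>\<^sub>o dual C U)\<^esub>"
    have VU: "V \<otimes>\<^sub>o dual C U \<in> Ob C" using V Ud by simp
    have "arr (ident C V \<otimes>\<^sub>m ev C U) ((V \<otimes>\<^sub>o dual C U) \<otimes>\<^sub>o U) V"
      using arr_tensor[OF arr_id[OF V] dual_pairD(4)[OF dl]] V Uo Ud by simp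
    then have "lower_r U (ev C U) V f' = \<zero>\<^bsub>Hom C (\<alpha> \<otimes>\<^sub>o U) V\<^esub>"
      unfolding lower_r_def z tensor_zero_l[OF ob(2) VU Uo] using ob(2) Uo by (intro cmp_zero_r) simp_all
    then show False using nz lower_raise_r[OF dl f ob(2)] unfolding f'_def by simp
  qed
  then have "monomorphism C \<alpha> (V \<otimes>\<^sub>o dual C U) f'" by (rule nonzero_from_simple_mono[OF tuple_facts(1) f'])
  then obtain k where k: "arr k (V \<otimes>\<^sub>o dual C U) P" "k \<cdot> f' = \<eta>"
    using injective_extend[OF projective_imp_injective[OF P_projective] _ arr_\<eta>] by blast
  define h where "h = raise_r U (coev_tilde C U) V k"
  have h: "arr h V (P \<otimes>\<^sub>o U)" unfolding h_def by (rule arr_raise_r[OF dr k(1) V])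
  have tr: "right_partial_trace C \<alpha> P U (h \<cdot> f) = \<eta>"
    using right_partial_trace_cmp[OF f h ob(2,1) Uo] lower_raise_r[OF dr k(1) V] k(2)
    unfolding f'_def h_def by simp
  note hf = arr_cmp[OF h f] and \<epsilon>U = arr_tensor[OF arr_\<epsilon> arr_id[OF Uo]]
  note s' = \<sigma>[unfolded retraction_def, THEN conjunct1]
  define g where "g = (\<epsilon> \<otimes>\<^sub>m ident C U) \<cdot> h"
  have g: "arr g V (\<beta> \<otimes>\<^sub>o U)" unfolding g_def by (rule arr_cmp[OF \<epsilon>U h])
  have "t U (g \<cdot> f) = coeff_\<epsilon> (right_partial_trace C P \<beta> U ((\<epsilon> \<otimes>\<^sub>m ident C U) \<cdot> ((h \<cdot> f) \<cdot> \<sigma>)))"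
    using trace_formulas(2)[OF U arr_cmp[OF g f] \<sigma> \<tau>] assoc[OF \<epsilon>U h f] assoc[OF \<epsilon>U hf s']
    unfolding g_def by simp
  also have "\<dots> = coeff_\<eta> (right_partial_trace C \<alpha> P U (h \<cdot> f))"
    using coefficients_of_trace_agree[OF Uo arr_cmp[OF hf s']] retraction_cancel[OF \<sigma> Uo hf] by simp
  also have "\<dots> = 1" unfolding tr by (rule coeff_generator)
  finally show ?thesis using g by blast
qed

lemma projectives_twisted_calabi_yau:
  "twisted_calabi_yau (full_subcategory C (projective C))
     (left_tensor_functor C \<alpha>) (left_tensor_functor C \<beta>) t"
proof -
  define D where "D = full_subcategory C (projective C)"
  have D: "Ob D = {A \<in> Ob C. projective C A}" "Hom D = Hom C" "ident D = ident C" "(\<cdot>\<^bsub>D\<^esub>) = (\<cdot>)"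
    by (simp_all add: D_def full_subcategory_def)
  have ob: "V \<in> Ob D \<longleftrightarrow> projective C V" for V using projective_Ob by (auto simp: D)
  have lin: "linear_category D"
    by (rule linear_category.intro; unfold D)
      (blast intro: Hom_module id_closed cmp_linear_left cmp_linear_right cmp_assoc id_left id_right)+
  have endo: "linear_endofunctor D (left_tensor_functor C A)" if A: "A \<in> Ob C" for A
    unfolding linear_endofunctor_def left_tensor_functor_def fst_conv snd_conv
  proof (intro conjI ballI)
    fix U assume U: "U \<in> Ob D"
    then show "A \<otimes>\<^sub>o U \<in> Ob D" using projective_tensor_l[OF _ A] by (simp add: ob)
    show "ident C A \<otimes>\<^sub>m ident D U = ident D (A \<otimes>\<^sub>o U)" using U A projective_Ob by (simp add: D tensor_id)
    fix V assume V: "V \<in> Ob D"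
    show "linear_map (Hom D U V) (Hom D (A \<otimes>\<^sub>o U) (A \<otimes>\<^sub>o V)) (\<lambda>f. ident C A \<otimes>\<^sub>m f)"
      using tensor_linear_right[of A A U V "ident C A"] U V A id_closed by (simp add: D)
    fix W f g assume W: "W \<in> Ob D" and fg: "f \<in> Mor D U V" "g \<in> Mor D V W"
    show "ident C A \<otimes>\<^sub>m (g \<cdot>\<^bsub>D\<^esub> f) = (ident C A \<otimes>\<^sub>m g) \<cdot>\<^bsub>D\<^esub> (ident C A \<otimes>\<^sub>m f)"
      using tensor_cmp[of A A A U V W "ident C A" "ident C A" f g] U V W A fg id_closed id_left[of A A "ident C A"]
      by (simp add: D)
  qed
  show ?thesis
    unfolding D_def[symmetric] twisted_calabi_yau_def
  proof (intro conjI ballI impI lin endo tuple_objects(2,3); (unfold left_tensor_functor_def fst_conv snd_conv D)?)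
    fix U assume "U \<in> {A \<in> Ob C. projective C A}"
    then have U: "projective C U" by simp
    note Uo = projective_Ob[OF U]
    show "linear_functional (Hom C (\<alpha> \<otimes>\<^sub>o U) (\<beta> \<otimes>\<^sub>o U)) (t U)" by (rule trace_linear[OF U])
    fix V assume "V \<in> {A \<in> Ob C. projective C A}"
    then have V: "projective C V" by simp
    note Vo = projective_Ob[OF V]
    have obs: "\<alpha> \<otimes>\<^sub>o U \<in> Ob C" "\<beta> \<otimes>\<^sub>o U \<in> Ob C" using Uo tuple_objects by simp_all
    show "g = \<zero>\<^bsub>Hom C V (\<beta> \<otimes>\<^sub>o U)\<^esub>"
      if "g \<in> Mor C V (\<beta> \<otimes>\<^sub>o U)" "\<forall>f\<in>Mor C (\<alpha> \<otimes>\<^sub>o U) V. t U (g \<cdot> f) = 0" for g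
      using trace_nondegenerate_left[OF U, of g V] that arrI[OF Vo obs(2)] arrD(3) by force
    show "f = \<zero>\<^bsub>Hom C (\<alpha> \<otimes>\<^sub>o U) V\<^esub>"
      if "f \<in> Mor C (\<alpha> \<otimes>\<^sub>o U) V" "\<forall>g\<in>Mor C V (\<beta> \<otimes>\<^sub>o U). t U (g \<cdot> f) = 0" for f
      using trace_nondegenerate_right[OF U, of f V] that arrI[OF obs(1) Vo] arrD(3) by force
    show "t V ((ident C \<beta> \<otimes>\<^sub>m g) \<cdot> f) = t U (f \<cdot> (ident C \<alpha> \<otimes>\<^sub>m g))"
      if "f \<in> Mor C (\<alpha> \<otimes>\<^sub>o V) (\<beta> \<otimes>\<^sub>o U)" "g \<in> Mor C U V" for f g
      by (rule trace_cyclic[OF U V]) (use that Uo Vo tuple_objects in \<open>simp_all add: arr_def\<close>)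
  qed
qed

end

end

theorem theorem6p2:
  fixes C :: "('o, 'm, 'k::alg_closed_field) piv_cat" and P :: 'o
  assumes "pivotal_tensor_category C"
    and "abelian_category C"
    and "locally_finite C"
    and "enough_projectives C"
    and "projective C P"
    and "indecomposable C P"
  shows "(\<exists>\<alpha> \<beta> \<eta> \<epsilon>. corresponding_tuple C P \<alpha> \<beta> \<eta> \<epsilon>) \<and>
    (\<forall>\<alpha> \<beta> \<eta> \<epsilon>. corresponding_tuple C P \<alpha> \<beta> \<eta> \<epsilon> \<longrightarrow>
       trace_tuple C P \<alpha> \<beta> \<eta> \<epsilon> \<and>
       (\<exists>t. associated_right_trace C P \<alpha> \<beta> \<eta> \<epsilon> t) \<and>
       (\<forall>t. associated_right_trace C P \<alpha> \<beta> \<eta> \<epsilon> t \<longrightarrow>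
          twisted_calabi_yau (full_subcategory C (projective C))
            (left_tensor_functor C \<alpha>) (left_tensor_functor C \<beta>) t))"
proof -
  interpret finite_pivotal_category C
    using assms by (intro finite_pivotal_category.intro finite_abelian_category.intro
        finite_abelian_category_axioms.intro)
  show ?thesis
  proof (intro conjI allI impI)
    show "\<exists>\<alpha> \<beta> \<eta> \<epsilon>. corresponding_tuple C P \<alpha> \<beta> \<eta> \<epsilon>"
      by (rule corresponding_tuple_exists) fact+
    fix \<alpha> \<beta> \<eta> \<epsilon> assume tup: "corresponding_tuple C P \<alpha> \<beta> \<eta> \<epsilon>"
    interpret T: projective_trace_tuple C P \<alpha> \<beta> \<eta> \<epsilon>
      by unfold_locales (use assms tup in auto)
    show "trace_tuple C P \<alpha> \<beta> \<eta> \<epsilon>" by (rule T.is_trace_tuple)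
    show "\<exists>t. associated_right_trace C P \<alpha> \<beta> \<eta> \<epsilon> t" by (rule T.associated_right_trace_exists)
    fix t assume "associated_right_trace C P \<alpha> \<beta> \<eta> \<epsilon> t"
    then show "twisted_calabi_yau (full_subcategory C (projective C))
        (left_tensor_functor C \<alpha>) (left_tensor_functor C \<beta>) t"
      by (rule T.projectives_twisted_calabi_yau)
  qed
qed

end
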